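(* Let $d\ge2$. Let $\Omega\subset\mathbb{R}^d_+$ be open and bounded with Lipschitz boundary, and let $f:\mathbb{R}^d\to[0,\infty)$ be a probability density such that there is a continuous nondecreasing $m:[0,\infty)\to[0,\infty)$ with $m(0)=0$ and $|f(x)-f(y)|\le m(|x-y|)$ for $x,y\in\Omega$, and $f(x)=0$ for $x\notin\Omega$. Let $X_1,X_2,\dots$ be i.i.d. with density $f$. Then for every $z\in\mathbb{R}^d$, \[\liminf_{n\to\infty}n^{-1/d}u_n(z)\ge c_dU(z)\quad\text{almost surely.}\]
   Context: $x\leqq y$ means $x_i\le y_i$ for all $i$; $\mathbb{R}^d_+=\{x:x_i>0\ \forall i\}$. $u_n(x)$ is the length of a longest chain (subset totally ordered by $\leqq$) in $\{X_i: 1\le i\le n,\ X_i\leqq x\}$. $\mathcal{A}$ is the set of $\gamma\in C^1([0,1];\mathbb{R}^d)$ with all components of $\gamma'(t)$ nonnegative and $\gamma'(t)\ne0$ for every $t$; $U(x)=\sup\{\int_0^1 f(\gamma(t))^{1/d}(\gamma_1'(t)\cdots\gamma_d'(t))^{1/d}dt:\gamma\in\mathcal{A},\ \gamma(t)\leqq x\ \forall t\}$. $c_d$ is the positive constant such that, for i.i.d. uniform points on $[0,1]^d$, $n^{-1/d}$ times the length of a longest chain among the first $n$ points converges almost surely to $c_d$. *)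

theory Defs
  imports "HOL-Probability.Probability"
begin

definition vle :: "real^'d \<Rightarrow> real^'d \<Rightarrow> bool" where
  "vle x y \<longleftrightarrow> (\<forall>i. x $ i \<le> y $ i)"

definition longest_chain :: "(real^'d) set \<Rightarrow> nat" where
  "longest_chain S = Max (card ` {C. C \<subseteq> S \<and> Complete_Partial_Order.chain vle C})"

text \<open>u_n(x): longest chain among X_1..X_n (here indexed 0..n-1) lying below x.\<close>
definition u_n :: "(nat \<Rightarrow> 'a \<Rightarrow> real^'d) \<Rightarrow> nat \<Rightarrow> real^'d \<Rightarrow> 'a \<Rightarrow> nat" where
  "u_n X n x \<omega> = longest_chain {X i \<omega> | i. i < n \<and> vle (X i \<omega>) x}"

text \<open>Lipschitz boundary: locally, in a rotated coordinate frame (unit normal e),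
  the set is the strict subgraph of a Lipschitz function on the hyperplane orthogonal to e.\<close>
definition lipschitz_boundary :: "('a::euclidean_space) set \<Rightarrow> bool" where
  "lipschitz_boundary \<Omega> \<longleftrightarrow>
     (\<forall>p\<in>frontier \<Omega>. \<exists>r>0. \<exists>e L g. norm e = 1 \<and> L-lipschitz_on {y. y \<bullet> e = 0} g \<and>
        (\<forall>x\<in>ball p r. x \<in> \<Omega> \<longleftrightarrow> (x - p) \<bullet> e < g ((x - p) - ((x - p) \<bullet> e) *\<^sub>R e)))"

definition admissible :: "(real \<Rightarrow> real^'d) \<Rightarrow> bool" where
  "admissible \<gamma> \<longleftrightarrow> (\<exists>\<gamma>'. continuous_on {0..1} \<gamma>' \<and>
      (\<forall>t\<in>{0..1}. (\<gamma> has_vector_derivative \<gamma>' t) (at t within {0..1}) \<and>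
                  (\<forall>i. 0 \<le> \<gamma>' t $ i) \<and> \<gamma>' t \<noteq> 0))"

definition curve_value :: "(real^'d \<Rightarrow> real) \<Rightarrow> (real \<Rightarrow> real^'d) \<Rightarrow> real" where
  "curve_value f \<gamma> = integral {0..1} (\<lambda>t.
      f (\<gamma> t) powr (1 / real CARD('d)) *
      (\<Prod>i\<in>UNIV. vector_derivative \<gamma> (at t within {0..1}) $ i) powr (1 / real CARD('d)))"

definition U_fun :: "(real^'d \<Rightarrow> real) \<Rightarrow> real^'d \<Rightarrow> real" where
  "U_fun f x = (SUP \<gamma>\<in>{\<gamma>. admissible \<gamma> \<and> (\<forall>t\<in>{0..1}. vle (\<gamma> t) x)}. curve_value f \<gamma>)"

text \<open>c_d: the positive constant such that for i.i.d. uniform points on [0,1]^d,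
  n^(-1/d) times the longest chain among the first n points converges a.s. to it.
  The sample space is fixed to the type (nat => real^d) measure (which carries such sequences).\<close>
definition chain_const :: "'d::finite itself \<Rightarrow> real" where
  "chain_const _ = (THE c. 0 < c \<and>
     (\<forall>(M::(nat \<Rightarrow> real^'d) measure) (Y::nat \<Rightarrow> (nat \<Rightarrow> real^'d) \<Rightarrow> real^'d).
        prob_space M \<and> prob_space.indep_vars M (\<lambda>_. borel) Y UNIV \<and>
        (\<forall>i. distributed M lborel (Y i) (\<lambda>x. indicator (cbox 0 One) x)) \<longrightarrow>
        (AE \<omega> in M. (\<lambda>n. real n powr (- 1 / real CARD('d)) * real (longest_chain {Y i \<omega> | i. i < n}))
                      \<longlonglongrightarrow> c)))"

end

theory Submission
  imports Defs "HOL-Real_Asymp.Real_Asymp"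
begin

text \<open>
  For \<open>n\<close> uniform points in the cube, stacking \<open>k\<close> boxes of side \<open>1/k\<close> along the diagonal makes the
  expected longest chain almost superadditive, so after division by \<open>n powr (1/d)\<close> it converges; the limit
  is positive, and finite by a first moment bound on chains. The variance of the longest chain is at most
  its mean, hence Chebyshev and Borel--Cantelli along \<open>n = k ^ (2 * d)\<close> give almost sure
  convergence, which identifies the limit with \<open>chain_const\<close>.

  If the density is at least \<open>\<mu>\<close> on a box \<open>B\<close>, then among \<open>n\<close> points there are about
  \<open>n * \<mu> * vol B\<close> uniform points of \<open>B\<close>, so the chains inside \<open>B\<close> have length at least
  about \<open>chain_const * (n * \<mu> * vol B) powr (1/d)\<close>. The boxes spanned by consecutive points of an increasing
  curve below \<open>z\<close> are stacked, so their chains concatenate. Since the density is lower semicontinuous,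
  Fatou's lemma shows that the resulting lower sums exhaust the curve functional.
\<close>

subsection \<open>Chains\<close>

text \<open>No coupling of point sets is constructed. The expectation at \<open>n\<close> points of
  one law is an iterated average over one inserted point, so the variance bound and the comparison
  of two laws are inductions that peel off a point; probabilities enter as expectations of indicator
  functionals. Points of a box are compared with uniform ones in this way: the law dominates a
  multiple \<open>p\<close> of the uniform law of the box, and the expectation of a monotone
  functional is bounded below by a binomial mixture, whose lower tail Chebyshev controls.

  Since variance and mean are both of order \<open>n powr (1/d)\<close>, relative deviations have
  probability of order \<open>n powr (- 1/d)\<close>, which is \<open>1 / k ^ 2\<close> at
  \<open>n = k ^ (2 * d)\<close>: hence that subsequence. Monotonicity in \<open>n\<close> fills the
  gaps.

  \<open>chain_const\<close> is a definite description over sample spaces of one type, so existence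
  and uniqueness come before any other statement about it, and uniqueness calls for a concrete
  sequence of points. \<open>U_fun\<close> is a real supremum, so the curve functional must first be
  bounded on the curves concerned.\<close>

lemma vle_refl [simp]: "vle x x"
  by (simp add: vle_def)

lemma vle_trans: "vle x y \<Longrightarrow> vle y z \<Longrightarrow> vle x z"
  unfolding vle_def by (meson order_trans)

lemma finite_chain_cards:
  assumes "finite S"
  shows "finite (card ` {C. C \<subseteq> S \<and> Complete_Partial_Order.chain vle C})"
    and "card ` {C. C \<subseteq> S \<and> Complete_Partial_Order.chain vle C} \<noteq> {}"
proof -
  have "{C. C \<subseteq> S \<and> Complete_Partial_Order.chain vle C} \<subseteq> Pow S" by auto
  with assms show "finite (card ` {C. C \<subseteq> S \<and> Complete_Partial_Order.chain vle C})"
    by (meson finite_Pow_iff finite_imageI finite_subset)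
  have "{} \<in> {C. C \<subseteq> S \<and> Complete_Partial_Order.chain vle C}"
    by (simp add: chain_def)
  then show "card ` {C. C \<subseteq> S \<and> Complete_Partial_Order.chain vle C} \<noteq> {}" by blast
qed

lemma longest_chain_ge:
  assumes "finite S" "C \<subseteq> S" "Complete_Partial_Order.chain vle C"
  shows "card C \<le> longest_chain S"
  unfolding longest_chain_def using assms finite_chain_cards[OF assms(1)]
  by (intro Max_ge) auto

lemma longest_chain_witness:
  assumes "finite S"
  obtains C where "C \<subseteq> S" "Complete_Partial_Order.chain vle C" "card C = longest_chain S"
  using Max_in[OF finite_chain_cards[OF assms]] that unfolding longest_chain_def by auto

lemma chain_vle_subset: "Complete_Partial_Order.chain vle C \<Longrightarrow> D \<subseteq> C \<Longrightarrow> Complete_Partial_Order.chain vle D"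
  by (auto simp: chain_def)

text \<open>Subsets of chains are chains, so every size up to the maximum occurs. A bound on the
  maximum thus becomes the existence of a chain of exact size, as measurability and the union bound
  require.\<close>

lemma le_longest_chain_iff:
  assumes "finite S"
  shows "k \<le> longest_chain S \<longleftrightarrow> (\<exists>C\<subseteq>S. Complete_Partial_Order.chain vle C \<and> card C = k)"
proof
  assume k: "k \<le> longest_chain S"
  obtain C where C: "C \<subseteq> S" "Complete_Partial_Order.chain vle C" "card C = longest_chain S"
    using longest_chain_witness[OF assms] .
  obtain D where "D \<subseteq> C" "card D = k"
    using k C by (metis obtain_subset_with_card_n)
  then show "\<exists>C\<subseteq>S. Complete_Partial_Order.chain vle C \<and> card C = k"
    using C chain_vle_subset by (intro exI[of _ D]) auto
qed (use longest_chain_ge[OF assms] in auto)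

lemma longest_chain_mono:
  assumes "finite T" "S \<subseteq> T"
  shows "longest_chain S \<le> longest_chain T"
  by (metis assms finite_subset longest_chain_ge longest_chain_witness order_trans)

lemma longest_chain_le_card:
  assumes "finite S"
  shows "longest_chain S \<le> card S"
  by (metis assms card_mono longest_chain_witness)

lemma longest_chain_empty [simp]: "longest_chain {} = 0"
  using longest_chain_le_card[of "{}"] by simp

lemma longest_chain_singleton [simp]: "longest_chain {x} = 1"
  using longest_chain_le_card[of "{x}"] longest_chain_ge[of "{x}" "{x}"]
  by (auto simp: chain_def)

lemma longest_chain_insert_le:
  assumes "finite S"
  shows "longest_chain (insert y S) \<le> longest_chain S + 1"
proof -
  obtain C where C: "C \<subseteq> insert y S" "Complete_Partial_Order.chain vle C" "card C = longest_chain (insert y S)"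
    using longest_chain_witness[of "insert y S"] assms by auto
  have "card (C - {y}) \<le> longest_chain S"
    using C assms by (intro longest_chain_ge) (auto intro: chain_vle_subset)
  moreover have "card C \<le> card (C - {y}) + 1"
    by (cases "y \<in> C") (auto simp: card_Diff_singleton)
  ultimately show ?thesis using C by simp
qed

lemma longest_chain_embedding:
  assumes "finite S" and emb: "\<And>x y. vle (\<phi> x) (\<phi> y) \<longleftrightarrow> vle x y" and inj: "inj \<phi>"
  shows "longest_chain (\<phi> ` S) = longest_chain S"
proof (rule antisym)
  obtain C where C: "C \<subseteq> S" "Complete_Partial_Order.chain vle C" "card C = longest_chain S"
    using longest_chain_witness[OF assms(1)] .
  have "card (\<phi> ` C) \<le> longest_chain (\<phi> ` S)"
    using C assms(1) by (intro longest_chain_ge) (auto simp: chain_def emb)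
  then show "longest_chain S \<le> longest_chain (\<phi> ` S)"
    using C inj by (simp add: card_image inj_on_subset)
next
  obtain C where C: "C \<subseteq> \<phi> ` S" "Complete_Partial_Order.chain vle C" "card C = longest_chain (\<phi> ` S)"
    using longest_chain_witness[of "\<phi> ` S"] assms(1) by auto
  obtain D where D: "D \<subseteq> S" "C = \<phi> ` D" using C(1) by (meson subset_imageE)
  have "card D \<le> longest_chain S"
    using C D assms(1) by (intro longest_chain_ge) (auto simp: chain_def emb)
  then show "longest_chain (\<phi> ` S) \<le> longest_chain S"
    using C D inj by (simp add: card_image inj_on_subset)
qed

lemma longest_chain_stack:
  assumes "finite S" "finite T" "S \<inter> T = {}" "\<And>x y. x \<in> S \<Longrightarrow> y \<in> T \<Longrightarrow> vle x y"
  shows "longest_chain S + longest_chain T \<le> longest_chain (S \<union> T)"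
proof -
  obtain C where C: "C \<subseteq> S" "Complete_Partial_Order.chain vle C" "card C = longest_chain S"
    using longest_chain_witness[OF assms(1)] .
  obtain D where D: "D \<subseteq> T" "Complete_Partial_Order.chain vle D" "card D = longest_chain T"
    using longest_chain_witness[OF assms(2)] .
  have "card (C \<union> D) = card C + card D"
    using C D assms by (intro card_Un_disjoint) (auto intro: finite_subset)
  moreover have "card (C \<union> D) \<le> longest_chain (S \<union> T)"
  proof (rule longest_chain_ge)
    show "Complete_Partial_Order.chain vle (C \<union> D)"
      using C D assms(4) unfolding chain_def by blast
  qed (use C D assms in auto)
  ultimately show ?thesis using C D by simp
qed

text \<open>The condition \<open>x \<noteq> y\<close> makes the layers disjoint, so that
  cardinalities add; comparability across layers makes the union of their chains a chain.\<close>

lemma longest_chain_stack_sum: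
  fixes B :: "nat \<Rightarrow> (real^'d) set"
  assumes "finite S"
    and "\<And>i j x y. i < j \<Longrightarrow> j < N \<Longrightarrow> x \<in> B i \<Longrightarrow> y \<in> B j \<Longrightarrow> vle x y \<and> x \<noteq> y"
  shows "(\<Sum>j<N. longest_chain (S \<inter> B j)) \<le> longest_chain (S \<inter> (\<Union>j<N. B j))"
  using assms(2)
proof (induction N)
  case (Suc N)
  have "(\<Sum>j<Suc N. longest_chain (S \<inter> B j)) \<le>
      longest_chain (S \<inter> (\<Union>j<N. B j)) + longest_chain (S \<inter> B N)"
    using Suc.IH Suc.prems by (auto intro: less_SucI)
  also have "\<dots> \<le> longest_chain ((S \<inter> (\<Union>j<N. B j)) \<union> (S \<inter> B N))"
  proof (rule longest_chain_stack)
    show "(S \<inter> (\<Union>j<N. B j)) \<inter> (S \<inter> B N) = {}" using Suc.prems by blast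
    show "vle x y" if "x \<in> S \<inter> (\<Union>j<N. B j)" "y \<in> S \<inter> B N" for x y
      using Suc.prems that by blast
  qed (use assms(1) in auto)
  also have "(S \<inter> (\<Union>j<N. B j)) \<union> (S \<inter> B N) = S \<inter> (\<Union>j<Suc N. B j)"
    by (auto simp: less_Suc_eq)
  finally show ?case .
qed auto

text \<open>A point outside a fixed longest chain can be removed without loss, so at most
  \<open>longest_chain\<close> many removals decrease the maximal length, each by at most one.\<close>

lemma sum_longest_chain_remove:
  fixes x :: "'i \<Rightarrow> real^'d"
  assumes I: "finite I"
  shows "(real (card I) - 1) * real (longest_chain (x ` I \<inter> B))
       \<le> (\<Sum>i\<in>I. real (longest_chain (x ` (I - {i}) \<inter> B)))"
proof -
  let ?L = "longest_chain (x ` I \<inter> B)"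
  obtain C where C: "C \<subseteq> x ` I \<inter> B" "Complete_Partial_Order.chain vle C" "card C = ?L"
    using longest_chain_witness[of "x ` I \<inter> B"] I by auto
  \<comment> \<open>\<open>x\<close> may repeat points; \<open>J\<close> holds one index for each
    point of the chain.\<close>
  then obtain J where J: "J \<subseteq> I" "inj_on x J" "C = x ` J"
    by (metis Int_subset_iff subset_image_inj)
  have cJ: "card J = ?L" using C J by (metis card_image)
  have fJ: "finite J" using I J finite_subset by blast
  have 1: "?L \<le> longest_chain (x ` (I - {i}) \<inter> B)" if "i \<in> I - J" for i
    using C J that I by (subst C(3)[symmetric], intro longest_chain_ge) auto
  have 2: "?L - 1 \<le> longest_chain (x ` (I - {i}) \<inter> B)" if "i \<in> J" for i
  proof -
    have "x ` I \<inter> B \<subseteq> insert (x i) (x ` (I - {i}) \<inter> B)" by auto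
    then have "?L \<le> longest_chain (insert (x i) (x ` (I - {i}) \<inter> B))"
      using I by (intro longest_chain_mono) auto
    also have "\<dots> \<le> longest_chain (x ` (I - {i}) \<inter> B) + 1"
      using I by (intro longest_chain_insert_le) auto
    finally show ?thesis by simp
  qed
  \<comment> \<open>\<open>card I - ?L\<close> removals leave the chain intact, the other
    \<open>?L\<close> cost at most one each, and
    \<open>(card I - ?L) * ?L + ?L * (?L - 1) = (card I - 1) * ?L\<close>.\<close>
  have "(real (card I) - 1) * real ?L = (\<Sum>i\<in>I-J. real ?L) + (\<Sum>i\<in>J. real ?L - 1)"
  proof -
    have *: "real (card (I - J)) = real (card I) - real ?L"
      using I J fJ cJ by (simp add: card_Diff_subset card_mono of_nat_diff flip: cJ)
    show ?thesis unfolding sum_constant * cJ by (simp add: left_diff_distrib right_diff_distrib)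
  qed
  also have "\<dots> \<le> (\<Sum>i\<in>I-J. real (longest_chain (x ` (I - {i}) \<inter> B))) + (\<Sum>i\<in>J. real (longest_chain (x ` (I - {i}) \<inter> B)))"
  proof (intro add_mono sum_mono)
    show "real ?L - 1 \<le> real (longest_chain (x ` (I - {i}) \<inter> B))" if "i \<in> J" for i
      using 2[OF that] by linarith
  qed (use 1 in auto)
  also have "\<dots> = (\<Sum>i\<in>I. real (longest_chain (x ` (I - {i}) \<inter> B)))"
    using I J by (metis sum.subset_diff)
  finally show ?thesis .
qed

subsection \<open>Expectations of functionals of independent points\<close>

text \<open>Functionals of the set of points are blind to order and indices, so points can be
  reindexed at will. The bound in terms of the cardinality alone gives integrability under every
  probability law.\<close>

definition point_functional :: "('b::topological_space set \<Rightarrow> real) \<Rightarrow> bool" where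
  "point_functional F \<longleftrightarrow>
     (\<forall>J::nat set. finite J \<longrightarrow> (\<lambda>x. F (x ` J)) \<in> borel_measurable (PiM J (\<lambda>_. borel))) \<and>
     (\<forall>n. \<exists>C. \<forall>S. finite S \<and> card S \<le> n \<longrightarrow> \<bar>F S\<bar> \<le> C)"

definition iid_exp :: "'b::topological_space measure \<Rightarrow> nat \<Rightarrow> ('b set \<Rightarrow> real) \<Rightarrow> real" where
  "iid_exp \<nu> n F = (\<integral>x. F (x ` {..<n}) \<partial>PiM {..<n} (\<lambda>_. \<nu>))"

text \<open>The operator that averages over one additional point. For a probability law, Fubini
  shows that \<open>n\<close> applications followed by evaluation at the empty set give
  \<open>iid_exp \<nu> n F\<close>.\<close>

definition insert_avg :: "'b::topological_space measure \<Rightarrow> ('b set \<Rightarrow> real) \<Rightarrow> 'b set \<Rightarrow> real" where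
  "insert_avg \<nu> F S = (\<integral>y. F (insert y S) \<partial>\<nu>)"

lemma point_functional_bounded:
  assumes "point_functional F"
  obtains C where "C \<ge> 0" "\<And>S. finite S \<Longrightarrow> card S \<le> n \<Longrightarrow> \<bar>F S\<bar> \<le> C"
proof -
  obtain C where C: "\<forall>S. finite S \<and> card S \<le> n \<longrightarrow> \<bar>F S\<bar> \<le> C"
    using assms unfolding point_functional_def by blast
  have "\<bar>F {}\<bar> \<le> C" using C by simp
  then show ?thesis using C by (intro that[of C]) auto
qed

lemma point_functional_borel:
  fixes J :: "nat set"
  assumes "point_functional F" "finite J"
  shows "(\<lambda>x. F (x ` J)) \<in> borel_measurable (PiM J (\<lambda>_. borel))"
  using assms unfolding point_functional_def by simp

lemma point_functional_measurable:
  fixes J :: "nat set"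
  assumes "point_functional F" "finite J" "\<And>i. i \<in> J \<Longrightarrow> sets (\<nu> i) = sets borel"
  shows "(\<lambda>x. F (x ` J)) \<in> borel_measurable (PiM J \<nu>)"
proof -
  have "sets (PiM J \<nu>) = sets (PiM J (\<lambda>_. borel))"
    using assms by (intro sets_PiM_cong) auto
  then have "(borel_measurable (PiM J \<nu>) :: (_ \<Rightarrow> real) set) = borel_measurable (PiM J (\<lambda>_. borel))"
    by (rule measurable_cong_sets) simp
  then show ?thesis
    using assms(1,2) by (simp add: point_functional_def)
qed

lemma point_functional_integrable:
  fixes J :: "nat set"
  assumes F: "point_functional F" and J: "finite J"
    and \<nu>: "\<And>i. i \<in> J \<Longrightarrow> prob_space (\<nu> i)" "\<And>i. i \<in> J \<Longrightarrow> sets (\<nu> i) = sets borel"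
  shows "integrable (PiM J \<nu>) (\<lambda>x. F (x ` J))"
proof -
  interpret P: prob_space "PiM J \<nu>" using \<nu>(1) by (rule prob_space_PiM)
  obtain C where "\<And>S. finite S \<Longrightarrow> card S \<le> card J \<Longrightarrow> \<bar>F S\<bar> \<le> C"
    using point_functional_bounded[OF F] by blast
  then show ?thesis
    using J by (intro P.integrable_const_bound[where B = C] point_functional_measurable[OF F J \<nu>(2)])
      (auto simp: card_image_le)
qed

text \<open>A fresh index turns the inserted point into one more coordinate of a product space.
  Joint measurability is what makes \<open>insert_avg\<close> measurable again.\<close>

lemma measurable_insert_image:
  fixes J :: "nat set"
  assumes F: "point_functional F" and J: "finite J"
  shows "(\<lambda>(x, y). F (insert y (x ` J))) \<in> borel_measurable (PiM J (\<lambda>_. borel) \<Otimes>\<^sub>M borel)"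
proof -
  obtain i where i: "i \<notin> J" using J ex_new_if_finite infinite_UNIV_nat by blast
  have "(\<lambda>(x, y). x(i := y)) \<in> measurable (PiM J (\<lambda>_. borel) \<Otimes>\<^sub>M borel) (PiM (insert i J) (\<lambda>_. borel))"
    by (rule measurable_add_dim)
  moreover have "(\<lambda>x. F (x ` insert i J)) \<in> borel_measurable (PiM (insert i J) (\<lambda>_. borel))"
    using F J by (intro point_functional_borel) auto
  ultimately have "(\<lambda>x. F (x ` insert i J)) \<circ> (\<lambda>(x, y). x(i := y)) \<in> borel_measurable (PiM J (\<lambda>_. borel) \<Otimes>\<^sub>M borel)"
    by (rule measurable_comp)
  also have "(\<lambda>x. F (x ` insert i J)) \<circ> (\<lambda>(x, y). x(i := y)) = (\<lambda>(x, y). F (insert y (x ` J)))"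
    using i by (auto simp: fun_eq_iff image_iff intro!: arg_cong[where f = F])
  finally show ?thesis .
qed

lemma measurable_insert:
  assumes F: "point_functional F" and S: "finite S"
  shows "(\<lambda>y. F (insert y S)) \<in> borel_measurable borel"
proof -
  obtain h :: "nat \<Rightarrow> 'a" and n where h: "S = h ` {..<n}"
    using S by (metis finite_imp_nat_seg_image_inj_on lessThan_def)
  let ?x = "\<lambda>i\<in>{..<n}. h i"
  have "(\<lambda>(x, y). F (insert y (x ` {..<n}))) \<circ> (\<lambda>y. (?x, y)) \<in> borel_measurable borel"
  proof (rule measurable_comp)
    show "(\<lambda>y. (?x, y)) \<in> borel \<rightarrow>\<^sub>M PiM {..<n} (\<lambda>_. borel) \<Otimes>\<^sub>M borel"
      by (intro measurable_Pair measurable_const measurable_ident) (auto simp: space_PiM)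
  qed (rule measurable_insert_image[OF F], simp)
  then show ?thesis using h by (simp add: comp_def)
qed

lemma integrable_insert:
  assumes F: "point_functional F" and S: "finite S" and \<nu>: "prob_space \<nu>" "sets \<nu> = sets borel"
  shows "integrable \<nu> (\<lambda>y. F (insert y S))"
proof -
  interpret prob_space \<nu> by fact
  obtain C where "\<And>T. finite T \<Longrightarrow> card T \<le> card S + 1 \<Longrightarrow> \<bar>F T\<bar> \<le> C"
    using point_functional_bounded[OF F] by blast
  then show ?thesis
    using S measurable_insert[OF F S] \<nu>(2) measurable_cong_sets[OF \<nu>(2) refl]
    by (intro integrable_const_bound[where B = C]) (auto simp: card_insert_if)
qed

lemma insert_avg_bounds:
  assumes F: "point_functional F" and S: "finite S" and \<nu>: "prob_space \<nu>" "sets \<nu> = sets borel"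
    and b: "\<And>y. a \<le> F (insert y S)" "\<And>y. F (insert y S) \<le> b"
  shows "a \<le> insert_avg \<nu> F S" "insert_avg \<nu> F S \<le> b"
proof -
  interpret prob_space \<nu> by fact
  show "a \<le> insert_avg \<nu> F S" "insert_avg \<nu> F S \<le> b"
    unfolding insert_avg_def
    using integrable_insert[OF F S \<nu>] b by (auto intro: integral_ge_const integral_le_const)
qed

lemma point_functional_insert_avg:
  assumes F: "point_functional F" and \<nu>: "prob_space \<nu>" "sets \<nu> = sets borel"
  shows "point_functional (insert_avg \<nu> F)"
  unfolding point_functional_def
proof safe
  interpret prob_space \<nu> by fact
  fix J :: "nat set" assume J: "finite J"
  have "(\<lambda>(x, y). F (insert y (x ` J))) \<in> borel_measurable (PiM J (\<lambda>_. borel) \<Otimes>\<^sub>M \<nu>)"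
    using measurable_insert_image[OF F J]
      measurable_cong_sets[OF sets_pair_measure_cong[OF refl \<nu>(2)] refl] by blast
  then show "(\<lambda>x. insert_avg \<nu> F (x ` J)) \<in> borel_measurable (PiM J (\<lambda>_. borel))"
    unfolding insert_avg_def by (rule borel_measurable_lebesgue_integral)
next
  fix n
  obtain C where C: "\<And>T. finite T \<Longrightarrow> card T \<le> n + 1 \<Longrightarrow> \<bar>F T\<bar> \<le> C"
    using point_functional_bounded[OF F] by blast
  have "\<bar>insert_avg \<nu> F S\<bar> \<le> C" if "finite S" "card S \<le> n" for S
  proof -
    have "\<bar>F (insert y S)\<bar> \<le> C" for y using that by (intro C) (auto simp: card_insert_if)
    then have "-C \<le> insert_avg \<nu> F S" "insert_avg \<nu> F S \<le> C"
      using insert_avg_bounds[OF F that(1) \<nu>, of "-C" C] by (auto simp: abs_le_iff minus_le_iff)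
    then show ?thesis by auto
  qed
  then show "\<exists>C. \<forall>S. finite S \<and> card S \<le> n \<longrightarrow> \<bar>insert_avg \<nu> F S\<bar> \<le> C" by blast
qed

lemma point_functional_const: "point_functional (\<lambda>_. c)"
  by (auto simp: point_functional_def)

lemma point_functional_add:
  assumes "point_functional F" "point_functional G"
  shows "point_functional (\<lambda>S. F S + G S)"
  unfolding point_functional_def
proof safe
  fix n
  obtain C where C: "\<And>T. finite T \<Longrightarrow> card T \<le> n \<Longrightarrow> \<bar>F T\<bar> \<le> C"
    using point_functional_bounded[OF assms(1)] by blast
  obtain D where D: "\<And>T. finite T \<Longrightarrow> card T \<le> n \<Longrightarrow> \<bar>G T\<bar> \<le> D"
    using point_functional_bounded[OF assms(2)] by blast
  show "\<exists>C. \<forall>S. finite S \<and> card S \<le> n \<longrightarrow> \<bar>F S + G S\<bar> \<le> C"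
    using C D by (intro exI[of _ "C + D"]) (smt (verit))
qed (intro borel_measurable_add point_functional_borel assms)

lemma point_functional_mult:
  assumes "point_functional F" "point_functional G"
  shows "point_functional (\<lambda>S. F S * G S)"
  unfolding point_functional_def
proof safe
  fix n
  obtain C where C: "C \<ge> 0" "\<And>T. finite T \<Longrightarrow> card T \<le> n \<Longrightarrow> \<bar>F T\<bar> \<le> C"
    using point_functional_bounded[OF assms(1)] by blast
  obtain D where D: "\<And>T. finite T \<Longrightarrow> card T \<le> n \<Longrightarrow> \<bar>G T\<bar> \<le> D"
    using point_functional_bounded[OF assms(2)] by blast
  show "\<exists>C. \<forall>S. finite S \<and> card S \<le> n \<longrightarrow> \<bar>F S * G S\<bar> \<le> C"
    using C D by (intro exI[of _ "C * D"]) (auto simp: abs_mult intro!: mult_mono)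
qed (intro borel_measurable_times point_functional_borel assms)

lemma point_functional_diff:
  assumes "point_functional F" "point_functional G"
  shows "point_functional (\<lambda>S. F S - G S)"
  using point_functional_add[OF assms(1) point_functional_mult[OF point_functional_const[of "-1"] assms(2)]]
  by simp

lemma point_functional_sum:
  assumes "\<And>i. i \<in> A \<Longrightarrow> point_functional (F i)"
  shows "point_functional (\<lambda>S. \<Sum>i\<in>A. F i S)"
  using assms
  by (induction A rule: infinite_finite_induct) (auto intro: point_functional_const point_functional_add)

text \<open>Lets tail probabilities be treated as expectations.\<close>

lemma point_functional_indicator:
  assumes "point_functional F" "A \<in> sets borel"
  shows "point_functional (\<lambda>S. indicator A (F S))"
  unfolding point_functional_def
proof safe
  fix n show "\<exists>C. \<forall>S. finite S \<and> card S \<le> n \<longrightarrow> \<bar>indicator A (F S)\<bar> \<le> (C::real)"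
    by (intro exI[of _ 1]) (auto simp: indicator_def)
qed (intro measurable_compose[OF point_functional_borel[OF assms(1)]] borel_measurable_indicator assms)

lemma point_functional_image:
  assumes F: "point_functional F" and \<phi>: "\<phi> \<in> borel_measurable borel"
  shows "point_functional (\<lambda>S. F (\<phi> ` S))"
  unfolding point_functional_def
proof safe
  fix J :: "nat set" assume J: "finite J"
  have "(\<lambda>x. F (x ` J)) \<in> borel_measurable (PiM J (\<lambda>_. borel))"
    using F J by (rule point_functional_borel)
  moreover have "(\<lambda>x. \<lambda>i\<in>J. \<phi> (x i)) \<in> PiM J (\<lambda>_. borel) \<rightarrow>\<^sub>M PiM J (\<lambda>_. borel)"
    using \<phi> by measurable
  ultimately have "(\<lambda>x. F (x ` J)) \<circ> (\<lambda>x. \<lambda>i\<in>J. \<phi> (x i)) \<in> borel_measurable (PiM J (\<lambda>_. borel))"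
    by (rule measurable_comp[rotated])
  then show "(\<lambda>x. F (\<phi> ` x ` J)) \<in> borel_measurable (PiM J (\<lambda>_. borel))"
    by (simp add: comp_def image_image)
next
  fix n
  obtain C where C: "\<And>T. finite T \<Longrightarrow> card T \<le> n \<Longrightarrow> \<bar>F T\<bar> \<le> C"
    using point_functional_bounded[OF F] by blast
  then show "\<exists>C. \<forall>S. finite S \<and> card S \<le> n \<longrightarrow> \<bar>F (\<phi> ` S)\<bar> \<le> C"
    by (intro exI[of _ C]) (meson card_image_le finite_imageI order_trans)
qed

text \<open>A chain of size \<open>k\<close> exists iff some \<open>k\<close> indices carry
  distinct, pairwise comparable points of \<open>B\<close>. This is a finite union of events
  described by membership in \<open>B\<close> and by coordinate inequalities.\<close>

lemma point_functional_longest_chain: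
  fixes B :: "(real^'d) set"
  assumes B: "B \<in> sets borel"
  shows "point_functional (\<lambda>S. real (longest_chain (S \<inter> B)))"
  unfolding point_functional_def
proof safe
  fix J :: "nat set" assume J: "finite J"
  show "(\<lambda>x. real (longest_chain (x ` J \<inter> B))) \<in> borel_measurable (PiM J (\<lambda>_. borel :: (real^'d) measure))"
  proof (rule borel_measurableI_ge)
    fix y :: real
    let ?P = "PiM J (\<lambda>_. borel :: (real^'d) measure)"
    \<comment> \<open>For \<open>y \<le> 0\<close> this is 0, and the empty index set is a
      witness.\<close>
    let ?k = "nat \<lceil>y\<rceil>"
    let ?good = "\<lambda>K x. (\<forall>i\<in>K. x i \<in> B) \<and> (\<forall>i\<in>K. \<forall>j\<in>K. i \<noteq> j \<longrightarrow> x i \<noteq> x j) \<and>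
        (\<forall>i\<in>K. \<forall>j\<in>K. (\<forall>l. x i $ l \<le> x j $ l) \<or> (\<forall>l. x j $ l \<le> x i $ l))"
    have eq: "y \<le> real (longest_chain (x ` J \<inter> B)) \<longleftrightarrow> (\<exists>K\<in>{K. K \<subseteq> J \<and> card K = ?k}. ?good K x)" for x
    proof -
      have "y \<le> real (longest_chain (x ` J \<inter> B)) \<longleftrightarrow> ?k \<le> longest_chain (x ` J \<inter> B)"
        by linarith
      also have "\<dots> \<longleftrightarrow> (\<exists>C\<subseteq>x ` J \<inter> B. Complete_Partial_Order.chain vle C \<and> card C = ?k)"
        using J by (intro le_longest_chain_iff) auto
      also have "\<dots> \<longleftrightarrow> (\<exists>K\<in>{K. K \<subseteq> J \<and> card K = ?k}. ?good K x)"
      proof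
        assume "\<exists>C\<subseteq>x ` J \<inter> B. Complete_Partial_Order.chain vle C \<and> card C = ?k"
        then obtain C where C: "C \<subseteq> x ` J" "C \<subseteq> B" "Complete_Partial_Order.chain vle C" "card C = ?k" by auto
        then obtain K where K: "K \<subseteq> J" "inj_on x K" "C = x ` K" by (meson subset_image_inj)
        then show "\<exists>K\<in>{K. K \<subseteq> J \<and> card K = ?k}. ?good K x"
          using C by (intro bexI[of _ K]) (auto simp: chain_def vle_def card_image dest: inj_onD)
      next
        assume "\<exists>K\<in>{K. K \<subseteq> J \<and> card K = ?k}. ?good K x"
        then obtain K where K: "K \<subseteq> J" "card K = ?k" "?good K x" by auto
        then have "inj_on x K" by (auto intro!: inj_onI)
        then show "\<exists>C\<subseteq>x ` J \<inter> B. Complete_Partial_Order.chain vle C \<and> card C = ?k"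
          using K by (intro exI[of _ "x ` K"]) (auto simp: chain_def vle_def card_image)
      qed
      finally show ?thesis .
    qed
    have fin: "finite {K. K \<subseteq> J \<and> card K = ?k}" using J by simp
    have "{x \<in> space ?P. \<exists>K\<in>{K. K \<subseteq> J \<and> card K = ?k}. ?good K x} \<in> sets ?P"
    proof (intro sets.sets_Collect_finite_Ex fin)
      fix K assume "K \<in> {K. K \<subseteq> J \<and> card K = ?k}"
      then have K: "K \<subseteq> J" "finite K" using J finite_subset by auto
      have c: "(\<lambda>x. x i) \<in> borel_measurable ?P" if "i \<in> K" for i
        using that K by (intro measurable_component_singleton) auto
      have cl: "(\<lambda>x. x i $ l) \<in> borel_measurable ?P" if "i \<in> K" for i l
        using measurable_compose[OF c[OF that] borel_measurable_nth[of l]] by simp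
      show "{x \<in> space ?P. ?good K x} \<in> sets ?P"
      proof (intro sets.sets_Collect_conj sets.sets_Collect_finite_All sets.sets_Collect_imp
          sets.sets_Collect_const sets.sets_Collect_disj K sets.sets_Collect_neg finite)
        show "{x \<in> space ?P. x i \<in> B} \<in> sets ?P" if "i \<in> K" for i
          using measurable_sets[OF c[OF that] B] by (simp add: vimage_def Int_def conj_commute)
        show "{x \<in> space ?P. x i = x j} \<in> sets ?P" if "i \<in> K" "j \<in> K" for i j
          unfolding vec_eq_iff by (intro sets.sets_Collect_countable_All borel_measurable_eq cl that)
        have *: "{x \<in> space ?P. \<forall>l. x i $ l \<le> x j $ l} \<in> sets ?P" if "i \<in> K" "j \<in> K" for i j
          by (intro sets.sets_Collect_countable_All borel_measurable_le cl that)
        then show "{x \<in> space ?P. \<forall>l. x i $ l \<le> x j $ l} \<in> sets ?P"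
           "{x \<in> space ?P. \<forall>l. x j $ l \<le> x i $ l} \<in> sets ?P" if "i \<in> K" "j \<in> K" for i j
          using that by auto
      qed
    qed
    then show "{x \<in> space ?P. y \<le> real (longest_chain (x ` J \<inter> B))} \<in> sets ?P"
      unfolding eq .
  qed
next
  fix n
  have "longest_chain (S \<inter> B) \<le> n" if "finite S" "card S \<le> n" for S
    using longest_chain_le_card[of "S \<inter> B"] card_mono[of S "S \<inter> B"] that by auto
  then show "\<exists>C. \<forall>S. finite S \<and> card S \<le> n \<longrightarrow> \<bar>real (longest_chain (S \<inter> B))\<bar> \<le> C"
    by (intro exI[of _ "real n"]) auto
qed

section \<open>Moments of set functionals under one fixed law\<close>

locale point_law = prob_space \<nu> for \<nu> :: "'b::topological_space measure" +
  assumes sets_law: "sets \<nu> = sets borel"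
begin

lemma iid_exp_insert:
  fixes J :: "nat set"
  assumes F: "point_functional F" and J: "finite J" "i \<notin> J"
  shows "(\<integral>x. F (x ` insert i J) \<partial>PiM (insert i J) (\<lambda>_. \<nu>)) = (\<integral>x. insert_avg \<nu> F (x ` J) \<partial>PiM J (\<lambda>_. \<nu>))"
proof -
  interpret product_sigma_finite "\<lambda>_::nat. \<nu>" by standard
  have "(\<integral>x. F (x ` insert i J) \<partial>PiM (insert i J) (\<lambda>_. \<nu>)) =
      (\<integral>x. (\<integral>y. F ((x(i := y)) ` insert i J) \<partial>\<nu>) \<partial>PiM J (\<lambda>_. \<nu>))"
    using J by (intro product_integral_insert point_functional_integrable F) (auto simp: sets_law prob_space_axioms)
  moreover have "(x(i := y)) ` insert i J = insert y (x ` J)" for x :: "nat \<Rightarrow> 'b" and y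
    using J by (auto simp: image_iff)
  ultimately show ?thesis by (simp only: insert_avg_def)
qed

lemma iid_exp_0 [simp]: "iid_exp \<nu> 0 F = F {}"
  using prob_space.prob_space[OF prob_space_PiM[of "{}::nat set" "\<lambda>_. \<nu>"]] by (simp add: iid_exp_def)

lemma iid_exp_Suc:
  assumes "point_functional F"
  shows "iid_exp \<nu> (Suc n) F = iid_exp \<nu> n (insert_avg \<nu> F)"
  using iid_exp_insert[OF assms, of "{..<n}" n] by (simp add: iid_exp_def lessThan_Suc)

lemma point_functional_avg: "point_functional F \<Longrightarrow> point_functional (insert_avg \<nu> F)"
  using point_functional_insert_avg prob_space_axioms sets_law by blast

lemma iid_exp_PiM:
  fixes J :: "nat set"
  assumes "finite J" "point_functional F"
  shows "(\<integral>x. F (x ` J) \<partial>PiM J (\<lambda>_. \<nu>)) = iid_exp \<nu> (card J) F"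
  using assms
proof (induction J arbitrary: F rule: finite_induct)
  case empty
  then show ?case
    using prob_space.prob_space[OF prob_space_PiM[of "{}::nat set" "\<lambda>_. \<nu>"]] by simp
next
  case (insert i J)
  then show ?case
    by (simp add: iid_exp_insert iid_exp_Suc point_functional_avg del: image_insert)
qed

text \<open>The remaining \<open>n - 1\<close> points are again independent with the same law; this
  is how the pointwise removal inequality is averaged.\<close>

lemma iid_exp_remove:
  assumes F: "point_functional F" and i: "i < n"
  shows "(\<integral>x. F (x ` ({..<n} - {i})) \<partial>PiM {..<n} (\<lambda>_. \<nu>)) = iid_exp \<nu> (n - 1) F"
    and "integrable (PiM {..<n} (\<lambda>_. \<nu>)) (\<lambda>x. F (x ` ({..<n} - {i})))"
proof -
  interpret product_sigma_finite "\<lambda>_::nat. \<nu>" by standard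
  let ?J = "{..<n} - {i}"
  have ins: "{..<n} = insert i ?J" using i by auto
  interpret P: prob_space "PiM {..<n} (\<lambda>_. \<nu>)"
    by (rule prob_space_PiM) (rule prob_space_axioms)
  have "(\<lambda>x. F (x ` ?J)) \<circ> (\<lambda>x. restrict x ?J) \<in> borel_measurable (PiM {..<n} (\<lambda>_. \<nu>))"
    using point_functional_measurable[OF F, of ?J "\<lambda>_. \<nu>"] sets_law
    by (intro measurable_comp[OF measurable_restrict_subset]) auto
  then have meas: "(\<lambda>x. F (x ` ?J)) \<in> borel_measurable (PiM {..<n} (\<lambda>_. \<nu>))"
    by (simp add: comp_def)
  obtain C where "\<And>S. finite S \<Longrightarrow> card S \<le> n \<Longrightarrow> \<bar>F S\<bar> \<le> C"
    using point_functional_bounded[OF F] by blast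
  moreover have "card (x ` ?J) \<le> n" for x :: "nat \<Rightarrow> 'b"
    using card_image_le[of ?J x] card_mono[of "{..<n}" ?J] by auto
  ultimately show int: "integrable (PiM {..<n} (\<lambda>_. \<nu>)) (\<lambda>x. F (x ` ?J))"
    by (intro P.integrable_const_bound[where B = C] meas) auto
  have "(\<integral>x. F (x ` ?J) \<partial>PiM {..<n} (\<lambda>_. \<nu>)) = (\<integral>x. F (x ` ?J) \<partial>PiM (insert i ?J) (\<lambda>_. \<nu>))"
    using ins by simp
  also have "\<dots> = (\<integral>x. (\<integral>y. F ((x(i := y)) ` ?J) \<partial>\<nu>) \<partial>PiM ?J (\<lambda>_. \<nu>))"
    by (rule product_integral_insert) (use int ins in auto)
  also have "\<dots> = (\<integral>x. F (x ` ?J) \<partial>PiM ?J (\<lambda>_. \<nu>))"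
    by (simp add: prob_space)
  also have "\<dots> = iid_exp \<nu> (n - 1) F"
    using i F by (subst iid_exp_PiM) auto
  finally show "(\<integral>x. F (x ` ?J) \<partial>PiM {..<n} (\<lambda>_. \<nu>)) = iid_exp \<nu> (n - 1) F" .
qed

lemma iid_integrable:
  "point_functional F \<Longrightarrow> integrable (PiM {..<n::nat} (\<lambda>_. \<nu>)) (\<lambda>x. F (x ` {..<n}))"
  using point_functional_integrable[of F "{..<n}" "\<lambda>_. \<nu>"] by (simp add: sets_law prob_space_axioms)

lemma iid_exp_mono:
  assumes "point_functional F" "point_functional G" "\<And>S. finite S \<Longrightarrow> F S \<le> G S"
  shows "iid_exp \<nu> n F \<le> iid_exp \<nu> n G"
  unfolding iid_exp_def using assms by (intro integral_mono iid_integrable) auto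

lemma iid_exp_cong:
  assumes "\<And>S. finite S \<Longrightarrow> F S = G S"
  shows "iid_exp \<nu> n F = iid_exp \<nu> n G"
  unfolding iid_exp_def using assms by (intro Bochner_Integration.integral_cong) auto

lemma iid_exp_add:
  assumes "point_functional F" "point_functional G"
  shows "iid_exp \<nu> n (\<lambda>S. F S + G S) = iid_exp \<nu> n F + iid_exp \<nu> n G"
  unfolding iid_exp_def using assms by (intro Bochner_Integration.integral_add iid_integrable)

lemma iid_exp_diff:
  assumes "point_functional F" "point_functional G"
  shows "iid_exp \<nu> n (\<lambda>S. F S - G S) = iid_exp \<nu> n F - iid_exp \<nu> n G"
  unfolding iid_exp_def using assms by (intro Bochner_Integration.integral_diff iid_integrable)

lemma iid_exp_cmult: "iid_exp \<nu> n (\<lambda>S. c * F S) = c * iid_exp \<nu> n F"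
  unfolding iid_exp_def by simp

lemma iid_exp_const [simp]: "iid_exp \<nu> n (\<lambda>_. c) = c"
proof -
  interpret P: prob_space "PiM {..<n} (\<lambda>_. \<nu>)"
    by (rule prob_space_PiM) (rule prob_space_axioms)
  show ?thesis by (simp add: iid_exp_def P.prob_space)
qed

lemma iid_exp_sum:
  assumes "\<And>i. i \<in> A \<Longrightarrow> point_functional (F i)"
  shows "iid_exp \<nu> n (\<lambda>S. \<Sum>i\<in>A. F i S) = (\<Sum>i\<in>A. iid_exp \<nu> n (F i))"
  unfolding iid_exp_def using assms by (intro Bochner_Integration.integral_sum iid_integrable)

lemma insert_avg_mono:
  assumes "point_functional F" "finite S" "\<And>y. F S \<le> F (insert y S)"
  shows "F S \<le> insert_avg \<nu> F S"
proof -
  have "(\<integral>y. F S \<partial>\<nu>) \<le> insert_avg \<nu> F S"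
    unfolding insert_avg_def using assms(3)
    by (intro integral_mono[OF integrable_const integrable_insert[OF assms(1,2) prob_space_axioms sets_law]])
  then show ?thesis by (simp add: prob_space)
qed

lemma iid_exp_mono_n:
  assumes F: "point_functional F" and mono: "\<And>S y. finite S \<Longrightarrow> F S \<le> F (insert y S)" and "m \<le> n"
  shows "iid_exp \<nu> m F \<le> iid_exp \<nu> n F"
proof -
  have "iid_exp \<nu> n F \<le> iid_exp \<nu> (Suc n) F" for n
    using F mono by (simp add: iid_exp_Suc, intro iid_exp_mono insert_avg_mono point_functional_avg) auto
  then show ?thesis using \<open>m \<le> n\<close> by (rule lift_Suc_mono_le)
qed

text \<open>The variance of a monotone functional with increments at most one is bounded by an
  Efron--Stein argument: conditioning on all points but one, the conditional variance is at most
  the conditional expectation of the increment.\<close>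

lemma iid_variance_le:
  assumes F: "point_functional F"
    and inc: "\<And>S y. finite S \<Longrightarrow> F S \<le> F (insert y S)" "\<And>S y. finite S \<Longrightarrow> F (insert y S) \<le> F S + 1"
  shows "iid_exp \<nu> n (\<lambda>S. F S * F S) - (iid_exp \<nu> n F)\<^sup>2 \<le> real n * (iid_exp \<nu> n F - iid_exp \<nu> (n - 1) F)"
  using assms
proof (induction n arbitrary: F)
  case 0
  then show ?case by (simp add: power2_eq_square)
next
  case (Suc n)
  note F = Suc.prems(1) and inc = Suc.prems(2,3)
  let ?T = "insert_avg \<nu>"
  have TF: "point_functional (?T F)" using F by (rule point_functional_avg)
  have FF: "point_functional (\<lambda>S. F S * F S)" using F by (intro point_functional_mult)
  have TFF: "point_functional (?T (\<lambda>S. F S * F S))" using FF by (rule point_functional_avg)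
  have int: "integrable \<nu> (\<lambda>y. G (insert y S))" if "finite S" "point_functional G" for S G
    using that by (intro integrable_insert) (auto simp: sets_law prob_space_axioms)
  have step: "?T (\<lambda>S. F S * F S) S - ?T F S * ?T F S \<le> ?T F S - F S" if S: "finite S" for S
  proof -
    let ?c = "F S" and ?t = "?T F S"
    \<comment> \<open>By \<open>inc\<close> the value lies between \<open>?c\<close> and
      \<open>?c + 1\<close>, where the square is below its chord. Integrated, this bounds the
      conditional variance by \<open>(?t - ?c) - (?t - ?c) * (?t - ?c)\<close>.\<close>
    have "F (insert y S) * F (insert y S) \<le> (2 * ?c + 1) * F (insert y S) - (?c * ?c + ?c)" for y
    proof -
      have "(F (insert y S) - ?c) * (?c + 1 - F (insert y S)) \<ge> 0"
        using inc[OF S] by (intro mult_nonneg_nonneg) (auto simp: algebra_simps)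
      then show ?thesis by (simp add: algebra_simps)
    qed
    then have "?T (\<lambda>S. F S * F S) S \<le> (\<integral>y. (2 * ?c + 1) * F (insert y S) - (?c * ?c + ?c) \<partial>\<nu>)"
      unfolding insert_avg_def using int[OF S F] int[OF S FF] by (intro integral_mono) auto
    also have "\<dots> = (2 * ?c + 1) * ?t - (?c * ?c + ?c)"
      using int[OF S F] by (simp add: insert_avg_def prob_space)
    finally have "?T (\<lambda>S. F S * F S) S \<le> (2 * ?c + 1) * ?t - (?c * ?c + ?c)" .
    moreover have "0 \<le> (?t - ?c) * (?t - ?c)" by simp
    ultimately show ?thesis by (simp add: algebra_simps)
  qed
  \<comment> \<open>Averaging over a point preserves monotonicity and unit increments, so the
    induction hypothesis controls the variance of the conditional mean.\<close>
  have IH: "iid_exp \<nu> n (\<lambda>S. ?T F S * ?T F S) - (iid_exp \<nu> n (?T F))\<^sup>2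
       \<le> real n * (iid_exp \<nu> n (?T F) - iid_exp \<nu> (n - 1) (?T F))"
  proof (rule Suc.IH[OF TF])
    fix S :: "'b set" and z assume S: "finite S"
    have S': "finite (insert z S)" using S by simp
    show "?T F S \<le> ?T F (insert z S)"
      unfolding insert_avg_def
    proof (rule integral_mono[OF int[OF S F] int[OF S' F]])
      show "F (insert y S) \<le> F (insert y (insert z S))" for y
        using inc(1)[of "insert y S" z] S by (simp add: insert_commute)
    qed
    have "?T F (insert z S) \<le> (\<integral>y. F (insert y S) + 1 \<partial>\<nu>)"
      unfolding insert_avg_def
    proof (rule integral_mono[OF int[OF S' F]])
      show "integrable \<nu> (\<lambda>y. F (insert y S) + 1)" using int[OF S F] by simp
      show "F (insert y (insert z S)) \<le> F (insert y S) + 1" for y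
        using inc(2)[of "insert y S" z] S by (simp add: insert_commute)
    qed
    also have "\<dots> = ?T F S + 1"
      using int[OF S F] by (simp add: insert_avg_def prob_space)
    finally show "?T F (insert z S) \<le> ?T F S + 1" .
  qed
  \<comment> \<open>For \<open>n = 0\<close> the truncated index \<open>n - 1\<close> is harmless,
    because the factor \<open>real n\<close> vanishes.\<close>
  have n1: "real n * iid_exp \<nu> (n - 1) (?T F) = real n * iid_exp \<nu> n F"
    using iid_exp_Suc[OF F, of "n - 1"] by (cases n) auto
  \<comment> \<open>The total variance is the mean conditional variance plus the variance of the
    conditional mean; the two bounds add up to \<open>Suc n\<close> times the last
    increment.\<close>
  have "iid_exp \<nu> n (?T (\<lambda>S. F S * F S)) - iid_exp \<nu> n (\<lambda>S. ?T F S * ?T F S)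
      = iid_exp \<nu> n (\<lambda>S. ?T (\<lambda>S. F S * F S) S - ?T F S * ?T F S)"
    by (intro iid_exp_diff[symmetric] TFF point_functional_mult TF)
  also have "\<dots> \<le> iid_exp \<nu> n (\<lambda>S. ?T F S - F S)"
    by (intro iid_exp_mono point_functional_diff TFF point_functional_mult TF F step)
  also have "\<dots> = iid_exp \<nu> n (?T F) - iid_exp \<nu> n F"
    by (intro iid_exp_diff TF F)
  finally have "iid_exp \<nu> n (?T (\<lambda>S. F S * F S)) - iid_exp \<nu> n (\<lambda>S. ?T F S * ?T F S)
      \<le> iid_exp \<nu> n (?T F) - iid_exp \<nu> n F" .
  moreover have "iid_exp \<nu> n (\<lambda>S. ?T F S * ?T F S) - (iid_exp \<nu> n (?T F))\<^sup>2
       \<le> real n * iid_exp \<nu> n (?T F) - real n * iid_exp \<nu> n F"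
    using IH n1 by (simp only: right_diff_distrib)
  ultimately show ?case
    unfolding iid_exp_Suc[OF F] iid_exp_Suc[OF FF] diff_Suc_1 by (simp add: algebra_simps)
qed

lemma iid_Chebyshev:
  fixes n :: nat
  assumes F: "point_functional F" and t: "t > 0"
  defines "a \<equiv> iid_exp \<nu> n F"
  shows "iid_exp \<nu> n (\<lambda>S. indicator {y. t \<le> \<bar>y - a\<bar>} (F S)) \<le> (iid_exp \<nu> n (\<lambda>S. F S * F S) - a\<^sup>2) / t\<^sup>2"
proof -
  have ind: "point_functional (\<lambda>S. indicator {y. t \<le> \<bar>y - a\<bar>} (F S))"
    by (intro point_functional_indicator F) measurable
  have FF: "point_functional (\<lambda>S. F S * F S)" using F by (intro point_functional_mult)
  have aF: "point_functional (\<lambda>S. 2 * a * F S)" using F by (intro point_functional_mult point_functional_const)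
  have "t\<^sup>2 * iid_exp \<nu> n (\<lambda>S. indicator {y. t \<le> \<bar>y - a\<bar>} (F S))
      = iid_exp \<nu> n (\<lambda>S. t\<^sup>2 * indicator {y. t \<le> \<bar>y - a\<bar>} (F S))"
    by (simp add: iid_exp_cmult)
  also have "\<dots> \<le> iid_exp \<nu> n (\<lambda>S. (F S * F S - 2 * a * F S) + a\<^sup>2)"
  proof (intro iid_exp_mono point_functional_add point_functional_diff point_functional_mult[OF point_functional_const] ind
      FF aF F point_functional_const)
    fix S :: "'b set"
    have "t\<^sup>2 \<le> (F S - a)\<^sup>2" if "t \<le> \<bar>F S - a\<bar>"
      using that t by (metis abs_of_pos abs_le_square_iff)
    moreover have "F S * F S - 2 * a * F S + a\<^sup>2 = (F S - a)\<^sup>2"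
      by (simp add: power2_eq_square algebra_simps)
    ultimately show "t\<^sup>2 * indicator {y. t \<le> \<bar>y - a\<bar>} (F S) \<le> F S * F S - 2 * a * F S + a\<^sup>2"
      by (simp add: indicator_def)
  qed
  also have "\<dots> = iid_exp \<nu> n (\<lambda>S. F S * F S) - 2 * a * a + a\<^sup>2"
    by (subst iid_exp_add[OF point_functional_diff[OF FF aF] point_functional_const],
        subst iid_exp_diff[OF FF aF]) (simp add: iid_exp_cmult a_def)
  finally show ?thesis using t by (simp add: field_simps power2_eq_square)
qed

end

subsection \<open>Thinning\<close>

lemma Bernstein_Suc_Suc:
  "Bernstein (Suc n) (Suc k) p = p * Bernstein n k p + (1 - p) * Bernstein n (Suc k) p"
proof (cases "Suc k \<le> n")
  case True
  then obtain j where j: "n - k = Suc j" "n - Suc k = j" by (metis Suc_diff_Suc Suc_le_eq)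
  show ?thesis
    unfolding Bernstein_def diff_Suc_Suc j binomial_Suc_Suc power_Suc of_nat_add
    by (simp add: algebra_simps)
next
  case False
  then show ?thesis by (cases "k = n") (auto simp: Bernstein_def binomial_eq_0)
qed

text \<open>The binomial mean of \<open>e\<close>, conditioned on the outcome of one trial.\<close>

lemma sum_Bernstein_Suc:
  "(\<Sum>k\<le>Suc n. Bernstein (Suc n) k p * e k) =
     p * (\<Sum>k\<le>n. Bernstein n k p * e (Suc k)) + (1 - p) * (\<Sum>k\<le>n. Bernstein n k p * e k)"
proof -
  \<comment> \<open>The added term \<open>k = Suc n\<close> is zero, as
    \<open>n choose Suc n = 0\<close>; shifting the index then exposes the recursion.\<close>
  have "(1 - p) * (\<Sum>k\<le>n. Bernstein n k p * e k) = (1 - p) * (\<Sum>k\<le>Suc n. Bernstein n k p * e k)"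
    by (simp add: Bernstein_def)
  also have "\<dots> = (1 - p) * Bernstein n 0 p * e 0 + (\<Sum>k\<le>n. (1 - p) * Bernstein n (Suc k) p * e (Suc k))"
    unfolding sum.atMost_Suc_shift by (simp add: sum_distrib_left algebra_simps)
  finally have *: "(1 - p) * (\<Sum>k\<le>n. Bernstein n k p * e k) =
     (1 - p) * Bernstein n 0 p * e 0 + (\<Sum>k\<le>n. (1 - p) * Bernstein n (Suc k) p * e (Suc k))" .
  have B0: "Bernstein (Suc n) 0 p = (1 - p) * Bernstein n 0 p" by (simp add: Bernstein_def)
  show ?thesis
    unfolding sum.atMost_Suc_shift Bernstein_Suc_Suc * B0
    by (simp add: sum_distrib_left sum.distrib distrib_right mult.assoc)
qed

text \<open>Chebyshev's inequality for the binomial law: the variance \<open>n * p * (1 - p)\<close>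
  is computed from the first two factorial moments and is at most \<open>n * p\<close>.\<close>

lemma Bernstein_lower_tail:
  assumes p: "0 \<le> p" "p \<le> 1" and m: "real m < real n * p"
  shows "(\<Sum>k\<in>{..n} \<inter> {..<m}. Bernstein n k p) \<le> real n * p / (real n * p - real m)\<^sup>2"
proof -
  let ?q = "real n * p"
  have pos: "(?q - real m)\<^sup>2 > 0" using m by simp
  have "(?q - real m)\<^sup>2 * (\<Sum>k\<in>{..n} \<inter> {..<m}. Bernstein n k p) =
     (\<Sum>k\<in>{..n} \<inter> {..<m}. (?q - real m)\<^sup>2 * Bernstein n k p)"
    by (simp add: sum_distrib_left)
  also have "\<dots> \<le> (\<Sum>k\<in>{..n} \<inter> {..<m}. (real k - ?q)\<^sup>2 * Bernstein n k p)"
  proof (intro sum_mono mult_right_mono)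
    fix k assume "k \<in> {..n} \<inter> {..<m}"
    then have "?q - real m \<le> ?q - real k" by auto
    then have "(?q - real m)\<^sup>2 \<le> (?q - real k)\<^sup>2" using m by (intro power_mono) auto
    then show "(?q - real m)\<^sup>2 \<le> (real k - ?q)\<^sup>2" by (simp add: power2_commute)
  qed (use p in \<open>auto intro: Bernstein_nonneg\<close>)
  also have "\<dots> \<le> (\<Sum>k\<le>n. (real k - ?q)\<^sup>2 * Bernstein n k p)"
    using p by (intro sum_mono2) (auto intro!: mult_nonneg_nonneg Bernstein_nonneg)
  also have "\<dots> = (\<Sum>k\<le>n. real k * (real k - 1) * Bernstein n k p + (1 - 2 * ?q) * (real k * Bernstein n k p) + ?q\<^sup>2 * Bernstein n k p)"
    by (intro sum.cong) (auto simp: power2_eq_square algebra_simps)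
  also have "\<dots> = real n * (real n - 1) * p\<^sup>2 + (1 - 2 * ?q) * ?q + ?q\<^sup>2"
    unfolding sum.distrib sum_distrib_left[symmetric] by simp
  also have "\<dots> = ?q - ?q * p" by (simp add: power2_eq_square algebra_simps)
  also have "\<dots> \<le> ?q" using p by simp
  finally show ?thesis using pos by (simp add: field_simps)
qed

text \<open>If \<open>\<nu>\<close> dominates \<open>p \<mu>\<close>, then \<open>n\<close> points of law \<open>\<nu>\<close> contain a
  binomial number of points of law \<open>\<mu>\<close>; for monotone functionals the others may be dropped.\<close>

lemma iid_exp_thinning:
  fixes \<nu> \<mu> :: "'b::topological_space measure"
  assumes \<nu>: "point_law \<nu>" and \<mu>: "point_law \<mu>" and p: "0 \<le> p" "p \<le> 1"
    and dom: "\<And>g. (\<And>y. 0 \<le> g y) \<Longrightarrow> integrable \<nu> g \<Longrightarrow> integrable \<mu> g \<Longrightarrow> p * (\<integral>y. g y \<partial>\<mu>) \<le> (\<integral>y. g y \<partial>\<nu>)"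
    and F: "point_functional F" and mono: "\<And>S y. finite S \<Longrightarrow> F S \<le> F (insert y S)"
  shows "(\<Sum>k\<le>n. Bernstein n k p * iid_exp \<mu> k F) \<le> iid_exp \<nu> n F"
  using F mono
proof (induction n arbitrary: F)
  interpret N: point_law \<nu> by fact
  interpret M: point_law \<mu> by fact
  {
    case 0
    then show ?case by (simp add: Bernstein_def)
  next
    case (Suc n)
    note F = Suc.prems(1)
    have NF: "point_functional (insert_avg \<nu> F)" using F by (rule N.point_functional_avg)
    have MF: "point_functional (insert_avg \<mu> F)" using F by (rule M.point_functional_avg)
    have pM: "point_functional (\<lambda>S. p * insert_avg \<mu> F S)" "point_functional (\<lambda>S. (1 - p) * F S)"
      using point_functional_mult[OF point_functional_const MF] point_functional_mult[OF point_functional_const F]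
      by auto
    have intN: "integrable \<nu> (\<lambda>y. F (insert y S))" if "finite S" for S
      using that F by (intro integrable_insert) (auto simp: N.sets_law N.prob_space_axioms)
    have intM: "integrable \<mu> (\<lambda>y. F (insert y S))" if "finite S" for S
      using that F by (intro integrable_insert) (auto simp: M.sets_law M.prob_space_axioms)
    have "(\<Sum>k\<le>Suc n. Bernstein (Suc n) k p * iid_exp \<mu> k F) =
       p * (\<Sum>k\<le>n. Bernstein n k p * iid_exp \<mu> k (insert_avg \<mu> F)) + (1 - p) * (\<Sum>k\<le>n. Bernstein n k p * iid_exp \<mu> k F)"
      unfolding sum_Bernstein_Suc by (simp add: M.iid_exp_Suc[OF F])
    \<comment> \<open>The induction hypothesis serves twice: the extra point is kept with
      probability \<open>p\<close> and then has law \<open>\<mu>\<close>, or it is dropped.\<close>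
    also have "\<dots> \<le> p * iid_exp \<nu> n (insert_avg \<mu> F) + (1 - p) * iid_exp \<nu> n F"
    proof (intro add_mono mult_left_mono Suc.IH F MF Suc.prems)
      fix S :: "'b set" and z assume S: "finite S"
      have "finite (insert z S)" using S by simp
      then show "insert_avg \<mu> F S \<le> insert_avg \<mu> F (insert z S)"
        unfolding insert_avg_def
      proof (intro integral_mono intM S)
        show "F (insert y S) \<le> F (insert y (insert z S))" for y
          using Suc.prems(2)[of "insert y S" z] S by (simp add: insert_commute)
      qed
    qed (use p in auto)
    also have "\<dots> = iid_exp \<nu> n (\<lambda>S. p * insert_avg \<mu> F S + (1 - p) * F S)"
      by (subst N.iid_exp_add[OF pM]) (simp add: N.iid_exp_cmult)
    also have "\<dots> \<le> iid_exp \<nu> n (insert_avg \<nu> F)"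
    proof (rule N.iid_exp_mono[OF point_functional_add[OF pM] NF])
      fix S :: "'b set" assume S: "finite S"
      \<comment> \<open>\<open>dom\<close> speaks of nonnegative integrands; by monotonicity the
        increment is one.\<close>
      have "p * (\<integral>y. F (insert y S) - F S \<partial>\<mu>) \<le> (\<integral>y. F (insert y S) - F S \<partial>\<nu>)"
        using Suc.prems(2)[OF S] intN[OF S] intM[OF S] by (intro dom) auto
      then show "p * insert_avg \<mu> F S + (1 - p) * F S \<le> insert_avg \<nu> F S"
        using intN[OF S] intM[OF S]
        by (simp add: insert_avg_def N.prob_space M.prob_space algebra_simps)
    qed
    also have "\<dots> = iid_exp \<nu> (Suc n) F" by (simp add: N.iid_exp_Suc[OF F])
    finally show ?case .
  }
qed

text \<open>By the binomial lower tail, fewer than \<open>m\<close> points are kept with at most the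
  subtracted probability; otherwise monotonicity allows the mean at the actual number of points to
  be replaced by the mean at \<open>m\<close>.\<close>

lemma iid_exp_thinning_bound:
  assumes \<nu>: "point_law \<nu>" and \<mu>: "point_law \<mu>" and p: "0 \<le> p" "p \<le> 1"
    and dom: "\<And>g. (\<And>y. 0 \<le> g y) \<Longrightarrow> integrable \<nu> g \<Longrightarrow> integrable \<mu> g \<Longrightarrow> p * (\<integral>y. g y \<partial>\<mu>) \<le> (\<integral>y. g y \<partial>\<nu>)"
    and F: "point_functional F" and mono: "\<And>S y. finite S \<Longrightarrow> F S \<le> F (insert y S)"
    and nonneg: "\<And>S. finite S \<Longrightarrow> 0 \<le> F S" and m: "real m < real n * p"
  shows "(1 - real n * p / (real n * p - real m)\<^sup>2) * iid_exp \<mu> m F \<le> iid_exp \<nu> n F"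
proof -
  interpret M: point_law \<mu> by fact
  have em: "iid_exp \<mu> k F \<ge> 0" for k
    using M.iid_exp_mono[OF point_functional_const[of 0] F] nonneg by simp
  have "(\<Sum>k\<in>{..n} \<inter> {..<m}. Bernstein n k p) + (\<Sum>k\<in>{..n} - {..<m}. Bernstein n k p) = 1"
    by (metis finite_atMost sum.Int_Diff sum_Bernstein)
  then have "1 - real n * p / (real n * p - real m)\<^sup>2 \<le> (\<Sum>k\<in>{..n} - {..<m}. Bernstein n k p)"
    using Bernstein_lower_tail[OF p m] by linarith
  then have "(1 - real n * p / (real n * p - real m)\<^sup>2) * iid_exp \<mu> m F \<le> (\<Sum>k\<in>{..n} - {..<m}. Bernstein n k p) * iid_exp \<mu> m F"
    using em by (intro mult_right_mono) auto
  also have "\<dots> = (\<Sum>k\<in>{..n} - {..<m}. Bernstein n k p * iid_exp \<mu> m F)"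
    by (simp add: sum_distrib_right)
  also have "\<dots> \<le> (\<Sum>k\<in>{..n} - {..<m}. Bernstein n k p * iid_exp \<mu> k F)"
    using p by (intro sum_mono mult_left_mono M.iid_exp_mono_n F mono) (auto intro: Bernstein_nonneg)
  also have "\<dots> \<le> (\<Sum>k\<le>n. Bernstein n k p * iid_exp \<mu> k F)"
    using p em by (intro sum_mono2) (auto intro!: mult_nonneg_nonneg Bernstein_nonneg)
  also have "\<dots> \<le> iid_exp \<nu> n F"
    by (rule iid_exp_thinning[OF \<nu> \<mu> p dom F mono])
  finally show ?thesis .
qed

section \<open>Image laws, and the variance of the longest chain\<close>

lemma point_law_distr:
  assumes "point_law \<nu>" "\<phi> \<in> borel_measurable borel"
  shows "point_law (distr \<nu> borel \<phi>)"
proof -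
  interpret point_law \<nu> by fact
  have "\<phi> \<in> borel_measurable \<nu>"
    using assms(2) measurable_cong_sets[OF sets_law refl] by blast
  then show ?thesis
    by (simp add: point_law_def point_law_axioms_def prob_space_distr)
qed

lemma iid_exp_distr:
  assumes \<nu>: "point_law \<nu>" and \<phi>: "\<phi> \<in> borel_measurable borel" and F: "point_functional F"
  shows "iid_exp (distr \<nu> borel \<phi>) n F = iid_exp \<nu> n (\<lambda>S. F (\<phi> ` S))"
  using F
proof (induction n arbitrary: F)
  interpret N: point_law \<nu> by fact
  interpret D: point_law "distr \<nu> borel \<phi>" by (rule point_law_distr[OF \<nu> \<phi>])
  {
    case 0
    then show ?case by simp
  next
    case (Suc n)
    note F = Suc.prems
    have \<phi>': "\<phi> \<in> borel_measurable \<nu>"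
      using \<phi> measurable_cong_sets[OF N.sets_law refl] by blast
    have "insert_avg (distr \<nu> borel \<phi>) F (\<phi> ` S) = insert_avg \<nu> (\<lambda>S. F (\<phi> ` S)) S" if "finite S" for S
      unfolding insert_avg_def using that
      by (subst integral_distr[OF \<phi>']) (auto intro: measurable_insert[OF F])
    then show ?case
      using Suc.IH[OF D.point_functional_avg[OF F]]
      by (simp add: D.iid_exp_Suc[OF F] N.iid_exp_Suc[OF point_functional_image[OF F \<phi>]] cong: N.iid_exp_cong)
  }
qed

lemma longest_chain_increment:
  assumes "finite S"
  shows "real (longest_chain (S \<inter> B)) \<le> real (longest_chain (insert y S \<inter> B))"
    and "real (longest_chain (insert y S \<inter> B)) \<le> real (longest_chain (S \<inter> B)) + 1"
proof -
  show "real (longest_chain (S \<inter> B)) \<le> real (longest_chain (insert y S \<inter> B))"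
    using assms by (auto intro!: longest_chain_mono)
  have "longest_chain (insert y S \<inter> B) \<le> longest_chain (insert y (S \<inter> B))"
    using assms by (intro longest_chain_mono) auto
  also have "\<dots> \<le> longest_chain (S \<inter> B) + 1"
    using assms by (intro longest_chain_insert_le) auto
  finally show "real (longest_chain (insert y S \<inter> B)) \<le> real (longest_chain (S \<inter> B)) + 1"
    by simp
qed

text \<open>Averaging the removal inequality, \<open>(n - 1)\<close> times the mean at
  \<open>n\<close> is at most \<open>n\<close> times the mean at \<open>n - 1\<close>. So
  \<open>n\<close> times the last increment is at most the mean, and the Efron--Stein bound
  applies.\<close>

lemma longest_chain_variance:
  fixes \<nu> :: "(real^'d) measure"
  assumes \<nu>: "point_law \<nu>" and B: "B \<in> sets borel"
  defines "F \<equiv> \<lambda>S. real (longest_chain (S \<inter> B))"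
  shows "iid_exp \<nu> n (\<lambda>S. F S * F S) - (iid_exp \<nu> n F)\<^sup>2 \<le> iid_exp \<nu> n F"
proof -
  interpret point_law \<nu> by fact
  have F: "point_functional F" unfolding F_def by (rule point_functional_longest_chain[OF B])
  have "(real n - 1) * iid_exp \<nu> n F = (\<integral>x. (real (card {..<n}) - 1) * F (x ` {..<n}) \<partial>PiM {..<n} (\<lambda>_. \<nu>))"
    by (simp add: iid_exp_def)
  also have "\<dots> \<le> (\<integral>x. (\<Sum>i<n. F (x ` ({..<n} - {i}))) \<partial>PiM {..<n} (\<lambda>_. \<nu>))"
  proof (intro integral_mono)
    show "(real (card {..<n}) - 1) * F (x ` {..<n}) \<le> (\<Sum>i<n. F (x ` ({..<n} - {i})))" for x
      unfolding F_def by (rule sum_longest_chain_remove) simp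
  qed (auto intro!: iid_integrable F Bochner_Integration.integrable_sum iid_exp_remove)
  also have "\<dots> = (\<Sum>i<n. iid_exp \<nu> (n - 1) F)"
    by (subst Bochner_Integration.integral_sum) (auto simp: iid_exp_remove[OF F])
  finally have "real n * (iid_exp \<nu> n F - iid_exp \<nu> (n - 1) F) \<le> iid_exp \<nu> n F"
    by (simp add: algebra_simps)
  moreover have "iid_exp \<nu> n (\<lambda>S. F S * F S) - (iid_exp \<nu> n F)\<^sup>2 \<le> real n * (iid_exp \<nu> n F - iid_exp \<nu> (n - 1) F)"
    using longest_chain_increment unfolding F_def
    by (intro iid_variance_le F[unfolded F_def]) auto
  ultimately show ?thesis by linarith
qed

subsection \<open>Random points\<close>

text \<open>Carries computations on the product space over to an arbitrary sample space.\<close>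

lemma iid_points:
  fixes X :: "nat \<Rightarrow> 'a \<Rightarrow> 'b::{second_countable_topology,t2_space}"
  assumes M: "prob_space M" and ind: "prob_space.indep_vars M (\<lambda>_. borel) X UNIV"
    and law: "\<And>i. distr M borel (X i) = \<nu>" and F: "point_functional F"
  shows "(\<lambda>\<omega>. F ((\<lambda>i. X i \<omega>) ` {..<n})) \<in> borel_measurable M"
    and "(\<integral>\<omega>. F ((\<lambda>i. X i \<omega>) ` {..<n}) \<partial>M) = iid_exp \<nu> n F"
proof -
  interpret prob_space M by fact
  have rv: "X i \<in> borel_measurable M" for i
    using ind unfolding indep_vars_def by auto
  let ?P = "PiM {..<n} (\<lambda>_. borel :: 'b measure)"
  have m: "(\<lambda>\<omega>. \<lambda>i\<in>{..<n}. X i \<omega>) \<in> measurable M ?P"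
    using rv by (intro measurable_restrict) auto
  have Fm: "(\<lambda>x. F (x ` {..<n})) \<in> borel_measurable ?P"
    using F by (intro point_functional_borel) auto
  from measurable_comp[OF m Fm] show "(\<lambda>\<omega>. F ((\<lambda>i. X i \<omega>) ` {..<n})) \<in> borel_measurable M"
    by (simp add: comp_def)
  have law': "sets \<nu> = sets borel" "prob_space \<nu>" using law[of 0] rv[of 0] by (auto simp flip: law[of 0] intro: prob_space_distr)
  show "(\<integral>\<omega>. F ((\<lambda>i. X i \<omega>) ` {..<n}) \<partial>M) = iid_exp \<nu> n F"
  \<comment> \<open>The characterization of independence by the joint law assumes a nonempty index
    set.\<close>
  proof (cases "n = 0")
    case True
    then show ?thesis
      using law' by (simp add: prob_space point_law.iid_exp_0 point_law_def point_law_axioms_def)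
  next
    case False
    have "indep_vars (\<lambda>_. borel) X {..<n}" using ind by (rule indep_vars_subset) auto
    then have d: "distr M ?P (\<lambda>\<omega>. \<lambda>i\<in>{..<n}. X i \<omega>) = PiM {..<n} (\<lambda>_. \<nu>)"
      using False rv law by (subst (asm) indep_vars_iff_distr_eq_PiM) auto
    have "iid_exp \<nu> n F = (\<integral>x. F (x ` {..<n}) \<partial>distr M ?P (\<lambda>\<omega>. \<lambda>i\<in>{..<n}. X i \<omega>))"
      by (simp add: iid_exp_def d)
    also have "\<dots> = (\<integral>\<omega>. F ((\<lambda>i. X i \<omega>) ` {..<n}) \<partial>M)"
      by (subst integral_distr[OF m Fm]) simp
    finally show ?thesis by simp
  qed
qed

lemma iid_points_prob:
  fixes X :: "nat \<Rightarrow> 'a \<Rightarrow> 'b::{second_countable_topology,t2_space}"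
  assumes M: "prob_space M" and ind: "prob_space.indep_vars M (\<lambda>_. borel) X UNIV"
    and law: "\<And>i. distr M borel (X i) = \<nu>" and F: "point_functional F" and A: "A \<in> sets borel"
  shows "{\<omega> \<in> space M. F ((\<lambda>i. X i \<omega>) ` {..<n}) \<in> A} \<in> sets M"
    and "measure M {\<omega> \<in> space M. F ((\<lambda>i. X i \<omega>) ` {..<n}) \<in> A} = iid_exp \<nu> n (\<lambda>S. indicator A (F S))"
proof -
  interpret prob_space M by fact
  let ?E = "{\<omega> \<in> space M. F ((\<lambda>i. X i \<omega>) ` {..<n}) \<in> A}"
  show E: "?E \<in> sets M"
    using measurable_sets[OF iid_points(1)[OF M ind law F] A]
    by (simp add: vimage_def Int_def conj_commute)
  have "iid_exp \<nu> n (\<lambda>S. indicator A (F S)) = (\<integral>\<omega>. indicator A (F ((\<lambda>i. X i \<omega>) ` {..<n})) \<partial>M)"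
    by (rule iid_points(2)[symmetric, OF M ind law point_functional_indicator[OF F A]])
  also have "\<dots> = (\<integral>\<omega>. indicator ?E \<omega> \<partial>M)"
    by (intro Bochner_Integration.integral_cong) (auto simp: indicator_def)
  also have "\<dots> = measure M ?E" using E by simp
  finally show "measure M ?E = iid_exp \<nu> n (\<lambda>S. indicator A (F S))" by simp
qed

subsection \<open>Boxes and the uniform law\<close>

lemma prod_Basis_cart:
  "(\<Prod>j\<in>(Basis :: (real^'d) set). h j) = (\<Prod>i\<in>UNIV. h (axis i 1))"
proof -
  have B: "(Basis :: (real^'d) set) = (\<lambda>i. axis i 1) ` UNIV"
    by (auto simp: Basis_vec_def)
  have "inj (\<lambda>i. axis i 1 :: real^'d)"
    by (auto simp: inj_on_def axis_eq_axis)
  then show ?thesis unfolding B by (subst prod.reindex) auto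
qed

definition box_map :: "real^'d \<Rightarrow> real^'d \<Rightarrow> real^'d \<Rightarrow> real^'d" where
  "box_map a b y = (\<chi> i. a $ i + (b $ i - a $ i) * y $ i)"

text \<open>A signed product: it is the volume if \<open>a\<close> lies below \<open>b\<close>, and
  0 as soon as one side degenerates.\<close>

definition box_vol :: "real^'d \<Rightarrow> real^'d \<Rightarrow> real" where
  "box_vol a b = (\<Prod>i\<in>UNIV. b $ i - a $ i)"

text \<open>Open boxes: two stacked boxes that touch are still disjoint and strictly ordered. The
  missing faces are null sets.\<close>

abbreviation unit_box :: "(real^'d) set" where
  "unit_box \<equiv> box 0 1"

definition unit_law :: "(real^'d) measure" where
  "unit_law = density lborel (indicator unit_box)"

lemma One_cart: "(One :: real^'d) = 1"
proof -
  have "(\<Sum>i\<in>Basis. i :: real^'d) $ j = 1" for j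
    using inner_sum_Basis[of "axis j 1 :: real^'d"] by (simp add: cart_eq_inner_axis)
  then show ?thesis by (simp add: vec_eq_iff)
qed

lemma mem_unit_box: "y \<in> unit_box \<longleftrightarrow> (\<forall>i. 0 < y $ i \<and> y $ i < 1)"
  by (simp add: mem_box_cart)

lemma emeasure_unit_box: "emeasure lborel (unit_box :: (real^'d) set) = 1"
proof -
  have "emeasure lborel (box 0 (One :: real^'d)) = 1"
    by (subst emeasure_lborel_box) auto
  then show ?thesis by (simp add: One_cart)
qed

lemma point_law_density:
  fixes f :: "real^'d \<Rightarrow> real"
  assumes "f \<in> borel_measurable borel" "(\<integral>\<^sup>+ x. ennreal (f x) \<partial>lborel) = 1"
  shows "point_law (density lborel (\<lambda>x. ennreal (f x)))"
proof -
  have "prob_space (density lborel (\<lambda>x. ennreal (f x)))"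
    using assms by (intro prob_spaceI) (simp add: emeasure_density)
  then show ?thesis by (simp add: point_law_def point_law_axioms_def)
qed

lemma unit_law_eq: "unit_law = density lborel (\<lambda>x. ennreal (indicator unit_box x))"
  by (simp add: unit_law_def ennreal_indicator)

lemma point_law_unit: "point_law (unit_law :: (real^'d) measure)"
  unfolding unit_law_eq
  by (rule point_law_density) (auto simp: emeasure_unit_box ennreal_indicator)

lemma box_map_measurable [measurable]: "box_map a b \<in> borel_measurable borel"
proof -
  have "continuous_on UNIV (box_map a b)"
    unfolding box_map_def by (intro continuous_on_vec_lambda continuous_intros)
  then show ?thesis by (rule borel_measurable_continuous_onI)
qed

context
  fixes a b :: "real^'d"
  assumes ab: "\<And>i. a $ i < b $ i"
begin

lemma box_vol_pos: "0 < box_vol a b"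
  unfolding box_vol_def using ab by (intro prod_pos) auto

lemma box_map_vle: "vle (box_map a b x) (box_map a b y) \<longleftrightarrow> vle x y"
  using ab by (auto simp: vle_def box_map_def)

lemma inj_box_map: "inj (box_map a b)"
proof (rule injI)
  fix x y assume "box_map a b x = box_map a b y"
  then have "(b $ i - a $ i) * x $ i = (b $ i - a $ i) * y $ i" for i
    by (simp add: box_map_def vec_eq_iff)
  then have "x $ i = y $ i" for i using ab[of i] by (metis less_irrefl mult_left_cancel right_minus_eq)
  then show "x = y" by (simp add: vec_eq_iff)
qed

lemma box_map_in_box: "box_map a b y \<in> box a b \<longleftrightarrow> y \<in> unit_box"
proof -
  have "(a $ i < a $ i + (b $ i - a $ i) * y $ i \<and> a $ i + (b $ i - a $ i) * y $ i < b $ i) \<longleftrightarrow> 0 < y $ i \<and> y $ i < 1" for i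
  proof -
    have "a $ i + (b $ i - a $ i) * y $ i < b $ i \<longleftrightarrow> (b $ i - a $ i) * y $ i < (b $ i - a $ i) * 1" by auto
    also have "\<dots> \<longleftrightarrow> y $ i < 1" using ab[of i] by (subst mult_less_cancel_left_pos) auto
    finally show ?thesis using ab[of i] by (simp add: zero_less_mult_iff)
  qed
  then show ?thesis by (simp add: mem_box_cart box_map_def)
qed

lemma longest_chain_box_map:
  assumes "finite S"
  shows "longest_chain (box_map a b ` S \<inter> box a b) = longest_chain (S \<inter> unit_box)"
proof -
  have "box_map a b ` S \<inter> box a b = box_map a b ` (S \<inter> unit_box)"
    using box_map_in_box by auto
  then show ?thesis
    using assms by (simp add: longest_chain_embedding[OF _ box_map_vle inj_box_map])
qed

lemma lborel_box_map: "lborel = density (distr lborel borel (box_map a b)) (\<lambda>_. ennreal (box_vol a b))"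
proof -
  have eq: "a + (\<Sum>j\<in>Basis. ((b - a) \<bullet> j * (x \<bullet> j)) *\<^sub>R j) = box_map a b x" for x
  proof -
    have "(a + (\<Sum>j\<in>Basis. ((b - a) \<bullet> j * (x \<bullet> j)) *\<^sub>R j)) \<bullet> axis i 1 = box_map a b x $ i" for i
    proof -
      have B: "axis i 1 \<in> (Basis :: (real^'d) set)" by (auto simp: Basis_vec_def)
      have "(a + (\<Sum>j\<in>Basis. ((b - a) \<bullet> j * (x \<bullet> j)) *\<^sub>R j)) \<bullet> axis i 1
          = a \<bullet> axis i 1 + (b - a) \<bullet> axis i 1 * (x \<bullet> axis i 1)"
        by (simp only: inner_add_left inner_sum_left_Basis[OF B])
      then show ?thesis by (simp add: box_map_def inner_axis)
    qed
    then show ?thesis by (simp add: vec_eq_iff cart_eq_inner_axis)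
  qed
  have ne: "b $ i \<noteq> a $ i" for i using ab[of i] by simp
  have "lborel = density (distr lborel borel (\<lambda>x. a + (\<Sum>j\<in>Basis. ((b - a) \<bullet> j * (x \<bullet> j)) *\<^sub>R j)))
      (\<lambda>_. \<Prod>j\<in>Basis. \<bar>(b - a) \<bullet> j\<bar>)"
    using ne by (intro lborel_affine_euclidean) (auto simp: Basis_vec_def inner_axis)
  also have "(\<Prod>j\<in>Basis. \<bar>(b - a) \<bullet> j\<bar>) = box_vol a b"
    unfolding prod_Basis_cart box_vol_def using ab by (intro prod.cong) (auto simp: inner_axis less_imp_le)
  finally show ?thesis by (simp add: eq)
qed

text \<open>The image of \<open>unit_law\<close> under \<open>box_map a b\<close> is the uniform law
  of the box, and \<open>box_vol a b\<close> is the Jacobian factor.\<close>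

lemma integral_box_map:
  fixes g :: "real^'d \<Rightarrow> real"
  assumes [measurable]: "g \<in> borel_measurable borel"
  shows "(\<integral>x. indicator (box a b) x * g x \<partial>lborel) = box_vol a b * (\<integral>y. g y \<partial>distr unit_law borel (box_map a b))"
    and "integrable (distr unit_law borel (box_map a b)) g \<Longrightarrow> integrable lborel (\<lambda>x. indicator (box a b) x * g x)"
proof -
  have ind: "indicator (box a b) (box_map a b y) = (indicator unit_box y :: real)" for y
    using box_map_in_box by (auto simp: indicator_def)
  have m: "box_map a b \<in> borel_measurable unit_law"
    using measurable_cong_sets[OF point_law.sets_law[OF point_law_unit] refl] box_map_measurable by blast
  have "(\<integral>x. indicator (box a b) x * g x \<partial>lborel) =
     (\<integral>x. indicator (box a b) x * g x \<partial>density (distr lborel borel (box_map a b)) (\<lambda>_. ennreal (box_vol a b)))"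
    using lborel_box_map by simp
  also have "\<dots> = box_vol a b * (\<integral>x. indicator (box a b) x * g x \<partial>distr lborel borel (box_map a b))"
    using box_vol_pos by (subst integral_density) auto
  also have "\<dots> = box_vol a b * (\<integral>y. indicator unit_box y * g (box_map a b y) \<partial>lborel)"
    by (subst integral_distr) (auto simp: ind)
  also have "(\<integral>y. indicator unit_box y * g (box_map a b y) \<partial>lborel) = (\<integral>y. g (box_map a b y) \<partial>unit_law)"
    unfolding unit_law_eq by (subst integral_density) auto
  also have "\<dots> = (\<integral>y. g y \<partial>distr unit_law borel (box_map a b))"
    by (subst integral_distr[OF m]) auto
  finally show "(\<integral>x. indicator (box a b) x * g x \<partial>lborel) = box_vol a b * (\<integral>y. g y \<partial>distr unit_law borel (box_map a b))" .
  assume "integrable (distr unit_law borel (box_map a b)) g"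
  then have "integrable unit_law (\<lambda>y. g (box_map a b y))"
    by (subst (asm) integrable_distr_eq[OF m]) auto
  then have "integrable lborel (\<lambda>y. indicator unit_box y * g (box_map a b y))"
    unfolding unit_law_eq by (subst (asm) integrable_density) auto
  then have "integrable (distr lborel borel (box_map a b)) (\<lambda>x. indicator (box a b) x * g x)"
    by (subst integrable_distr_eq) (auto simp: ind)
  then have "integrable (density (distr lborel borel (box_map a b)) (\<lambda>_. ennreal (box_vol a b))) (\<lambda>x. indicator (box a b) x * g x)"
    using box_vol_pos by (subst integrable_density) auto
  then show "integrable lborel (\<lambda>x. indicator (box a b) x * g x)"
    using lborel_box_map by simp
qed

text \<open>The density is at least \<open>\<mu>\<close> on the box, so the law dominates
  \<open>p\<close> times the uniform law there, and \<open>box_map\<close> transports chains from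
  the unit box. The two choices of \<open>h\<close> give a bound for means and one for tail
  probabilities.\<close>

lemma longest_chain_thinning:
  fixes f :: "real^'d \<Rightarrow> real" and h :: "real \<Rightarrow> real"
  assumes f: "f \<in> borel_measurable borel" "\<And>x. 0 \<le> f x" "(\<integral>\<^sup>+ x. ennreal (f x) \<partial>lborel) = 1"
    and \<mu>: "0 \<le> \<mu>" "\<And>x. x \<in> box a b \<Longrightarrow> \<mu> \<le> f x"
    and h: "h = (\<lambda>y. y) \<or> h = indicator {t..}"
    and m: "real m < real n * (\<mu> * box_vol a b)"
  defines "p \<equiv> \<mu> * box_vol a b"
  shows "(1 - real n * p / (real n * p - real m)\<^sup>2) * iid_exp (unit_law :: (real^'d) measure) m (\<lambda>S. h (real (longest_chain (S \<inter> unit_box))))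
     \<le> iid_exp (density lborel (\<lambda>x. ennreal (f x))) n (\<lambda>S. h (real (longest_chain (S \<inter> box a b))))"
proof -
  let ?\<nu> = "density lborel (\<lambda>x. ennreal (f x))" and ?D = "distr unit_law borel (box_map a b)"
  interpret N: point_law ?\<nu> by (rule point_law_density[OF f(1,3)])
  interpret D: point_law ?D by (rule point_law_distr[OF point_law_unit box_map_measurable])
  have hm: "mono h" "\<And>y. 0 \<le> y \<Longrightarrow> 0 \<le> h y" using h by (auto simp: mono_def indicator_def)
  have dom: "p * (\<integral>y. g y \<partial>?D) \<le> (\<integral>y. g y \<partial>?\<nu>)"
    if g: "\<And>y. 0 \<le> g y" "integrable ?\<nu> g" "integrable ?D g" for g
  proof -
    have gm [measurable]: "g \<in> borel_measurable borel" using borel_measurable_integrable[OF g(3)] by simp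
    have "p * (\<integral>y. g y \<partial>?D) = \<mu> * (\<integral>x. indicator (box a b) x * g x \<partial>lborel)"
      unfolding p_def by (simp add: integral_box_map(1)[OF gm])
    also have "\<dots> = (\<integral>x. \<mu> * (indicator (box a b) x * g x) \<partial>lborel)" by simp
    also have "\<dots> \<le> (\<integral>x. f x * g x \<partial>lborel)"
    proof (rule integral_mono)
      show "integrable lborel (\<lambda>x. f x * g x)"
        using g(2) f(1,2) by (subst (asm) integrable_density) auto
      show "integrable lborel (\<lambda>x. \<mu> * (indicator (box a b) x * g x))"
        using integral_box_map(2)[OF gm g(3)] by simp
      show "\<mu> * (indicator (box a b) x * g x) \<le> f x * g x" for x
        using \<mu>(2)[of x] g(1)[of x] f(2)[of x] by (auto simp: indicator_def intro: mult_right_mono)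
    qed
    also have "\<dots> = (\<integral>y. g y \<partial>?\<nu>)"
      using f(1,2) by (subst integral_density) auto
    finally show ?thesis .
  qed
  \<comment> \<open>\<open>p \<le> 1\<close> results from testing the domination on the constant
    1.\<close>
  have p: "0 \<le> p" "p \<le> 1"
    using \<mu>(1) box_vol_pos dom[of "\<lambda>_. 1"] D.prob_space N.prob_space by (auto simp: p_def)
  let ?F = "\<lambda>S. h (real (longest_chain (S \<inter> box a b)))"
  have F: "point_functional ?F"
    using h point_functional_longest_chain[of "box a b"]
      point_functional_indicator[OF point_functional_longest_chain[of "box a b"], of "{t..}"] by auto
  have "(1 - real n * p / (real n * p - real m)\<^sup>2) * iid_exp ?D m ?F \<le> iid_exp ?\<nu> n ?F"
  proof (rule iid_exp_thinning_bound[OF N.point_law_axioms D.point_law_axioms p dom F])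
    show "?F S \<le> ?F (insert y S)" if "finite S" for S y
      by (rule monoD[OF hm(1) longest_chain_increment(1)[OF that]])
    show "real m < real n * p" using m by (simp add: p_def)
  qed (use hm in auto)
  also have "iid_exp ?D m ?F = iid_exp unit_law m (\<lambda>S. ?F (box_map a b ` S))"
    by (rule iid_exp_distr[OF point_law_unit box_map_measurable F])
  also have "\<dots> = iid_exp (unit_law :: (real^'d) measure) m (\<lambda>S. h (real (longest_chain (S \<inter> unit_box))))"
    by (rule point_law.iid_exp_cong[OF point_law_unit]) (simp add: longest_chain_box_map)
  finally show ?thesis .
qed

end

subsection \<open>Growth of the expected longest chain\<close>

definition mean_chain :: "'d::finite itself \<Rightarrow> nat \<Rightarrow> real" where
  "mean_chain _ n = iid_exp (unit_law :: (real^'d) measure) n (\<lambda>S. real (longest_chain (S \<inter> unit_box)))"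

lemma point_functional_unit: "point_functional (\<lambda>S. real (longest_chain (S \<inter> (unit_box :: (real^'d) set))))"
  by (rule point_functional_longest_chain) simp

lemma mean_chain_nonneg: "0 \<le> mean_chain TYPE('d::finite) n"
  unfolding mean_chain_def iid_exp_def by simp

text \<open>The source of positivity of the growth rate: a single point already forms a
  chain.\<close>

lemma mean_chain_1: "mean_chain TYPE('d::finite) 1 = 1"
proof -
  interpret point_law "unit_law :: (real^'d) measure" by (rule point_law_unit)
  have "mean_chain TYPE('d) 1 = (\<integral>y. real (longest_chain ({y} \<inter> unit_box)) \<partial>(unit_law :: (real^'d) measure))"
    by (simp add: mean_chain_def iid_exp_Suc[OF point_functional_unit] insert_avg_def)
  also have "\<dots> = (\<integral>y. indicator unit_box y \<partial>(unit_law :: (real^'d) measure))"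
    by (intro Bochner_Integration.integral_cong) (auto simp: indicator_def)
  also have "\<dots> = (\<integral>y. indicator unit_box y * indicator unit_box y \<partial>(lborel :: (real^'d) measure))"
    unfolding unit_law_eq by (subst integral_density) auto
  also have "\<dots> = (\<integral>y. indicator unit_box y \<partial>(lborel :: (real^'d) measure))"
    by (intro Bochner_Integration.integral_cong) (auto simp: indicator_def)
  also have "\<dots> = 1" by (simp add: measure_def emeasure_unit_box)
  finally show ?thesis .
qed

text \<open>\<open>s\<close> is the mean number of points in one diagonal box. Such a box holds
  fewer than \<open>m\<close> points with probability at most \<open>s / (s - real m) ^ 2\<close>,
  so it contributes \<open>mean_chain\<close> at \<open>m\<close> up to that loss, and the
  contributions of stacked boxes add.\<close>

lemma mean_chain_superadditive:
  fixes k m n :: nat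
  assumes k: "1 \<le> k" and m: "real m * real k ^ CARD('d::finite) < real n"
  defines "s \<equiv> real n / real k ^ CARD('d)"
  shows "real k * (1 - s / (s - real m)\<^sup>2) * mean_chain TYPE('d) m \<le> mean_chain TYPE('d) n"
proof -
  interpret point_law "unit_law :: (real^'d) measure" by (rule point_law_unit)
  define D :: "nat \<Rightarrow> (real^'d) set" where
    "D j = box (\<chi> i. real j / real k) (\<chi> i. (real j + 1) / real k)" for j
  let ?L = "\<lambda>B S. real (longest_chain (S \<inter> (B :: (real^'d) set)))"
  have memD: "x \<in> D j \<longleftrightarrow> (\<forall>i. real j / real k < x $ i \<and> x $ i < (real j + 1) / real k)" for x j
    by (simp add: D_def mem_box_cart)
  have sub: "D j \<subseteq> unit_box" if "j < k" for j
  proof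
    fix x assume x: "x \<in> D j"
    have "(real j + 1) / real k \<le> 1" using that by (simp add: field_simps)
    moreover have "0 \<le> real j / real k" by simp
    ultimately show "x \<in> unit_box" using x unfolding memD mem_unit_box by (meson le_less_trans less_le_trans)
  qed
  have pf: "point_functional (?L (D j))" for j
    by (rule point_functional_longest_chain) (simp add: D_def)
  \<comment> \<open>The factor \<open>1\<close> is the value of the density; it is written out to
    match \<open>\<mu> * box_vol\<close> in the thinning bound.\<close>
  have vol: "1 * box_vol (\<chi> i. real j / real k) (\<chi> i. (real j + 1) / real k :: real^'d) = 1 / real k ^ CARD('d)" for j
    using k by (simp add: box_vol_def diff_divide_distrib[symmetric] power_one_over[symmetric] inverse_eq_divide)
  have one: "(1 - s / (s - real m)\<^sup>2) * mean_chain TYPE('d) m \<le> iid_exp unit_law n (?L (D j))" if j: "j < k" for j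
  proof -
    have "real m < real n * (1 / real k ^ CARD('d))" using m k by (simp add: field_simps)
    then have "(1 - real n * (1 / real k ^ CARD('d)) / (real n * (1 / real k ^ CARD('d)) - real m)\<^sup>2) *
        iid_exp unit_law m (\<lambda>S. real (longest_chain (S \<inter> (unit_box :: (real^'d) set))))
     \<le> iid_exp (density lborel (\<lambda>x. ennreal (indicator unit_box x))) n (?L (D j))"
      unfolding D_def vol[of j, symmetric]
      using k sub[OF j]
      by (intro longest_chain_thinning[where h = "\<lambda>y. y"])
        (auto simp: divide_strict_right_mono emeasure_unit_box ennreal_indicator D_def)
    then show ?thesis by (simp add: mean_chain_def s_def unit_law_eq)
  qed
  have "real k * (1 - s / (s - real m)\<^sup>2) * mean_chain TYPE('d) m = (\<Sum>j<k. (1 - s / (s - real m)\<^sup>2) * mean_chain TYPE('d) m)"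
    by simp
  also have "\<dots> \<le> (\<Sum>j<k. iid_exp unit_law n (?L (D j)))"
    by (intro sum_mono one) auto
  also have "\<dots> = iid_exp unit_law n (\<lambda>S. \<Sum>j<k. ?L (D j) S)"
    by (rule iid_exp_sum[symmetric]) (rule pf)
  also have "\<dots> \<le> iid_exp unit_law n (?L unit_box)"
  proof (rule iid_exp_mono[OF point_functional_sum[OF pf] point_functional_unit])
    fix S :: "(real^'d) set" assume S: "finite S"
    have "(\<Sum>j<k. longest_chain (S \<inter> D j)) \<le> longest_chain (S \<inter> (\<Union>j<k. D j))"
    proof (rule longest_chain_stack_sum[OF S])
      fix i j x y assume ij: "i < j" "x \<in> D i" "y \<in> D j"
      have "(real i + 1) / real k \<le> real j / real k" using ij by (intro divide_right_mono) auto
      then have "x $ l < y $ l" for l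
        using ij unfolding memD by (meson less_le_trans less_trans)
      then show "vle x y \<and> x \<noteq> y" by (metis less_imp_le less_irrefl vle_def)
    qed
    also have "\<dots> \<le> longest_chain (S \<inter> unit_box)"
      using S sub by (intro longest_chain_mono) auto
    finally show "(\<Sum>j<k. ?L (D j) S) \<le> ?L unit_box S"
      by (metis of_nat_le_iff of_nat_sum)
  qed
  also have "\<dots> = mean_chain TYPE('d) n" by (simp add: mean_chain_def)
  finally show ?thesis .
qed

section \<open>First moment bound for increasing tuples of uniform points\<close>

definition ascending :: "nat \<Rightarrow> (nat \<Rightarrow> real^'d) \<Rightarrow> real^'d \<Rightarrow> bool" where
  "ascending k x t \<longleftrightarrow> (\<forall>i<k. vle (x i) t \<and> (\<forall>j<i. vle (x j) (x i)))"

text \<open>Once the largest point is peeled off, it becomes the bound for the remaining ones; the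
  bound \<open>t\<close> is carried along for this recursion.\<close>

lemma ascending_Suc: "ascending (Suc k) x t \<longleftrightarrow> ascending k x (x k) \<and> vle (x k) t"
  unfolding ascending_def by (auto simp: less_Suc_eq intro: vle_trans)

lemma ascending_cong: "(\<And>i. i < k \<Longrightarrow> x i = y i) \<Longrightarrow> ascending k x t \<longleftrightarrow> ascending k y t"
  unfolding ascending_def by (metis less_trans)

lemma measurable_vle:
  assumes "g \<in> borel_measurable M" "h \<in> borel_measurable M"
  shows "{x \<in> space M. vle (g x) (h x :: real^'d)} \<in> sets M"
  unfolding vle_def
  by (intro sets.sets_Collect_countable_All borel_measurable_le
      measurable_compose[OF assms(1) borel_measurable_nth] measurable_compose[OF assms(2) borel_measurable_nth])

lemma measurable_ascending:
  assumes "\<And>i. i < k \<Longrightarrow> (\<lambda>x. g x i) \<in> borel_measurable M"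
  shows "{x \<in> space M. ascending k (g x) t} \<in> sets M"
proof -
  have eq: "ascending k y t \<longleftrightarrow> (\<forall>i\<in>{..<k}. vle (y i) t \<and> (\<forall>j\<in>{..<i}. vle (y j) (y i)))" for y :: "nat \<Rightarrow> real^'b"
    by (auto simp: ascending_def)
  show ?thesis
    unfolding eq
    by (intro sets.sets_Collect_finite_All sets.sets_Collect_conj measurable_vle assms) (auto intro: assms)
qed

text \<open>The weight \<open>exp (l * (\<Sum>i. y $ i))\<close> is an approximate eigenfunction of the kernel \<open>y \<le> t\<close>
  with eigenvalue \<open>l\<close> to the power \<open>- CARD('d)\<close>.\<close>

lemma exp_weight_kernel:
  fixes t :: "real^'d"
  assumes l: "l > 0"
  shows "(\<integral>\<^sup>+ y. indicator {y. vle y t} y * ennreal (exp (l * (\<Sum>i\<in>UNIV. y $ i))) \<partial>unit_law)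
     \<le> ennreal (exp (l * (\<Sum>i\<in>UNIV. t $ i)) / l ^ CARD('d))"
proof -
  let ?g = "\<lambda>b u. ennreal (exp (l * u)) * indicator {0..t \<bullet> b} u"
  have S: "{y. vle y t} \<in> sets borel"
    using measurable_vle[of "\<lambda>y. y" borel "\<lambda>_. t"] by simp
  have one: "(\<integral>\<^sup>+ u. ?g b u \<partial>lborel) \<le> ennreal (exp (l * (t \<bullet> b)) / l)" for b
  proof (cases "0 \<le> t \<bullet> b")
    case True
    have "(\<integral>\<^sup>+ u. ?g b u \<partial>lborel) = ennreal (exp (l * (t \<bullet> b)) / l - exp (l * 0) / l)"
      using True l by (intro nn_integral_FTC_Icc) (auto intro!: derivative_eq_intros)
    also have "\<dots> \<le> ennreal (exp (l * (t \<bullet> b)) / l)" using l by (intro ennreal_leI) auto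
    finally show ?thesis .
  qed simp
  have "(\<integral>\<^sup>+ y. indicator {y. vle y t} y * ennreal (exp (l * (\<Sum>i\<in>UNIV. y $ i))) \<partial>unit_law)
      = (\<integral>\<^sup>+ y. indicator unit_box y * (indicator {y. vle y t} y * ennreal (exp (l * (\<Sum>i\<in>UNIV. y $ i)))) \<partial>lborel)"
    unfolding unit_law_def using S by (subst nn_integral_density) (auto intro!: borel_measurable_times_ennreal)
  \<comment> \<open>Enlarging the domain from the part of the cube below \<open>t\<close> to the
    whole box between 0 and \<open>t\<close> makes the integrand a product over the
    coordinates.\<close>
  also have "\<dots> \<le> (\<integral>\<^sup>+ y. (\<Prod>b\<in>Basis. ?g b (y \<bullet> b)) \<partial>lborel)"
  proof (rule nn_integral_mono)
    fix y :: "real^'d"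
    show "indicator unit_box y * (indicator {y. vle y t} y * ennreal (exp (l * (\<Sum>i\<in>UNIV. y $ i)))) \<le> (\<Prod>b\<in>Basis. ?g b (y \<bullet> b))"
    proof (cases "y \<in> unit_box \<and> vle y t")
      case True
      then have "0 \<le> y $ i" "y $ i \<le> t $ i" for i by (auto simp: mem_unit_box vle_def less_imp_le)
      then have "(\<Prod>b\<in>Basis. ?g b (y \<bullet> b)) = (\<Prod>i\<in>UNIV. ennreal (exp (l * y $ i)))"
        unfolding prod_Basis_cart by (simp add: inner_axis)
      also have "\<dots> = ennreal (exp (l * (\<Sum>i\<in>UNIV. y $ i)))"
        by (subst prod_ennreal) (auto simp: exp_sum sum_distrib_left)
      finally show ?thesis using True by simp
    qed (auto simp: indicator_def)
  qed
  also have "\<dots> = (\<Prod>b\<in>Basis. (\<integral>\<^sup>+ u. ?g b u \<partial>lborel))"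
    by (rule nn_integral_lborel_prod) auto
  also have "\<dots> \<le> (\<Prod>b\<in>Basis. ennreal (exp (l * (t \<bullet> b)) / l))"
    by (rule prod_mono_ennreal) (rule one)
  also have "\<dots> = (\<Prod>i\<in>UNIV. ennreal (exp (l * t $ i) / l))"
    unfolding prod_Basis_cart by (simp add: inner_axis)
  also have "\<dots> = ennreal (exp (l * (\<Sum>i\<in>UNIV. t $ i)) / l ^ CARD('d))"
    using l by (subst prod_ennreal) (auto simp: prod_dividef exp_sum sum_distrib_left)
  finally show ?thesis .
qed

text \<open>For \<open>k = 0\<close> the probability is one, which the weight at \<open>t\<close> need not dominate.\<close>

lemma ascending_prob:
  fixes t :: "real^'d"
  assumes l: "l > 0"
  shows "emeasure (PiM {..<k} (\<lambda>_. unit_law)) {x \<in> space (PiM {..<k} (\<lambda>_. unit_law)). ascending k x t}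
     \<le> ennreal (exp (l * (\<Sum>i\<in>UNIV. t $ i)) / l ^ (CARD('d) * k) * (if k = 0 then 1 / exp (l * (\<Sum>i\<in>UNIV. t $ i)) else 1))"
proof (induction k arbitrary: t)
  case 0
  interpret P: prob_space "PiM ({}::nat set) (\<lambda>_. unit_law :: (real^'d) measure)"
    by (rule prob_space_PiM) (use point_law_unit point_law_def in auto)
  show ?case
    using P.emeasure_space_1 by (simp add: ascending_def)
next
  case (Suc k)
  interpret U: point_law "unit_law :: (real^'d) measure" by (rule point_law_unit)
  interpret product_sigma_finite "\<lambda>_::nat. unit_law :: (real^'d) measure" by standard
  let ?P = "\<lambda>k. PiM {..<k} (\<lambda>_. unit_law :: (real^'d) measure)"
  let ?E = "\<lambda>k t. {x \<in> space (?P k). ascending k x t}"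
  have sp: "x \<in> space (?P k) \<longleftrightarrow> x \<in> extensional {..<k}" for x k
    by (simp add: space_PiM PiE_def unit_law_def)
  have c: "(\<lambda>x. x i) \<in> borel_measurable (?P k)" if "i < k" for i k
  proof -
    have "(\<lambda>x. x i) \<in> ?P k \<rightarrow>\<^sub>M unit_law" using that by (intro measurable_component_singleton) auto
    then show ?thesis using measurable_cong_sets[OF refl U.sets_law] by blast
  qed
  have E: "?E k t \<in> sets (?P k)" for k t
    by (rule measurable_ascending) (rule c)
  have S: "{y. vle y t} \<in> sets borel" for t :: "real^'d"
    using measurable_vle[of "\<lambda>y. y" borel "\<lambda>_. t"] by simp
  have "emeasure (?P (Suc k)) (?E (Suc k) t) = (\<integral>\<^sup>+ x. indicator (?E (Suc k) t) x \<partial>?P (Suc k))"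
    using E by simp
  also have "\<dots> = (\<integral>\<^sup>+ x. indicator (?E (Suc k) t) x \<partial>PiM (insert k {..<k}) (\<lambda>_. unit_law))"
    by (simp add: lessThan_Suc)
  \<comment> \<open>The last point is integrated outermost, because it bounds all the
    others.\<close>
  also have "\<dots> = (\<integral>\<^sup>+ y. (\<integral>\<^sup>+ x. indicator (?E (Suc k) t) (x(k := y)) \<partial>?P k) \<partial>unit_law)"
    using E[of "Suc k" t] by (intro product_nn_integral_insert_rev) (auto simp: lessThan_Suc)
  also have "\<dots> = (\<integral>\<^sup>+ y. (\<integral>\<^sup>+ x. indicator {y. vle y t} y * indicator (?E k y) x \<partial>?P k) \<partial>unit_law)"
  proof (intro nn_integral_cong)
    fix y x assume x: "x \<in> space (?P k)"
    have "x(k := y) \<in> space (?P (Suc k))"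
      using x unfolding sp extensional_def by auto
    moreover have "ascending k (x(k := y)) y \<longleftrightarrow> ascending k x y"
      by (rule ascending_cong) auto
    ultimately show "indicator (?E (Suc k) t) (x(k := y)) = (indicator {y. vle y t} y * indicator (?E k y) x :: ennreal)"
      using x by (auto simp: indicator_def ascending_Suc)
  qed
  also have "\<dots> = (\<integral>\<^sup>+ y. indicator {y. vle y t} y * emeasure (?P k) (?E k y) \<partial>unit_law)"
    using E by (simp add: nn_integral_cmult)
  also have "\<dots> \<le> (\<integral>\<^sup>+ y. ennreal (1 / l ^ (CARD('d) * k)) * (indicator {y. vle y t} y * ennreal (exp (l * (\<Sum>i\<in>UNIV. y $ i)))) \<partial>unit_law)"
  proof (intro nn_integral_mono_AE)
    have "AE y in unit_law. y \<in> (unit_box :: (real^'d) set)"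
      unfolding unit_law_def by (subst AE_density) (auto simp: indicator_def split: if_splits)
    then show "AE y in unit_law. indicator {y. vle y t} y * emeasure (?P k) (?E k y)
       \<le> ennreal (1 / l ^ (CARD('d) * k)) * (indicator {y. vle y t} y * ennreal (exp (l * (\<Sum>i\<in>UNIV. y $ i))))"
    proof eventually_elim
      case (elim y)
      have s: "0 \<le> (\<Sum>i\<in>UNIV. y $ i)"
        using elim by (intro sum_nonneg) (auto simp: mem_unit_box less_imp_le)
      let ?e = "exp (l * (\<Sum>i\<in>UNIV. y $ i))"
      \<comment> \<open>Points of the unit box have positive coordinates, so the weight at
        \<open>y\<close> is at least one and dominates also in the exceptional case
        \<open>k = 0\<close> of the induction hypothesis.\<close>
      have e1: "1 \<le> ?e" using s l by simp
      have "emeasure (?P k) (?E k y) \<le> ennreal (?e / l ^ (CARD('d) * k) * (if k = 0 then 1 / ?e else 1))"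
        by (rule Suc.IH)
      also have "\<dots> \<le> ennreal (?e / l ^ (CARD('d) * k))"
        using e1 l by (intro ennreal_leI) auto
      also have "\<dots> = ennreal (1 / l ^ (CARD('d) * k)) * ennreal ?e"
        using l by (simp flip: ennreal_mult')
      finally show ?case by (auto simp: indicator_def)
    qed
  qed
  also have "\<dots> = ennreal (1 / l ^ (CARD('d) * k)) * (\<integral>\<^sup>+ y. indicator {y. vle y t} y * ennreal (exp (l * (\<Sum>i\<in>UNIV. y $ i))) \<partial>unit_law)"
    using S by (intro nn_integral_cmult) (simp add: unit_law_def)
  also have "\<dots> \<le> ennreal (1 / l ^ (CARD('d) * k)) * ennreal (exp (l * (\<Sum>i\<in>UNIV. t $ i)) / l ^ CARD('d))"
    by (intro mult_left_mono exp_weight_kernel l) auto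
  also have "\<dots> = ennreal (exp (l * (\<Sum>i\<in>UNIV. t $ i)) / l ^ (CARD('d) * Suc k))"
    using l by (simp add: power_add mult.commute flip: ennreal_mult')
  finally show ?case by simp
qed

text \<open>A finite nonempty chain has a greatest element; placing it last and recursing sorts the
  chain.\<close>

lemma finite_chain_enum:
  assumes "finite C" "Complete_Partial_Order.chain vle C" "card C = k"
  shows "\<exists>g. bij_betw g {..<k} C \<and> (\<forall>i<k. \<forall>j<i. vle (g j) (g i))"
  using assms
proof (induction k arbitrary: C)
  case 0
  then show ?case by (intro exI[of _ "\<lambda>_. undefined"]) (auto simp: bij_betw_def)
next
  case (Suc k)
  have "\<exists>m\<in>C. \<forall>c\<in>C. vle c m"
    if "finite C" "C \<noteq> {}" "Complete_Partial_Order.chain vle C" for C :: "(real^'a) set"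
    using that
  proof (induction C rule: finite_ne_induct)
    case (insert c C)
    then obtain m where m: "m \<in> C" "\<forall>c\<in>C. vle c m" by (auto intro: chain_vle_subset)
    have "vle c m \<or> vle m c" using insert.prems m by (auto simp: chain_def)
    then show ?case
    proof
      assume "vle m c"
      then have "\<forall>c'\<in>insert c C. vle c' c" using m vle_trans by auto
      then show ?thesis by blast
    qed (use m in auto)
  qed auto
  then obtain m where m: "m \<in> C" "\<forall>c\<in>C. vle c m"
    using Suc.prems by (metis card.empty nat.distinct(1))
  have "\<exists>g. bij_betw g {..<k} (C - {m}) \<and> (\<forall>i<k. \<forall>j<i. vle (g j) (g i))"
    using Suc.prems m by (intro Suc.IH) (auto intro: chain_vle_subset)
  then obtain g where g: "bij_betw g {..<k} (C - {m})" "\<forall>i<k. \<forall>j<i. vle (g j) (g i)" by blast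
  let ?g = "g(k := m)"
  have "bij_betw ?g {..<k} (C - {m})" using g(1) by (subst bij_betw_cong[of _ _ g]) auto
  moreover have "bij_betw ?g {k} {m}" by (simp add: bij_betw_def)
  ultimately have "bij_betw ?g ({..<k} \<union> {k}) ((C - {m}) \<union> {m})"
    by (rule bij_betw_combine) auto
  then have "bij_betw ?g {..<Suc k} C" using m by (simp add: lessThan_Suc insert_absorb)
  moreover have "\<forall>i<Suc k. \<forall>j<i. vle (?g j) (?g i)"
    using g m bij_betwE[OF g(1)] by (auto simp: less_Suc_eq)
  ultimately show ?case by blast
qed

text \<open>Union bound: a chain of size \<open>k\<close> is an ascending selection of
  \<open>k\<close> among the \<open>n\<close> points. There are at most \<open>n ^ k\<close>
  injective selections, and each ascends with the probability bounded by
  \<open>ascending_prob\<close> at the top corner of the cube.\<close>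

lemma longest_chain_tail:
  assumes l: "l > 0" and k: "k > 0"
  shows "iid_exp (unit_law :: (real^'d) measure) n (\<lambda>S. indicator {real k..} (real (longest_chain (S \<inter> unit_box))))
     \<le> real n ^ k * (exp (l * real CARD('d)) / l ^ (CARD('d) * k))"
proof -
  interpret U: point_law "unit_law :: (real^'d) measure" by (rule point_law_unit)
  let ?P = "\<lambda>n. PiM {..<n} (\<lambda>_. unit_law :: (real^'d) measure)"
  interpret P: prob_space "?P n" by (rule prob_space_PiM) (rule U.prob_space_axioms)
  interpret Pk: prob_space "?P k" by (rule prob_space_PiM) (rule U.prob_space_axioms)
  let ?A = "{x \<in> space (?P n). real k \<le> real (longest_chain (x ` {..<n} \<inter> unit_box))}"
  let ?I = "{f \<in> {..<k} \<rightarrow>\<^sub>E {..<n}. inj_on f {..<k}}"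
  let ?B = "\<lambda>f. {x \<in> space (?P n). ascending k (\<lambda>i. x (f i)) 1}"
  let ?q = "exp (l * real CARD('d)) / l ^ (CARD('d) * k)"
  have c: "(\<lambda>x. x i) \<in> borel_measurable (?P n)" if "i < n" for i n
  proof -
    have "(\<lambda>x. x i) \<in> ?P n \<rightarrow>\<^sub>M unit_law" using that by (intro measurable_component_singleton) auto
    then show ?thesis using measurable_cong_sets[OF refl U.sets_law] by blast
  qed
  have Bm: "?B f \<in> sets (?P n)" if "f \<in> ?I" for f
    using that by (intro measurable_ascending c) auto
  have fI: "finite ?I" by (rule finite_subset[of _ "{..<k} \<rightarrow>\<^sub>E {..<n}"]) (auto intro: finite_PiE)
  have Bq: "P.prob (?B f) \<le> ?q" if f: "f \<in> ?I" for f
  proof -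
    \<comment> \<open>Selecting distinct coordinates reproduces the product law, so all selections
      are equally likely to ascend.\<close>
    have d: "distr (?P n) (?P k) (\<lambda>\<omega>. \<lambda>i\<in>{..<k}. \<omega> (f i)) = ?P k"
      using f by (intro distr_PiM_reindex) (auto simp: U.prob_space_axioms)
    have m: "(\<lambda>\<omega>. \<lambda>i\<in>{..<k}. \<omega> (f i)) \<in> ?P n \<rightarrow>\<^sub>M ?P k"
      using f by (intro measurable_restrict measurable_component_singleton) auto
    let ?E = "{x \<in> space (?P k). ascending k x 1}"
    have E: "?E \<in> sets (?P k)" by (intro measurable_ascending c)
    have "emeasure (?P n) (?B f) = emeasure (?P n) ((\<lambda>\<omega>. \<lambda>i\<in>{..<k}. \<omega> (f i)) -` ?E \<inter> space (?P n))"
    proof (intro arg_cong[where f = "emeasure (?P n)"] set_eqI iffI)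
      fix x :: "nat \<Rightarrow> real^'d"
      have a: "ascending k (\<lambda>i\<in>{..<k}. x (f i)) 1 \<longleftrightarrow> ascending k (\<lambda>i. x (f i)) 1"
        by (rule ascending_cong) auto
      show "x \<in> (\<lambda>\<omega>. \<lambda>i\<in>{..<k}. \<omega> (f i)) -` ?E \<inter> space (?P n)" if "x \<in> ?B f"
        using that a measurable_space[OF m, of x] by auto
      show "x \<in> ?B f" if "x \<in> (\<lambda>\<omega>. \<lambda>i\<in>{..<k}. \<omega> (f i)) -` ?E \<inter> space (?P n)"
        using that a by auto
    qed
    also have "\<dots> = emeasure (?P k) ?E"
      using emeasure_distr[OF m E] d by simp
    also have "\<dots> \<le> ennreal ?q"
      using ascending_prob[OF l, of k "1 :: real^'d"] k by simp
    finally show ?thesis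
      using l unfolding P.emeasure_eq_measure by (subst (asm) ennreal_le_iff) auto
  qed
  have sub: "?A \<subseteq> (\<Union>f\<in>?I. ?B f)"
  proof
    fix x assume x: "x \<in> ?A"
    then have "k \<le> longest_chain (x ` {..<n} \<inter> unit_box)" by simp
    then obtain C where C: "C \<subseteq> x ` {..<n} \<inter> unit_box" "Complete_Partial_Order.chain vle C" "card C = k"
      by (subst (asm) le_longest_chain_iff) auto
    have fC: "finite C" using C(1) finite_subset by blast
    obtain g where g: "bij_betw g {..<k} C" "\<forall>i<k. \<forall>j<i. vle (g j) (g i)"
      using finite_chain_enum[OF fC C(2,3)] by blast
    have gC: "g i \<in> x ` {..<n}" "g i \<in> unit_box" if "i < k" for i
    proof -
      have "g i \<in> C" using bij_betwE[OF g(1)] that by blast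
      then show "g i \<in> x ` {..<n}" "g i \<in> unit_box" using C(1) by blast+
    qed
    have "\<forall>i\<in>{..<k}. \<exists>j. j < n \<and> x j = g i"
    proof
      fix i assume "i \<in> {..<k}"
      then obtain j where "g i = x j" "j \<in> {..<n}" using gC(1)[of i] by auto
      then show "\<exists>j. j < n \<and> x j = g i" by auto
    qed
    then obtain f where f: "\<forall>i\<in>{..<k}. f i < n \<and> x (f i) = g i" by (rule bchoice[THEN exE])
    let ?f = "restrict f {..<k}"
    have "inj_on ?f {..<k}"
    proof (rule inj_onI)
      fix i j assume ij: "i \<in> {..<k}" "j \<in> {..<k}" "?f i = ?f j"
      have "g i = x (f i)" "g j = x (f j)" using f ij(1,2) by auto
      moreover have "f i = f j" using ij by simp
      ultimately show "i = j" using bij_betw_imp_inj_on[OF g(1)] ij by (metis inj_onD)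
    qed
    then have "?f \<in> ?I" using f by auto
    moreover have "vle (g i) 1" if "i < k" for i
      using gC(2)[OF that] by (simp add: vle_def mem_unit_box less_imp_le)
    then have "ascending k (\<lambda>i. x (?f i)) 1"
      using f g(2) unfolding ascending_def by auto
    ultimately show "x \<in> (\<Union>f\<in>?I. ?B f)" using x by blast
  qed
  have "iid_exp unit_law n (\<lambda>S. indicator {real k..} (real (longest_chain (S \<inter> (unit_box :: (real^'d) set)))))
      = (\<integral>x. indicator ?A x \<partial>?P n)"
    unfolding iid_exp_def by (intro Bochner_Integration.integral_cong) (auto simp: indicator_def)
  also have "\<dots> = P.prob (?A \<inter> space (?P n))" by simp
  also have "\<dots> = P.prob ?A" by (rule arg_cong[where f = P.prob]) auto
  also have "\<dots> \<le> P.prob (\<Union>f\<in>?I. ?B f)"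
    using sub fI Bm by (intro P.finite_measure_mono) auto
  also have "\<dots> \<le> (\<Sum>f\<in>?I. P.prob (?B f))"
    using fI Bm by (intro P.finite_measure_subadditive_finite) auto
  also have "\<dots> \<le> (\<Sum>f\<in>?I. ?q)" by (intro sum_mono Bq)
  also have "\<dots> = real (card ?I) * ?q" by simp
  also have "\<dots> \<le> real n ^ k * ?q"
  proof (intro mult_right_mono)
    have "card ?I \<le> card ({..<k} \<rightarrow>\<^sub>E {..<n})"
      by (intro card_mono) (auto intro: finite_PiE)
    also have "\<dots> = n ^ k" by (simp add: card_PiE)
    finally show "real (card ?I) \<le> real n ^ k" by (metis of_nat_le_iff of_nat_power)
  qed (use l in auto)
  finally show ?thesis .
qed

lemma mean_chain_upper:
  "\<exists>C>0. \<forall>n\<ge>1. mean_chain TYPE('d::finite) n \<le> C * real n powr (1 / real CARD('d))"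
proof -
  let ?d = "real CARD('d)"
  interpret U: point_law "unit_law :: (real^'d) measure" by (rule point_law_unit)
  have d: "?d > 0" by simp
  define C where "C = 2 * ?d * exp 1 powr (1 / ?d) + 2"
  have "mean_chain TYPE('d) n \<le> C * real n powr (1 / ?d)" if n: "n \<ge> 1" for n
  proof -
    \<comment> \<open>With \<open>l ^ d = exp 1 * n\<close> the factors
      \<open>n ^ k / l ^ (d * k)\<close> of the union bound reduce to
      \<open>exp (- k)\<close>.\<close>
    define l where "l = (exp 1 * real n) powr (1 / ?d)"
    have en: "exp 1 * real n > 0" using n by simp
    have l: "l > 0" using n by (simp add: l_def)
    have ld: "l ^ CARD('d) = exp 1 * real n"
    proof -
      have "l ^ CARD('d) = l powr ?d" using powr_realpow[OF l, of "CARD('d)"] by simp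
      also have "\<dots> = exp 1 * real n" unfolding l_def using en d by (simp add: powr_powr)
      finally show ?thesis .
    qed
    \<comment> \<open>Twice \<open>l * d\<close>, so that the tail at \<open>K\<close> is at most
      \<open>exp (- (l * d))\<close>, hence at most \<open>1 / n\<close>. Even a chain of all
      \<open>n\<close> points on that event then adds only 1 to the mean.\<close>
    define K where "K = nat \<lceil>2 * l * ?d\<rceil>"
    have K: "2 * l * ?d \<le> real K" "real K \<le> 2 * l * ?d + 1" "K > 0"
      using l d unfolding K_def by (auto simp: ceiling_less_iff intro: less_imp_le)
    let ?L = "\<lambda>S. real (longest_chain (S \<inter> (unit_box :: (real^'d) set)))"
    let ?I = "\<lambda>S. indicator {real K..} (?L S) :: real"
    have pI: "point_functional ?I" by (intro point_functional_indicator point_functional_unit) auto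
    have "mean_chain TYPE('d) n \<le> (\<integral>x. real K + real n * ?I (x ` {..<n}) \<partial>PiM {..<n} (\<lambda>_. unit_law))"
      unfolding mean_chain_def iid_exp_def
    proof (rule integral_mono)
      show "integrable (PiM {..<n} (\<lambda>_. unit_law)) (\<lambda>x. ?L (x ` {..<n}))"
        by (rule U.iid_integrable[OF point_functional_unit])
      show "integrable (PiM {..<n} (\<lambda>_. unit_law)) (\<lambda>x. real K + real n * ?I (x ` {..<n}))"
        using U.iid_integrable[OF point_functional_add[OF point_functional_const
              point_functional_mult[OF point_functional_const pI]]] by simp
      fix x :: "nat \<Rightarrow> real^'d"
      have "longest_chain (x ` {..<n} \<inter> unit_box) \<le> card (x ` {..<n} \<inter> unit_box)"
        by (intro longest_chain_le_card) auto
      also have "\<dots> \<le> card (x ` {..<n})" by (intro card_mono) auto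
      also have "\<dots> \<le> n" using card_image_le[of "{..<n}" x] by simp
      finally show "?L (x ` {..<n}) \<le> real K + real n * ?I (x ` {..<n})"
        by (auto simp: indicator_def)
    qed
    also have "\<dots> = iid_exp unit_law n (\<lambda>S. real K + real n * ?I S)"
      by (simp add: iid_exp_def)
    also have "\<dots> = real K + real n * iid_exp unit_law n ?I"
      by (subst U.iid_exp_add[OF point_functional_const point_functional_mult[OF point_functional_const pI]])
        (simp add: U.iid_exp_cmult)
    also have "real n * iid_exp unit_law n ?I \<le> 1"
    proof -
      have "iid_exp unit_law n ?I \<le> real n ^ K * (exp (l * ?d) / l ^ (CARD('d) * K))"
        by (rule longest_chain_tail[OF l K(3)])
      also have "\<dots> = exp (l * ?d) / exp 1 ^ K"
        using n unfolding power_mult ld by (simp add: power_mult_distrib field_simps)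
      also have "\<dots> = exp (l * ?d - real K)"
        by (simp add: exp_diff flip: exp_of_nat_mult)
      also have "\<dots> \<le> exp (- (l * ?d))" using K(1) by simp
      also have "\<dots> \<le> 1 / real n"
      proof -
        have "real n \<le> exp 1 * real n" using n by simp
        also have "\<dots> \<le> exp l ^ CARD('d)"
          unfolding ld[symmetric] using l by (intro power_mono) (auto intro: order_trans[OF _ exp_ge_add_one_self])
        also have "\<dots> = exp (l * ?d)" by (simp add: exp_of_nat_mult[symmetric] mult.commute)
        finally show ?thesis using n by (simp add: exp_minus field_simps)
      qed
      finally have "iid_exp unit_law n ?I \<le> 1 / real n" .
      then show ?thesis using n by (simp add: field_simps)
    qed
    finally have "mean_chain TYPE('d) n \<le> 2 * l * ?d + 2" using K(2) by linarith
    also have "l = exp 1 powr (1 / ?d) * real n powr (1 / ?d)"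
      unfolding l_def by (simp add: powr_mult)
    also have "2 * (exp 1 powr (1 / ?d) * real n powr (1 / ?d)) * ?d + 2 \<le> C * real n powr (1 / ?d)"
    proof -
      have "1 \<le> real n powr (1 / ?d)" using n by (simp add: ge_one_powr_ge_zero)
      then show ?thesis unfolding C_def by (simp add: algebra_simps)
    qed
    finally show ?thesis .
  qed
  moreover have "C > 0" unfolding C_def by (intro add_nonneg_pos) auto
  ultimately show ?thesis by blast
qed


text \<open>A quantitative form of Fekete's argument. For fixed \<open>m\<close>, stacking gives
  that \<open>\<phi> m * b m\<close> is at most the limit inferior \<open>r\<close> of
  \<open>b\<close>; as \<open>\<phi> m\<close> tends to 1, this bounds \<open>b m\<close> from above
  by nearly \<open>r\<close>, so the limit exists. That \<open>r\<close> is finite comes from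
  \<open>mean_chain_upper\<close>, that it is positive from the case \<open>m = 1\<close>.\<close>

lemma chain_growth:
  "\<exists>c>0. (\<lambda>n. mean_chain TYPE('d::finite) n / real n powr (1 / real CARD('d))) \<longlonglongrightarrow> c"
proof -
  let ?d = "real CARD('d)"
  let ?a = "mean_chain TYPE('d)"
  define b where "b n = ?a n / real n powr (1 / ?d)" for n
  have d: "?d > 0" by simp
  have a0: "0 \<le> ?a n" for n by (rule mean_chain_nonneg)
  have key: "((real n / (real m * (1 + \<epsilon>))) powr (1 / ?d) - 1) * \<theta> * ?a m \<le> ?a n"
    if \<epsilon>: "\<epsilon> > 0" and m: "m \<ge> 1" and n: "n \<ge> 1"
      and \<theta>: "\<theta> = 1 - (1 + \<epsilon>) / (\<epsilon>\<^sup>2 * real m)" "\<theta> \<ge> 0" for \<epsilon> \<theta> :: real and m n :: nat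
  proof -
    \<comment> \<open>Boxes are to hold \<open>m * (1 + \<epsilon>)\<close> points on average, the
      surplus over \<open>m\<close> paying for the Chebyshev loss; \<open>x\<close> is the resulting
      number of boxes before rounding.\<close>
    define x where "x = (real n / (real m * (1 + \<epsilon>))) powr (1 / ?d)"
    define k where "k = nat \<lfloor>x\<rfloor>"
    have pos: "real n / (real m * (1 + \<epsilon>)) > 0" using \<epsilon> m n by auto
    have x: "x > 0" using pos unfolding x_def by (metis less_irrefl powr_gt_zero)
    have k: "real k \<le> x" "x - 1 \<le> real k" using x unfolding k_def by linarith+
    show ?thesis
    \<comment> \<open>With \<open>k = 0\<close> there is no box to stack, but then
      \<open>x \<le> 1\<close> and the left-hand side is nonpositive.\<close>
    proof (cases "k = 0")
      case True
      then have "(x - 1) * \<theta> * ?a m \<le> 0"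
        using k \<theta>(2) a0[of m] by (intro mult_nonpos_nonneg) auto
      then show ?thesis using a0[of n] unfolding x_def by linarith
    next
      case False
      have "real k ^ CARD('d) \<le> x ^ CARD('d)" using k by (intro power_mono) auto
      also have "x ^ CARD('d) = x powr ?d" using powr_realpow[OF x, of "CARD('d)"] by simp
      also have "\<dots> = real n / (real m * (1 + \<epsilon>))" 
      proof -
        have "(w powr (1 / ?d)) powr ?d = w" if "w > 0" for w :: real
          using that d by (simp add: powr_powr)
        from this[OF pos] show ?thesis by (simp only: x_def)
      qed
      finally have kd: "real k ^ CARD('d) \<le> real n / (real m * (1 + \<epsilon>))" .
      have kp: "real k ^ CARD('d) > 0" using False by simp
      define s where "s = real n / real k ^ CARD('d)"
      have mp: "real m > 0" using m by simp
      have s: "real m * (1 + \<epsilon>) \<le> s"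
      proof -
        have "0 < real m * (1 + \<epsilon>)" using mp \<epsilon> by simp
        then have "real k ^ CARD('d) * (real m * (1 + \<epsilon>)) \<le> real n" using kd by (simp only: pos_le_divide_eq)
        then show ?thesis unfolding s_def pos_le_divide_eq[OF kp] by (simp only: mult.commute)
      qed
      have "real m < real m * (1 + \<epsilon>)" using \<epsilon> mp by simp
      then have sm: "real m < s" using s by linarith
      \<comment> \<open>The loss decreases in \<open>s\<close>, and at
        \<open>s = m * (1 + \<epsilon>)\<close> it equals the right-hand side.\<close>
      have "s / (s - real m)\<^sup>2 \<le> (1 + \<epsilon>) / (\<epsilon>\<^sup>2 * real m)"
      proof -
        define r where "r = s - real m * (1 + \<epsilon>)"
        have r: "r \<ge> 0" "s = real m + real m * \<epsilon> + r" using s by (auto simp: r_def algebra_simps)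
        have "(1 + \<epsilon>) * (s - real m)\<^sup>2 - s * (\<epsilon>\<^sup>2 * real m) = 2 * real m * \<epsilon> * r + real m * \<epsilon>\<^sup>2 * r + (1 + \<epsilon>) * r\<^sup>2"
          unfolding r(2) by (simp add: power2_eq_square algebra_simps)
        moreover have "\<dots> \<ge> 0" using r \<epsilon> mp by auto
        ultimately have "s * (\<epsilon>\<^sup>2 * real m) \<le> (1 + \<epsilon>) * (s - real m)\<^sup>2" by linarith
        moreover have "(s - real m)\<^sup>2 > 0" using sm by simp
        moreover have "\<epsilon>\<^sup>2 * real m > 0" using \<epsilon> mp by simp
        ultimately show ?thesis by (simp add: frac_le_eq divide_le_eq pos_le_divide_eq pos_divide_le_eq mult.commute)
      qed
      then have "(x - 1) * \<theta> * ?a m \<le> real k * (1 - s / (s - real m)\<^sup>2) * ?a m"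
        using k \<theta> a0[of m] by (intro mult_right_mono mult_mono) auto
      also have "\<dots> \<le> ?a n"
        unfolding s_def
      proof (rule mean_chain_superadditive)
        show "real m * real k ^ CARD('d) < real n"
          using sm kp unfolding s_def by (simp add: field_simps)
      qed (use False in auto)
      finally show ?thesis unfolding x_def .
    qed
  qed
  have lower: "ereal ((1 + \<epsilon>) powr (- 1 / ?d) * \<theta> * b m) \<le> liminf (\<lambda>n. ereal (b n))"
    if \<epsilon>: "\<epsilon> > 0" and m: "m \<ge> 1"
      and \<theta>: "\<theta> = 1 - (1 + \<epsilon>) / (\<epsilon>\<^sup>2 * real m)" "\<theta> \<ge> 0" for \<epsilon> \<theta> :: real and m :: nat
  proof -
    define q where "q = (1 / (real m * (1 + \<epsilon>))) powr (1 / ?d)"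
    have qe: "q = (1 + \<epsilon>) powr (- 1 / ?d) / real m powr (1 / ?d)"
      unfolding q_def using \<epsilon> m by (simp add: powr_divide powr_mult powr_minus_divide)
    have "((\<lambda>n. (q - real n powr (- 1 / ?d)) * \<theta> * ?a m) \<longlongrightarrow> (q - 0) * \<theta> * ?a m) sequentially"
      using d by (intro tendsto_intros tendsto_neg_powr filterlim_real_sequentially) auto
    then have "ereal ((q - 0) * \<theta> * ?a m) = liminf (\<lambda>n. ereal ((q - real n powr (- 1 / ?d)) * \<theta> * ?a m))"
      by (intro lim_imp_Liminf[symmetric]) (auto intro: tendsto_ereal)
    also have "\<dots> \<le> liminf (\<lambda>n. ereal (b n))"
    proof (rule Liminf_mono)
      show "\<forall>\<^sub>F n in sequentially. ereal ((q - real n powr (- 1 / ?d)) * \<theta> * ?a m) \<le> ereal (b n)"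
        using eventually_ge_at_top[of 1]
      proof eventually_elim
        case (elim n)
        have np: "real n powr (1 / ?d) > 0" using elim by simp
        have "(real n / (real m * (1 + \<epsilon>))) powr (1 / ?d) = q * real n powr (1 / ?d)"
          unfolding q_def using \<epsilon> m by (simp add: powr_mult[symmetric])
        then have "(q * real n powr (1 / ?d) - 1) * \<theta> * ?a m \<le> ?a n"
          using key[OF \<epsilon> m elim \<theta>] by simp
        then have "(q * real n powr (1 / ?d) - 1) * \<theta> * ?a m / real n powr (1 / ?d) \<le> b n"
          unfolding b_def using np by (intro divide_right_mono) auto
        also have "(q * real n powr (1 / ?d) - 1) * \<theta> * ?a m / real n powr (1 / ?d) = (q - real n powr (- 1 / ?d)) * \<theta> * ?a m"
          using np by (simp add: field_simps powr_minus_divide)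
        finally show ?case by simp
      qed
    qed
    also have "(q - 0) * \<theta> * ?a m = (1 + \<epsilon>) powr (- 1 / ?d) * \<theta> * b m"
      unfolding qe b_def by simp
    finally show ?thesis .
  qed
  obtain C where C: "\<And>n. n \<ge> 1 \<Longrightarrow> ?a n \<le> C * real n powr (1 / ?d)"
    using mean_chain_upper[where 'd = 'd] by blast
  have bC: "b n \<le> C" if "n \<ge> 1" for n
    using C[OF that] that by (simp add: b_def divide_le_eq)
  have "liminf (\<lambda>n. ereal (b n)) \<le> limsup (\<lambda>n. ereal (b n))"
    by (rule Liminf_le_Limsup) simp
  also have "\<dots> \<le> ereal C"
    by (rule Limsup_bounded) (use bC in \<open>auto intro!: eventually_sequentiallyI[of 1]\<close>)
  finally have ub: "liminf (\<lambda>n. ereal (b n)) \<le> ereal C" .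
  \<comment> \<open>For \<open>m = 1\<close> and \<open>\<epsilon> = 3\<close> the factor
    \<open>\<theta>\<close> is \<open>1 - 4/9\<close>.\<close>
  have pos: "ereal ((1 + 3) powr (- 1 / ?d) * (5/9) * b 1) \<le> liminf (\<lambda>n. ereal (b n))"
    by (rule lower) auto
  have b1: "b 1 = 1" by (simp add: b_def mean_chain_1[unfolded One_nat_def])
  obtain r where r: "liminf (\<lambda>n. ereal (b n)) = ereal r"
    using ub pos by (cases "liminf (\<lambda>n. ereal (b n))") auto
  have "(0::real) < (1 + 3) powr (- 1 / ?d) * (5/9) * b 1" unfolding b1 by simp
  also have "\<dots> \<le> r" using pos r by simp
  finally have r0: "r > 0" .
  \<comment> \<open>The exponent lies strictly between \<open>-1/2\<close> and 0, so
    \<open>\<epsilon> m\<close> tends to 0 while \<open>(\<epsilon> m) ^ 2 * m\<close> tends to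
    infinity; together these send \<open>\<phi> m\<close> to 1.\<close>
  define \<epsilon> where "\<epsilon> m = real m powr (- 1 / 3)" for m
  define \<theta> where "\<theta> m = 1 - (1 + \<epsilon> m) / ((\<epsilon> m)\<^sup>2 * real m)" for m
  define \<phi> where "\<phi> m = (1 + \<epsilon> m) powr (- 1 / ?d) * \<theta> m" for m
  have \<epsilon>0: "\<epsilon> \<longlonglongrightarrow> 0" unfolding \<epsilon>_def by real_asymp
  have \<theta>1: "\<theta> \<longlonglongrightarrow> 1" unfolding \<theta>_def \<epsilon>_def by real_asymp
  have "\<phi> \<longlonglongrightarrow> (1 + 0) powr (- 1 / ?d) * 1"
    unfolding \<phi>_def by (intro tendsto_intros \<epsilon>0 \<theta>1) auto
  then have \<phi>1: "\<phi> \<longlonglongrightarrow> 1" by simp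
  have "(\<lambda>m. r / \<phi> m) \<longlonglongrightarrow> r / 1" by (intro tendsto_intros \<phi>1) auto
  then have rphi: "(\<lambda>m. r / \<phi> m) \<longlonglongrightarrow> r" by simp
  have upper: "\<forall>\<^sub>F m in sequentially. b m \<le> r / \<phi> m"
    using eventually_ge_at_top[of 1] order_tendstoD(1)[OF \<theta>1, of 0, simplified] order_tendstoD(1)[OF \<phi>1, of 0, simplified]
  proof eventually_elim
    case (elim m)
    have "ereal (\<phi> m * b m) \<le> liminf (\<lambda>n. ereal (b n))"
      unfolding \<phi>_def using elim by (intro lower) (auto simp: \<theta>_def \<epsilon>_def)
    then show ?case using r elim by (simp add: pos_le_divide_eq mult.commute)
  qed
  have "b \<longlonglongrightarrow> r"
  proof (rule order_tendstoI)
    fix y assume "y < r"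
    then have "ereal y < liminf (\<lambda>n. ereal (b n))" using r by simp
    from less_LiminfD[OF this] show "\<forall>\<^sub>F n in sequentially. y < b n" by simp
  next
    fix y assume "r < y"
    from order_tendstoD(2)[OF rphi this] upper show "\<forall>\<^sub>F n in sequentially. b n < y"
      by eventually_elim auto
  qed
  then show ?thesis using r0 unfolding b_def by blast
qed

subsection \<open>Almost sure convergence\<close>

text \<open>Along \<open>n = k ^ (2 * d)\<close> the variance bound is summable, while consecutive values of
  \<open>n powr (1 / d) = k\<^sup>2\<close> have ratio tending to one.\<close>

lemma root_index:
  fixes n d :: nat
  assumes d: "d > 0"
  defines "k \<equiv> nat \<lfloor>real n powr (1 / (2 * real d))\<rfloor>"
  shows "k ^ (2 * d) \<le> n" "n \<le> (k + 1) ^ (2 * d)"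
    "(real k)\<^sup>2 \<le> real n powr (1 / real d)" "real n powr (1 / real d) \<le> (real k + 1)\<^sup>2"
proof -
  define y where "y = real n powr (1 / (2 * real d))"
  have y0: "y \<ge> 0" unfolding y_def by simp
  have yn: "y ^ (2 * d) = real n"
  proof (cases "n = 0")
    case False
    then have "y > 0" unfolding y_def by simp
    then have "y ^ (2 * d) = y powr real (2 * d)" by (simp only: powr_realpow)
    also have "\<dots> = real n" unfolding y_def using d by (simp add: powr_powr)
    finally show ?thesis .
  qed (use d in \<open>auto simp: y_def\<close>)
  have y2: "y\<^sup>2 = real n powr (1 / real d)"
  proof (cases "n = 0")
    case False
    then have "y > 0" unfolding y_def by simp
    then have "y ^ 2 = y powr real 2" by (simp only: powr_realpow)
    also have "\<dots> = real n powr (1 / real d)" unfolding y_def using d by (simp add: powr_powr)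
    finally show ?thesis .
  qed (auto simp: y_def)
  have k: "real k \<le> y" "y \<le> real k + 1" using y0 unfolding k_def y_def[symmetric] by linarith+
  have "real (k ^ (2 * d)) \<le> real n"
    unfolding yn[symmetric] of_nat_power using k by (intro power_mono) auto
  then show "k ^ (2 * d) \<le> n" by (simp only: of_nat_le_iff)
  have "real n \<le> real ((k + 1) ^ (2 * d))"
    unfolding yn[symmetric] of_nat_power using k y0 by (intro power_mono) auto
  then show "n \<le> (k + 1) ^ (2 * d)" by (simp only: of_nat_le_iff)
  show "(real k)\<^sup>2 \<le> real n powr (1 / real d)" "real n powr (1 / real d) \<le> (real k + 1)\<^sup>2"
    unfolding y2[symmetric] using k y0 by (auto intro!: power_mono)
qed

lemma filterlim_root_index:
  fixes d :: nat
  assumes "d > 0"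
  shows "filterlim (\<lambda>n. nat \<lfloor>real n powr (1 / (2 * real d))\<rfloor>) at_top sequentially"
proof -
  have "filterlim (\<lambda>n. real n powr (1 / (2 * real d))) at_top sequentially"
    using assms by real_asymp
  then show ?thesis
    by (intro filterlim_compose[OF filterlim_nat_sequentially] filterlim_compose[OF filterlim_floor_sequentially])
qed

text \<open>Between \<open>k ^ (2 * d)\<close> and the next such number, \<open>L\<close> is at
  least its value at the lower end. The ratio \<open>((k + 1) / k) ^ 2\<close> tends to 1 and is
  absorbed by the gap between \<open>x\<close> and \<open>x'\<close>.\<close>

lemma interpolate_lower:
  fixes L :: "nat \<Rightarrow> real" and d :: nat
  assumes d: "d > 0" and L: "incseq L" "\<And>n. 0 \<le> L n"
    and ev: "\<And>x. x < c \<Longrightarrow> \<forall>\<^sub>F k in sequentially. x * (real k)\<^sup>2 \<le> L (k ^ (2 * d))" and x: "x < c"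
  shows "\<forall>\<^sub>F n in sequentially. x * real n powr (1 / real d) \<le> L n"
\<comment> \<open>A negative \<open>x\<close> would reverse the comparison of powers below, but the
  claim is then trivial because \<open>L\<close> is nonnegative.\<close>
proof (cases "x \<le> 0")
  case True
  have "x * real n powr (1 / real d) \<le> L n" for n
    using True L(2)[of n] mult_nonpos_nonneg[OF True, of "real n powr (1 / real d)"] by simp
  then show ?thesis by simp
next
  case False
  obtain x' where x': "x < x'" "x' < c" using x dense by blast
  have "(\<lambda>k. x * ((real k + 1)\<^sup>2 / (real k)\<^sup>2)) \<longlonglongrightarrow> x * 1"
    by (intro tendsto_mult tendsto_const) real_asymp
  from order_tendstoD(2)[OF this, of x'] x'
  have "\<forall>\<^sub>F k in sequentially. x * ((real k + 1)\<^sup>2 / (real k)\<^sup>2) < x'" by simp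
  then have "\<forall>\<^sub>F k in sequentially. x * (real k + 1)\<^sup>2 \<le> L (k ^ (2 * d))"
    using ev[OF x'(2)] eventually_gt_at_top[of 0]
  proof eventually_elim
    case (elim k)
    then have "x * (real k + 1)\<^sup>2 \<le> x' * (real k)\<^sup>2" by (simp add: divide_less_eq less_imp_le)
    then show ?case using elim by linarith
  qed
  from eventually_compose_filterlim[OF this filterlim_root_index[OF d]]
  show ?thesis
  proof eventually_elim
    case (elim n)
    let ?k = "nat \<lfloor>real n powr (1 / (2 * real d))\<rfloor>"
    have "x * real n powr (1 / real d) \<le> x * (real ?k + 1)\<^sup>2"
      using False root_index(4)[OF d, of n] by (intro mult_left_mono) auto
    also have "\<dots> \<le> L (?k ^ (2 * d))" by (rule elim)
    also have "\<dots> \<le> L n" using L(1) root_index(1)[OF d, of n] by (auto dest: incseqD)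
    finally show ?case .
  qed
qed

text \<open>The counterpart from the upper end of each gap; \<open>0 \<le> c\<close> makes
  \<open>x\<close> positive for the final comparison of powers.\<close>

lemma interpolate_upper:
  fixes L :: "nat \<Rightarrow> real" and d :: nat
  assumes d: "d > 0" and L: "incseq L" and c: "0 \<le> c"
    and ev: "\<And>x. c < x \<Longrightarrow> \<forall>\<^sub>F k in sequentially. L (k ^ (2 * d)) \<le> x * (real k)\<^sup>2" and x: "c < x"
  shows "\<forall>\<^sub>F n in sequentially. L n \<le> x * real n powr (1 / real d)"
proof -
  obtain x' where x': "c < x'" "x' < x" using x dense by blast
  have "(\<lambda>k. x' * ((real k + 1)\<^sup>2 / (real k)\<^sup>2)) \<longlonglongrightarrow> x' * 1"
    by (intro tendsto_mult tendsto_const) real_asymp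
  from order_tendstoD(2)[OF this, of x] x'
  have "\<forall>\<^sub>F k in sequentially. x' * ((real k + 1)\<^sup>2 / (real k)\<^sup>2) < x" by simp
  moreover have "\<forall>\<^sub>F k in sequentially. L (Suc k ^ (2 * d)) \<le> x' * (real (Suc k))\<^sup>2"
    using ev[OF x'(1)] by (subst eventually_sequentially_Suc)
  ultimately have "\<forall>\<^sub>F k in sequentially. L ((k + 1) ^ (2 * d)) \<le> x * (real k)\<^sup>2"
    using eventually_gt_at_top[of 0]
  proof eventually_elim
    case (elim k)
    then have "x' * (real k + 1)\<^sup>2 \<le> x * (real k)\<^sup>2" by (simp add: divide_less_eq less_imp_le)
    then show ?case using elim by (simp add: add.commute)
  qed
  from eventually_compose_filterlim[OF this filterlim_root_index[OF d]]
  show ?thesis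
  proof eventually_elim
    case (elim n)
    let ?k = "nat \<lfloor>real n powr (1 / (2 * real d))\<rfloor>"
    have "L n \<le> L ((?k + 1) ^ (2 * d))" using L root_index(2)[OF d, of n] by (auto dest: incseqD)
    also have "\<dots> \<le> x * (real ?k)\<^sup>2" by (rule elim)
    also have "\<dots> \<le> x * real n powr (1 / real d)"
      using x c root_index(3)[OF d, of n] by (intro mult_left_mono) auto
    finally show ?case .
  qed
qed

lemma incseq_longest_chain: "incseq (\<lambda>n. real (longest_chain (x ` {..<n} \<inter> B)))"
  by (intro incseq_SucI) (auto intro!: longest_chain_mono)

lemma unit_law_Chebyshev:
  assumes "t > 0"
  shows "iid_exp (unit_law :: (real^'d) measure) n
      (\<lambda>S. indicator {y. t \<le> \<bar>y - mean_chain TYPE('d) n\<bar>} (real (longest_chain (S \<inter> unit_box)))) \<le> mean_chain TYPE('d) n / t\<^sup>2"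
proof -
  interpret point_law "unit_law :: (real^'d) measure" by (rule point_law_unit)
  note iid_Chebyshev[OF point_functional_unit assms, of n]
  also have "(iid_exp (unit_law :: (real^'d) measure) n
      (\<lambda>S. real (longest_chain (S \<inter> unit_box)) * real (longest_chain (S \<inter> unit_box))) -
      (iid_exp unit_law n (\<lambda>S. real (longest_chain (S \<inter> (unit_box :: (real^'d) set)))))\<^sup>2) / t\<^sup>2 \<le> mean_chain TYPE('d) n / t\<^sup>2"
    unfolding mean_chain_def
    by (intro divide_right_mono longest_chain_variance point_law_unit) auto
  finally show ?thesis by (simp add: mean_chain_def)
qed

lemma powr_power_root:
  fixes d k :: nat
  assumes "d > 0"
  shows "real (k ^ (2 * d)) powr (1 / real d) = (real k)\<^sup>2"
proof (cases "k = 0")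
  case False
  then have "real (k ^ (2 * d)) = real k powr real (2 * d)" by (subst powr_realpow) auto
  then have "real (k ^ (2 * d)) powr (1 / real d) = real k powr 2" using assms by (simp add: powr_powr)
  then show ?thesis using False powr_realpow[of "real k" 2] by simp
qed (use assms in auto)

text \<open>At \<open>n = k ^ (2 * d)\<close> the variance is at most the mean, which is of order
  \<open>k ^ 2\<close>. Deviations of size \<open>\<delta> * k ^ 2\<close> therefore have
  probability of order \<open>1 / k ^ 2\<close>, which is summable.\<close>

lemma unit_points_convergence:
  fixes Y :: "nat \<Rightarrow> 'a \<Rightarrow> real^'d"
  assumes M: "prob_space M" and ind: "prob_space.indep_vars M (\<lambda>_. borel) Y UNIV"
    and law: "\<And>i. distr M borel (Y i) = unit_law"
    and lim: "(\<lambda>n. mean_chain TYPE('d) n / real n powr (1 / real CARD('d))) \<longlonglongrightarrow> c" and c: "c > 0"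
  shows "AE \<omega> in M. (\<lambda>n. real n powr (- 1 / real CARD('d)) * real (longest_chain ((\<lambda>i. Y i \<omega>) ` {..<n} \<inter> unit_box))) \<longlonglongrightarrow> c"
proof -
  interpret prob_space M by fact
  let ?d = "CARD('d)" and ?a = "mean_chain TYPE('d)"
  let ?L = "\<lambda>\<omega> n. real (longest_chain ((\<lambda>i. Y i \<omega>) ` {..<n} \<inter> unit_box))"
  note pw = powr_power_root[of "CARD('d)", OF zero_less_card_finite]
  have lim2: "(\<lambda>k. ?a (k ^ (2 * ?d)) / (real k)\<^sup>2) \<longlonglongrightarrow> c"
  proof -
    have "filterlim (\<lambda>k::nat. k ^ (2 * ?d)) at_top sequentially"
      by (intro filterlim_subseq strict_monoI power_strict_mono) auto
    from filterlim_compose[OF lim this] show ?thesis by (simp only: pw)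
  qed
  have bc: "AE \<omega> in M. \<forall>\<^sub>F k in sequentially. \<bar>?L \<omega> (k ^ (2 * ?d)) - ?a (k ^ (2 * ?d))\<bar> < \<delta> * (real k)\<^sup>2"
    if \<delta>: "\<delta> > 0" for \<delta> :: real
  proof -
    let ?A = "\<lambda>k. {\<omega> \<in> space M. ?L \<omega> (k ^ (2 * ?d)) \<in> {y. \<delta> * (real k)\<^sup>2 \<le> \<bar>y - ?a (k ^ (2 * ?d))\<bar>}}"
    have sb: "{y. \<delta> * (real k)\<^sup>2 \<le> \<bar>y - ?a (k ^ (2 * ?d))\<bar>} \<in> sets borel" for k by measurable
    have A: "?A k \<in> sets M" for k
      by (rule iid_points_prob(1)[OF M ind law point_functional_unit sb])
    have "\<forall>\<^sub>F k in sequentially. norm (prob (?A k)) \<le> ((c + 1) / \<delta>\<^sup>2) * inverse (real k ^ 2)"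
      using order_tendstoD(2)[OF lim2 less_add_one] eventually_gt_at_top[of 0]
    proof eventually_elim
      case (elim k)
      have ub: "?a (k ^ (2 * ?d)) \<le> (c + 1) * (real k)\<^sup>2"
        using elim by (simp add: divide_less_eq less_imp_le)
      have "prob (?A k) \<le> ?a (k ^ (2 * ?d)) / (\<delta> * (real k)\<^sup>2)\<^sup>2"
        unfolding iid_points_prob(2)[OF M ind law point_functional_unit sb]
        using \<delta> elim by (intro unit_law_Chebyshev) auto
      also have "\<dots> \<le> (c + 1) * (real k)\<^sup>2 / (\<delta> * (real k)\<^sup>2)\<^sup>2"
        using ub by (intro divide_right_mono) auto
      also have "\<dots> = ((c + 1) / \<delta>\<^sup>2) * inverse (real k ^ 2)"
        using elim \<delta> by (simp add: field_simps power2_eq_square)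
      finally show ?case by simp
    qed
    moreover have "summable (\<lambda>k. ((c + 1) / \<delta>\<^sup>2) * inverse (real k ^ 2))"
      by (intro summable_mult inverse_power_summable) auto
    ultimately have "summable (\<lambda>k. prob (?A k))"
      by (rule summable_comparison_test_ev)
    then have "AE \<omega> in M. \<forall>\<^sub>F k in sequentially. \<omega> \<in> space M - ?A k"
      by (intro borel_cantelli_AE1 A) (auto simp: emeasure_eq_measure)
    then show ?thesis
      by eventually_elim (auto elim!: eventually_mono)
  qed
  \<comment> \<open>Countably many thresholds, so that one null set serves all of them.\<close>
  have "AE \<omega> in M. \<forall>j. \<forall>\<^sub>F k in sequentially. \<bar>?L \<omega> (k ^ (2 * ?d)) - ?a (k ^ (2 * ?d))\<bar> < inverse (real (Suc j)) * (real k)\<^sup>2"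
    by (subst AE_all_countable) (intro allI bc, simp)
  then show ?thesis
  proof eventually_elim
    case (elim \<omega>)
    let ?S = "\<lambda>k. ?L \<omega> (k ^ (2 * ?d)) / (real k)\<^sup>2"
    have "(\<lambda>k. ?S k - ?a (k ^ (2 * ?d)) / (real k)\<^sup>2) \<longlonglongrightarrow> 0"
    proof (rule tendstoI)
      fix e :: real assume "e > 0"
      then obtain j where j: "inverse (real (Suc j)) < e" using reals_Archimedean by blast
      show "\<forall>\<^sub>F k in sequentially. dist (?S k - ?a (k ^ (2 * ?d)) / (real k)\<^sup>2) 0 < e"
        using elim[rule_format, of j] eventually_gt_at_top[of 0]
      proof eventually_elim
        case (elim k)
        have "\<bar>?S k - ?a (k ^ (2 * ?d)) / (real k)\<^sup>2\<bar> = \<bar>?L \<omega> (k ^ (2 * ?d)) - ?a (k ^ (2 * ?d))\<bar> / (real k)\<^sup>2"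
          by (simp add: diff_divide_distrib[symmetric] abs_divide)
        also have "\<dots> < inverse (real (Suc j))" using elim by (subst pos_divide_less_eq) auto
        finally show ?case using j by simp
      qed
    qed
    from tendsto_add[OF this lim2] have S: "?S \<longlonglongrightarrow> c" by simp
    have lo: "\<forall>\<^sub>F k in sequentially. x * (real k)\<^sup>2 \<le> ?L \<omega> (k ^ (2 * ?d))" if "x < c" for x
      using order_tendstoD(1)[OF S that] eventually_gt_at_top[of 0]
      by eventually_elim (simp add: less_divide_eq less_imp_le)
    have up: "\<forall>\<^sub>F k in sequentially. ?L \<omega> (k ^ (2 * ?d)) \<le> x * (real k)\<^sup>2" if "c < x" for x
      using order_tendstoD(2)[OF S that] eventually_gt_at_top[of 0]
      by eventually_elim (simp add: divide_less_eq less_imp_le)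
    have inc: "incseq (?L \<omega>)" by (rule incseq_longest_chain)
    have pm: "real n powr (- 1 / real ?d) * y = y / real n powr (1 / real ?d)" for n y
      by (simp add: powr_minus_divide)
    show ?case unfolding pm
    proof (rule order_tendstoI)
      fix y assume "y < c"
      then obtain x where x: "y < x" "x < c" using dense by blast
      have "\<forall>\<^sub>F n in sequentially. x * real n powr (1 / real ?d) \<le> ?L \<omega> n"
        by (rule interpolate_lower[OF _ inc _ lo x(2)]) auto
      then show "\<forall>\<^sub>F n in sequentially. y < ?L \<omega> n / real n powr (1 / real ?d)"
        using eventually_gt_at_top[of 0]
      proof eventually_elim
        case (elim n)
        then have "x \<le> ?L \<omega> n / real n powr (1 / real ?d)" by (subst pos_le_divide_eq) auto
        then show ?case using x by linarith
      qed
    next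
      fix y assume "c < y"
      then obtain x where x: "x < y" "c < x" using dense by blast
      have "\<forall>\<^sub>F n in sequentially. ?L \<omega> n \<le> x * real n powr (1 / real ?d)"
        by (rule interpolate_upper[OF _ inc _ up x(2)]) (use c in auto)
      then show "\<forall>\<^sub>F n in sequentially. ?L \<omega> n / real n powr (1 / real ?d) < y"
        using eventually_gt_at_top[of 0]
      proof eventually_elim
        case (elim n)
        then have "?L \<omega> n / real n powr (1 / real ?d) \<le> x" by (subst pos_divide_le_eq) auto
        then show ?case using x by linarith
      qed
    qed
  qed
qed

section \<open>Identification of the limit with the described constant\<close>

lemma unit_law_cbox: "density lborel (indicator (cbox 0 One)) = (unit_law :: (real^'d) measure)"
proof -
  have "AE x in (lborel :: (real^'d) measure). indicator (cbox 0 One) x = (indicator unit_box x :: ennreal)"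
  proof -
    have "emeasure lborel (cbox 0 (One :: real^'d) - box 0 One) = 0"
      by (subst emeasure_Diff) (auto simp: emeasure_lborel_box_eq emeasure_lborel_cbox_eq box_subset_cbox)
    then have "AE x in lborel. x \<notin> cbox 0 (One :: real^'d) - box 0 One"
      by (intro AE_not_in) (auto simp: null_sets_def)
    then show ?thesis
    proof eventually_elim
      case (elim x)
      then show ?case using box_subset_cbox[of 0 "One :: real^'d"] by (auto simp: indicator_def One_cart)
    qed
  qed
  then show ?thesis unfolding unit_law_def by (intro density_cong) auto
qed

lemma distr_of_distributed:
  assumes "distributed M lborel X f"
  shows "distr M borel X = density lborel f"
  using assms distr_cong[of M M borel lborel X X] by (simp add: distributed_def)

lemma AE_unit_box: "AE y in unit_law. y \<in> (unit_box :: (real^'d) set)"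
  unfolding unit_law_def by (subst AE_density) (auto simp: indicator_def split: if_splits)

text \<open>The canonical product space: a witness that independent sequences of the given law
  exist.\<close>

lemma indep_coordinates:
  fixes \<nu> :: "'b::topological_space measure"
  assumes "point_law \<nu>"
  defines "M \<equiv> PiM (UNIV :: nat set) (\<lambda>_. \<nu>)"
  shows "prob_space M" "prob_space.indep_vars M (\<lambda>_. borel) (\<lambda>i \<omega>. \<omega> i) UNIV"
    "\<And>i. distr M borel (\<lambda>\<omega>. \<omega> i) = \<nu>" "\<And>i. (\<lambda>\<omega>. \<omega> i) \<in> borel_measurable M"
proof -
  interpret N: point_law \<nu> by fact
  show P: "prob_space M" unfolding M_def by (rule prob_space_PiM) (rule N.prob_space_axioms)
  interpret prob_space M by fact
  show m: "(\<lambda>\<omega>. \<omega> i) \<in> borel_measurable M" for i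
  proof -
    have "(\<lambda>\<omega>. \<omega> i) \<in> M \<rightarrow>\<^sub>M \<nu>" unfolding M_def by (intro measurable_component_singleton) auto
    then show ?thesis using measurable_cong_sets[OF refl N.sets_law] by blast
  qed
  show d: "distr M borel (\<lambda>\<omega>. \<omega> i) = \<nu>" for i
  proof -
    have "distr M borel (\<lambda>\<omega>. \<omega> i) = distr M \<nu> (\<lambda>\<omega>. \<omega> i)"
      by (rule distr_cong) (auto simp: N.sets_law)
    also have "\<dots> = \<nu>" unfolding M_def by (rule distr_PiM_component) (auto simp: N.prob_space_axioms)
    finally show ?thesis .
  qed
  have s: "sets (PiM UNIV (\<lambda>_::nat. borel :: 'b measure)) = sets M"
    unfolding M_def by (intro sets_PiM_cong) (auto simp: N.sets_law)
  have "distr M (PiM UNIV (\<lambda>_. borel)) (\<lambda>\<omega>. \<lambda>i\<in>UNIV. \<omega> i) = distr M M (\<lambda>\<omega>. \<omega>)"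
    by (rule distr_cong) (auto simp: s)
  also have "\<dots> = PiM UNIV (\<lambda>i. distr M borel (\<lambda>\<omega>. \<omega> i))"
    unfolding d by (simp add: distr_id2 M_def)
  finally show "indep_vars (\<lambda>_. borel) (\<lambda>i \<omega>. \<omega> i) UNIV"
    using m by (subst indep_vars_iff_distr_eq_PiM) auto
qed

text \<open>Existence of the described constant is \<open>unit_points_convergence\<close>.
  Uniqueness uses one concrete sequence: two such constants would almost surely be limits of the
  same numbers.\<close>

lemma chain_const_growth:
  "chain_const TYPE('d::finite) > 0"
  "(\<lambda>n. mean_chain TYPE('d) n / real n powr (1 / real CARD('d))) \<longlonglongrightarrow> chain_const TYPE('d)"
proof -
  obtain c where c: "c > 0" "(\<lambda>n. mean_chain TYPE('d) n / real n powr (1 / real CARD('d))) \<longlonglongrightarrow> c"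
    using chain_growth[where 'd = 'd] by blast
  let ?lim = "\<lambda>c (Y :: nat \<Rightarrow> (nat \<Rightarrow> real^'d) \<Rightarrow> real^'d) \<omega>.
     (\<lambda>n. real n powr (- 1 / real CARD('d)) * real (longest_chain {Y i \<omega> | i. i < n})) \<longlonglongrightarrow> c"
  have conv: "AE \<omega> in M. ?lim c Y \<omega>"
    if M: "prob_space M" and ind: "prob_space.indep_vars M (\<lambda>_. borel) Y UNIV"
      and dist: "\<And>i. distributed M lborel (Y i) (\<lambda>x. indicator (cbox 0 One) x)"
    for M :: "(nat \<Rightarrow> real^'d) measure" and Y
  proof -
    interpret prob_space M by fact
    have law: "distr M borel (Y i) = unit_law" for i
      using distr_of_distributed[OF dist[of i]] by (simp add: unit_law_cbox)
    have Ym: "Y i \<in> borel_measurable M" for i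
      using distributed_measurable[OF dist[of i]] by simp
    \<comment> \<open>The description speaks of the closed cube; almost surely no point meets its
      boundary.\<close>
    have "AE \<omega> in M. Y i \<omega> \<in> unit_box" for i
      by (rule AE_distrD[OF Ym[of i]]) (unfold law, rule AE_unit_box)
    then have "AE \<omega> in M. \<forall>i. Y i \<omega> \<in> unit_box" by (simp add: AE_all_countable)
    with unit_points_convergence[OF M ind law c(2,1)] show ?thesis
    proof eventually_elim
      case (elim \<omega>)
      have "(\<lambda>i. Y i \<omega>) ` {..<n} \<inter> unit_box = {Y i \<omega> | i. i < n}" for n using elim(2) by auto
      with elim(1) show ?case by simp
    qed
  qed
  define M0 where "M0 = PiM (UNIV :: nat set) (\<lambda>_. unit_law :: (real^'d) measure)"
  note M0 = indep_coordinates[OF point_law_unit[where 'd = 'd], folded M0_def]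
  interpret M0: prob_space M0 by (rule M0(1))
  have M0d: "distributed M0 lborel (\<lambda>\<omega>. \<omega> i) (\<lambda>x. indicator (cbox 0 One) x)" for i
  proof -
    have "distr M0 lborel (\<lambda>\<omega>. \<omega> i) = distr M0 borel (\<lambda>\<omega>. \<omega> i)" by (rule distr_cong) auto
    also have "\<dots> = density lborel (indicator (cbox 0 One))" by (simp only: M0(3) unit_law_cbox)
    finally show ?thesis using M0(4)[of i] by (simp add: distributed_def)
  qed
  have "chain_const TYPE('d) = c"
    unfolding chain_const_def
  proof (rule the_equality)
    show "0 < c \<and> (\<forall>(M::(nat \<Rightarrow> real^'d) measure) Y. prob_space M \<and> prob_space.indep_vars M (\<lambda>_. borel) Y UNIV \<and>
        (\<forall>i. distributed M lborel (Y i) (\<lambda>x. indicator (cbox 0 One) x)) \<longrightarrow> (AE \<omega> in M. ?lim c Y \<omega>))"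
      using c(1) conv by blast
  next
    fix c' assume c': "0 < c' \<and> (\<forall>(M::(nat \<Rightarrow> real^'d) measure) Y. prob_space M \<and> prob_space.indep_vars M (\<lambda>_. borel) Y UNIV \<and>
        (\<forall>i. distributed M lborel (Y i) (\<lambda>x. indicator (cbox 0 One) x)) \<longrightarrow> (AE \<omega> in M. ?lim c' Y \<omega>))"
    have "AE \<omega> in M0. ?lim c' (\<lambda>i \<omega>. \<omega> i) \<omega>"
      using c' M0(1,2) M0d by blast
    with conv[OF M0(1,2) M0d] have "AE \<omega> in M0. c' = c"
      by eventually_elim (rule LIMSEQ_unique)
    then show "c' = c" by simp
  qed
  with c show "chain_const TYPE('d) > 0"
    "(\<lambda>n. mean_chain TYPE('d) n / real n powr (1 / real CARD('d))) \<longlonglongrightarrow> chain_const TYPE('d)" by auto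
qed

subsection \<open>Chains in a box\<close>

text \<open>At \<open>n = k ^ (2 * d)\<close> two things can go wrong: thinning may leave fewer than
  \<open>m k\<close> uniform points in the box, or \<open>m k\<close> such points may only have
  chains shorter than \<open>t k\<close>. Chebyshev bounds both probabilities by multiples of
  \<open>1 / k ^ 2\<close>, and Borel--Cantelli applies.\<close>

lemma box_chain_lower:
  fixes X :: "nat \<Rightarrow> 'a \<Rightarrow> real^'d" and f :: "real^'d \<Rightarrow> real"
  assumes M: "prob_space M" and ind: "prob_space.indep_vars M (\<lambda>_. borel) X UNIV"
    and law: "\<And>i. distr M borel (X i) = density lborel (\<lambda>x. ennreal (f x))"
    and f: "f \<in> borel_measurable borel" "\<And>x. 0 \<le> f x" "(\<integral>\<^sup>+ x. ennreal (f x) \<partial>lborel) = 1"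
    and ab: "\<And>i. a $ i \<le> b $ i" and \<mu>: "0 \<le> \<mu>" "\<And>x. x \<in> box a b \<Longrightarrow> \<mu> \<le> f x"
    and x: "x < chain_const TYPE('d) * (\<mu> * box_vol a b) powr (1 / real CARD('d))"
  shows "AE \<omega> in M. \<forall>\<^sub>F n in sequentially.
     x * real n powr (1 / real CARD('d)) \<le> real (longest_chain ((\<lambda>i. X i \<omega>) ` {..<n} \<inter> box a b))"
\<comment> \<open>Here \<open>x\<close> is negative; boxes with a degenerate side fall under this
  case.\<close>
proof (cases "\<mu> * box_vol a b = 0")
  case True
  then have "x * real n powr (1 / real CARD('d)) \<le> 0" for n using x by (intro mult_nonpos_nonneg) auto
  then have "x * real n powr (1 / real CARD('d)) \<le> real l" for n l by (meson of_nat_0_le_iff order_trans)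
  then show ?thesis by (intro AE_I2 always_eventually allI)
next
  case False
  interpret prob_space M by fact
  let ?d = "CARD('d)" and ?a = "mean_chain TYPE('d)" and ?c = "chain_const TYPE('d)"
  let ?\<nu> = "density lborel (\<lambda>x. ennreal (f x))"
  let ?L = "\<lambda>\<omega> n. real (longest_chain ((\<lambda>i. X i \<omega>) ` {..<n} \<inter> box a b))"
  interpret N: point_law ?\<nu> by (rule point_law_density[OF f(1,3)])
  interpret U: point_law "unit_law :: (real^'d) measure" by (rule point_law_unit)
  define p where "p = \<mu> * box_vol a b"
  have "a $ i \<noteq> b $ i" for i
    using False by (auto simp: box_vol_def) (metis)
  then have ab': "a $ i < b $ i" for i using ab[of i] by (simp add: less_le)
  have p: "p > 0" using False \<mu>(1) box_vol_pos[OF ab'] by (auto simp: p_def less_le)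
  note c = chain_const_growth[where 'd = 'd]
  \<comment> \<open>The slack is split: \<open>e\<close> pays for fewer points and shorter chains,
    the gap from \<open>x\<close> to \<open>x'\<close> for the interpolation between the numbers
    \<open>k ^ (2 * d)\<close>.\<close>
  obtain x' where x': "x < x'" "x' < ?c * p powr (1 / real ?d)" using x dense unfolding p_def by blast
  have "((\<lambda>e. (1 - e) * (?c * ((1 - e) * p) powr (1 / real ?d))) \<longlongrightarrow> (1 - 0) * (?c * ((1 - 0) * p) powr (1 / real ?d))) (at_right 0)"
    using p by (intro tendsto_intros) auto
  from order_tendstoD(1)[OF this, of x'] x'(2)
  have "\<forall>\<^sub>F e in at_right 0. x' < (1 - e) * (?c * ((1 - e) * p) powr (1 / real ?d))" by simp
  moreover have "\<forall>\<^sub>F e in at_right (0::real). e \<in> {0<..<1}" by (rule eventually_at_right_real) simp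
  ultimately have "\<forall>\<^sub>F e in at_right 0. x' < (1 - e) * (?c * ((1 - e) * p) powr (1 / real ?d)) \<and> e \<in> {0<..<1}"
    by (rule eventually_conj)
  then obtain e where e: "x' < (1 - e) * (?c * ((1 - e) * p) powr (1 / real ?d))" "0 < e" "e < 1"
    using eventually_happens'[OF trivial_limit_at_right_real] by (metis (no_types, lifting) greaterThanLessThan_iff)
  define q where "q = (1 - e) * p"
  have q: "q > 0" "q < p" using p e by (auto simp: q_def)
  define \<kappa> where "\<kappa> = ?c * q powr (1 / real ?d)"
  have "\<kappa> > 0" unfolding \<kappa>_def using c(1) q(1) by simp
  then have \<kappa>: "\<kappa> > 0" "x' < (1 - e) * \<kappa>" using e(1) by (auto simp: \<kappa>_def q_def)
  \<comment> \<open>A fixed proportion fewer than the mean number \<open>p * n\<close> of thinned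
    points at \<open>n = k ^ (2 * d)\<close>, which makes the binomial lower tail small.\<close>
  define m where "m k = nat \<lfloor>q * real (k ^ (2 * ?d))\<rfloor>" for k
  have top: "filterlim (\<lambda>k::nat. k ^ (2 * ?d)) at_top sequentially"
    by (intro filterlim_subseq strict_monoI power_strict_mono) auto
  have topr: "filterlim (\<lambda>k::nat. real (k ^ (2 * ?d))) at_top sequentially"
    by (rule filterlim_compose[OF filterlim_real_sequentially top])
  have "((\<lambda>y. real (nat \<lfloor>q * y\<rfloor>) / y) \<longlongrightarrow> q) at_top" using q by real_asymp
  from filterlim_compose[OF this topr] have mq: "(\<lambda>k. real (m k) / real (k ^ (2 * ?d))) \<longlonglongrightarrow> q"
    by (simp only: m_def)
  have "filterlim (\<lambda>y. nat \<lfloor>q * y\<rfloor>) at_top at_top" using q by real_asymp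
  from filterlim_compose[OF this topr] have mtop: "filterlim m at_top sequentially"
    by (simp only: m_def[abs_def])
  have "(\<lambda>k. ?a (m k) / real (m k) powr (1 / real ?d) * (real (m k) / real (k ^ (2 * ?d))) powr (1 / real ?d)) \<longlonglongrightarrow> ?c * q powr (1 / real ?d)"
    using q by (intro tendsto_mult filterlim_compose[OF c(2) mtop] tendsto_powr mq tendsto_const) auto
  moreover have "\<forall>\<^sub>F k in sequentially. ?a (m k) / real (m k) powr (1 / real ?d) * (real (m k) / real (k ^ (2 * ?d))) powr (1 / real ?d)
      = ?a (m k) / (real k)\<^sup>2"
    using eventually_compose_filterlim[OF eventually_gt_at_top[of 0] mtop]
  proof eventually_elim
    case (elim k)
    then show ?case
      unfolding powr_power_root[of ?d k, OF zero_less_card_finite, symmetric]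
      by (subst powr_divide) auto
  qed
  ultimately have lim: "(\<lambda>k. ?a (m k) / (real k)\<^sup>2) \<longlonglongrightarrow> \<kappa>"
    unfolding \<kappa>_def by (rule Lim_transform_eventually)
  define t where "t k = (1 - e) * ?a (m k)" for k
  have limt: "(\<lambda>k. t k / (real k)\<^sup>2) \<longlonglongrightarrow> (1 - e) * \<kappa>"
    using tendsto_mult[OF tendsto_const[of "1 - e"] lim] by (simp add: t_def)
  define n where "n k = k ^ (2 * ?d)" for k :: nat
  let ?F = "\<lambda>S. real (longest_chain (S \<inter> box a b))"
  let ?G = "\<lambda>S. real (longest_chain (S \<inter> (unit_box :: (real^'d) set)))"
  let ?A = "\<lambda>k. {\<omega> \<in> space M. ?L \<omega> (n k) \<in> {..<t k}}"
  have pf: "point_functional ?F" by (rule point_functional_longest_chain) simp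
  have A: "?A k \<in> sets M" for k
    by (rule iid_points_prob(1)[OF M ind law pf]) simp
  \<comment> \<open>The first term belongs to the chain length and uses
    \<open>?a (m k) \<ge> \<kappa> / 2 * k ^ 2\<close>; the second belongs to the number of points
    and uses \<open>n k \<ge> k ^ 2\<close>.\<close>
  let ?K = "2 / (e\<^sup>2 * \<kappa>) + 1 / (e\<^sup>2 * p)"
  have "\<kappa> / 2 < \<kappa>" using \<kappa>(1) by simp
  from order_tendstoD(1)[OF lim this]
  have "\<forall>\<^sub>F k in sequentially. norm (prob (?A k)) \<le> ?K * inverse (real k ^ 2)"
    using eventually_gt_at_top[of 0]
  proof eventually_elim
    case (elim k)
    have k: "real k \<ge> 1" using elim by simp
    have am: "?a (m k) \<ge> \<kappa> / 2 * (real k)\<^sup>2" "?a (m k) > 0"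
    proof -
      show "?a (m k) \<ge> \<kappa> / 2 * (real k)\<^sup>2" using elim \<kappa> by (simp add: less_divide_eq less_imp_le)
      moreover have "\<kappa> / 2 * (real k)\<^sup>2 > 0" using \<kappa> k by simp
      ultimately show "?a (m k) > 0" by linarith
    qed
    have nk: "real (n k) \<ge> (real k)\<^sup>2"
    proof -
      have "real k ^ 2 \<le> real k ^ (2 * ?d)" using k by (intro power_increasing) auto
      then show ?thesis by (simp add: n_def)
    qed
    have n0: "real (n k) > 0" using nk k by (smt (verit) one_le_power)
    have mk: "real (m k) \<le> (1 - e) * (real (n k) * p)"
    proof -
      have "0 \<le> q * real (n k)" using q by simp
      then have "real (m k) \<le> q * real (n k)" unfolding m_def n_def[symmetric] by linarith
      then show ?thesis by (simp add: q_def mult_ac)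
    qed
    have mlt: "e * (real (n k) * p) \<le> real (n k) * p - real (m k)" using mk by (simp add: algebra_simps)
    have enp: "0 < e * (real (n k) * p)" using e n0 p by simp
    have lt: "0 < real (n k) * p - real (m k)" using mlt enp by linarith
    define \<alpha> where "\<alpha> = real (n k) * p / (real (n k) * p - real (m k))\<^sup>2"
    have "\<alpha> \<le> real (n k) * p / (e * (real (n k) * p))\<^sup>2"
      unfolding \<alpha>_def using mlt lt n0 p e(2) by (intro divide_left_mono power_mono mult_pos_pos zero_less_power) auto
    also have "\<dots> = 1 / (e\<^sup>2 * p) * inverse (real (n k))" using n0 p e by (simp add: field_simps power2_eq_square)
    also have "\<dots> \<le> 1 / (e\<^sup>2 * p) * inverse ((real k)\<^sup>2)"
      using nk k p e by (intro mult_left_mono le_imp_inverse_le) auto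
    finally have \<alpha>: "\<alpha> \<le> 1 / (e\<^sup>2 * p) * inverse ((real k)\<^sup>2)" .
    have \<alpha>0: "\<alpha> \<ge> 0" unfolding \<alpha>_def using p by simp
    let ?I = "\<lambda>S. indicator {t k..} (?G S) :: real" and ?H = "\<lambda>S. indicator {y. e * ?a (m k) \<le> \<bar>y - ?a (m k)\<bar>} (?G S) :: real"
    have pI: "point_functional ?I" by (intro point_functional_indicator point_functional_unit) auto
    have sb: "{y. e * ?a (m k) \<le> \<bar>y - ?a (m k)\<bar>} \<in> sets borel" by measurable
    have pH: "point_functional ?H" by (rule point_functional_indicator[OF point_functional_unit sb])
    define E where "E = iid_exp unit_law (m k) ?I"
    have E1: "0 \<le> E" "E \<le> 1"
      using U.iid_exp_mono[OF point_functional_const[of 0] pI, of "m k"] U.iid_exp_mono[OF pI point_functional_const[of 1], of "m k"]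
      by (auto simp: E_def indicator_def)
    \<comment> \<open>A chain shorter than \<open>t k = (1 - e) * ?a (m k)\<close> deviates from the
      mean by at least \<open>e * ?a (m k)\<close>, so one of the two indicators is always
      1.\<close>
    have "iid_exp (unit_law :: (real^'d) measure) (m k) (\<lambda>_. 1) \<le> iid_exp unit_law (m k) (\<lambda>S. ?I S + ?H S)"
    proof (rule U.iid_exp_mono[OF point_functional_const point_functional_add[OF pI pH]])
      show "1 \<le> ?I S + ?H S" for S
      proof (cases "t k \<le> ?G S")
        case False
        then have "e * ?a (m k) \<le> \<bar>?G S - ?a (m k)\<bar>" unfolding t_def by (simp add: algebra_simps)
        then show ?thesis by (simp add: indicator_def)
      qed (simp add: indicator_def)
    qed
    then have "1 \<le> iid_exp unit_law (m k) (\<lambda>S. ?I S + ?H S)" by (simp only: U.iid_exp_const)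
    also have "\<dots> = E + iid_exp unit_law (m k) ?H" unfolding E_def by (rule U.iid_exp_add[OF pI pH])
    also have "iid_exp unit_law (m k) ?H \<le> ?a (m k) / (e * ?a (m k))\<^sup>2"
      using e am by (intro unit_law_Chebyshev) auto
    also have "?a (m k) / (e * ?a (m k))\<^sup>2 = 1 / e\<^sup>2 * inverse (?a (m k))" using am(2) by (simp add: field_simps power2_eq_square)
    also have "\<dots> \<le> 1 / e\<^sup>2 * inverse (\<kappa> / 2 * (real k)\<^sup>2)"
      using am \<kappa> k by (intro mult_left_mono le_imp_inverse_le) auto
    finally have E: "1 - E \<le> 2 / (e\<^sup>2 * \<kappa>) * inverse ((real k)\<^sup>2)" by (simp add: field_simps)
    have "(1 - \<alpha>) * E \<le> iid_exp ?\<nu> (n k) (\<lambda>S. indicator {t k..} (?F S))"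
      unfolding \<alpha>_def p_def E_def
    proof (rule longest_chain_thinning[OF ab' f \<mu>])
      show "real (m k) < real (n k) * (\<mu> * box_vol a b)" using mlt enp unfolding p_def by linarith
    qed auto
    also have "\<dots> = 1 - prob (?A k)"
    proof -
      have "prob (?A k) = iid_exp ?\<nu> (n k) (\<lambda>S. indicator {..<t k} (?F S))"
        by (rule iid_points_prob(2)[OF M ind law pf]) simp
      also have "\<dots> = iid_exp ?\<nu> (n k) (\<lambda>S. 1 - indicator {t k..} (?F S))"
        by (rule N.iid_exp_cong) (auto simp: indicator_def)
      also have "\<dots> = 1 - iid_exp ?\<nu> (n k) (\<lambda>S. indicator {t k..} (?F S))"
        by (subst N.iid_exp_diff[OF point_functional_const point_functional_indicator[OF pf]]) auto
      finally show ?thesis by simp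
    qed
    finally have "prob (?A k) \<le> 1 - (1 - \<alpha>) * E" by simp
    also have "\<dots> \<le> (1 - E) + \<alpha>" using mult_left_le[of E \<alpha>] \<alpha>0 E1 by (simp add: algebra_simps)
    also have "\<dots> \<le> ?K * inverse (real k ^ 2)" using E \<alpha> by (simp add: distrib_right)
    finally show ?case by simp
  qed
  moreover have "summable (\<lambda>k. ?K * inverse (real k ^ 2))"
    by (intro summable_mult inverse_power_summable) auto
  ultimately have "summable (\<lambda>k. prob (?A k))"
    by (rule summable_comparison_test_ev)
  then have "AE \<omega> in M. \<forall>\<^sub>F k in sequentially. \<omega> \<in> space M - ?A k"
    by (intro borel_cantelli_AE1 A) (auto simp: emeasure_eq_measure)
  then show ?thesis
  proof eventually_elim
    case (elim \<omega>)
    have "\<forall>\<^sub>F k in sequentially. x' * (real k)\<^sup>2 \<le> ?L \<omega> (k ^ (2 * ?d))"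
      using elim order_tendstoD(1)[OF limt \<kappa>(2)] eventually_gt_at_top[of 0]
    proof eventually_elim
      case (elim k)
      then have "x' * (real k)\<^sup>2 \<le> t k" by (simp add: less_divide_eq less_imp_le)
      also have "t k \<le> ?L \<omega> (n k)" using elim by auto
      finally show ?case by (simp add: n_def)
    qed
    then have ev: "\<forall>\<^sub>F k in sequentially. y * (real k)\<^sup>2 \<le> ?L \<omega> (k ^ (2 * ?d))" if "y < x'" for y
    proof eventually_elim
      case (elim k)
      have "y * (real k)\<^sup>2 \<le> x' * (real k)\<^sup>2" using that by (intro mult_right_mono) auto
      then show ?case using elim by linarith
    qed
    show ?case
      by (rule interpolate_lower[OF _ incseq_longest_chain _ ev x'(1)]) auto
  qed
qed

subsection \<open>Chains along a curve\<close>

text \<open>Summed over \<open>j < N\<close>, these are lower sums for the curve functional.\<close>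

definition curve_cell :: "(real^'d \<Rightarrow> real) \<Rightarrow> (real \<Rightarrow> real^'d) \<Rightarrow> nat \<Rightarrow> nat \<Rightarrow> real" where
  "curve_cell f \<gamma> N j =
     (Inf (f ` cbox (\<gamma> (real j / real N)) (\<gamma> ((real j + 1) / real N))) *
       box_vol (\<gamma> (real j / real N)) (\<gamma> ((real j + 1) / real N))) powr (1 / real CARD('d))"

text \<open>Lower semicontinuity makes the infima of \<open>f\<close> over shrinking cells converge
  to the value of \<open>f\<close> on the curve. It is compatible with \<open>f\<close> dropping to
  0 at the boundary of an open set.\<close>

locale monotone_curve =
  fixes f :: "real^'d \<Rightarrow> real" and \<gamma> \<gamma>' :: "real \<Rightarrow> real^'d"
  assumes f_nonneg: "\<And>x. 0 \<le> f x"
    and f_lsc: "\<And>p e. e > 0 \<Longrightarrow> \<exists>\<rho>>0. \<forall>y. dist y p < \<rho> \<longrightarrow> f p - e < f y"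
    and cont: "continuous_on {0..1} \<gamma>'"
    and deriv: "\<And>t. t \<in> {0..1} \<Longrightarrow> (\<gamma> has_vector_derivative \<gamma>' t) (at t within {0..1})"
    and incr: "\<And>t i. t \<in> {0..1} \<Longrightarrow> 0 \<le> \<gamma>' t $ i"
begin

text \<open>Coordinatewise, as each coordinate has its own intermediate point.\<close>

lemma component_mvt:
  assumes "0 \<le> s" "s \<le> t" "t \<le> 1"
  shows "\<exists>\<xi>\<in>{s..t}. \<gamma> t $ i - \<gamma> s $ i = \<gamma>' \<xi> $ i * (t - s)"
proof -
  have "((\<lambda>x. \<gamma> x $ i) has_derivative (\<lambda>h. h * \<gamma>' x $ i)) (at x within {s..t})" if "x \<in> {s..t}" for x
  proof -
    have "(\<gamma> has_vector_derivative \<gamma>' x) (at x within {s..t})"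
      using that assms by (intro has_vector_derivative_within_subset[OF deriv]) auto
    then have "((\<lambda>x. \<gamma> x $ i) has_derivative (\<lambda>h. (h *\<^sub>R \<gamma>' x) $ i)) (at x within {s..t})"
      unfolding has_vector_derivative_def by (rule bounded_linear.has_derivative[OF bounded_linear_vec_nth])
    then show ?thesis by simp
  qed
  from mvt_very_simple[OF assms(2) this]
  show ?thesis by (auto simp: mult.commute)
qed

lemma component_mono:
  assumes "0 \<le> s" "s \<le> t" "t \<le> 1"
  shows "\<gamma> s $ i \<le> \<gamma> t $ i"
proof -
  obtain \<xi> where "\<xi> \<in> {s..t}" "\<gamma> t $ i - \<gamma> s $ i = \<gamma>' \<xi> $ i * (t - s)"
    using component_mvt[OF assms] by blast
  moreover have "0 \<le> \<gamma>' \<xi> $ i * (t - s)" using incr calculation assms by (intro mult_nonneg_nonneg) auto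
  ultimately show ?thesis by simp
qed

lemma curve_cell_nonneg: "0 \<le> curve_cell f \<gamma> N j"
  by (simp add: curve_cell_def)

lemma f_bdd_below: "bdd_below (f ` A)"
  using f_nonneg by (auto intro!: bdd_belowI[of _ 0])

lemma cell_times: "0 \<le> real j / real N" "real j / real N \<le> (real j + 1) / real N"
  by (auto intro: divide_right_mono)

lemma cell_le_1: "j < N \<Longrightarrow> (real j + 1) / real N \<le> 1"
  by (auto simp: divide_le_eq)

lemma cell_mem_cbox:
  assumes "j < N" "real j / real N \<le> t" "t \<le> (real j + 1) / real N"
  shows "\<gamma> t \<in> cbox (\<gamma> (real j / real N)) (\<gamma> ((real j + 1) / real N))"
proof -
  have t: "0 \<le> t" "t \<le> 1"
    using assms(2,3) cell_times(1)[of j N] cell_le_1[OF assms(1)] by linarith+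
  show ?thesis
    unfolding mem_box_cart
    using component_mono[OF cell_times(1) assms(2) t(2)] component_mono[OF t(1) assms(3) cell_le_1[OF assms(1)]]
    by blast
qed

lemma cell_inf:
  assumes "j < N"
  defines "A \<equiv> cbox (\<gamma> (real j / real N)) (\<gamma> ((real j + 1) / real N))"
  shows "0 \<le> Inf (f ` A)" "\<And>y. y \<in> A \<Longrightarrow> Inf (f ` A) \<le> f y"
proof -
  have "A \<noteq> {}" using cell_mem_cbox[OF assms(1), of "real j / real N"] cell_times[of j N] by (auto simp: A_def)
  then show "0 \<le> Inf (f ` A)" using f_nonneg by (intro cInf_greatest) auto
  show "Inf (f ` A) \<le> f y" if "y \<in> A" for y using that by (intro cInf_lower f_bdd_below) auto
qed

lemma cell_vol_nonneg:
  "j < N \<Longrightarrow> 0 \<le> box_vol (\<gamma> (real j / real N)) (\<gamma> ((real j + 1) / real N))"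
  unfolding box_vol_def using cell_times[of j N] cell_le_1[of j N]
  by (intro prod_nonneg) (auto intro!: component_mono)

text \<open>Taken inside the root, the factor \<open>real N\<close> turns the side lengths of the
  cell into difference quotients, which converge by the mean value theorem and the continuity of
  \<open>\<gamma>'\<close>.\<close>

lemma cell_limit:
  assumes t: "0 \<le> t" "t < 1"
  defines "j \<equiv> \<lambda>N. nat \<lfloor>t * real N\<rfloor>"
  shows "(\<lambda>N. real N * curve_cell f \<gamma> N (j N)) \<longlonglongrightarrow>
     f (\<gamma> t) powr (1 / real CARD('d)) * (\<Prod>i\<in>UNIV. \<gamma>' t $ i) powr (1 / real CARD('d))"
proof -
  let ?s = "\<lambda>N. real (j N) / real N" and ?u = "\<lambda>N. (real (j N) + 1) / real N"
  let ?B = "\<lambda>N. cbox (\<gamma> (?s N)) (\<gamma> (?u N))"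
  have jN: "?s N \<le> t" "t \<le> ?u N" "j N < N" if "N \<ge> 1" for N
  proof -
    have "0 \<le> t * real N" using t by simp
    then have "real (j N) \<le> t * real N" "t * real N \<le> real (j N) + 1" unfolding j_def by linarith+
    moreover have "t * real N < real N" using t that by simp
    ultimately have "real (j N) < real N" by linarith
    then show "j N < N" by simp
    show "?s N \<le> t" "t \<le> ?u N"
      using that \<open>real (j N) \<le> t * real N\<close> \<open>t * real N \<le> real (j N) + 1\<close>
      by (auto simp: divide_le_eq le_divide_eq)
  qed
  have D: "(\<lambda>N. real N * (\<gamma> (?u N) $ i - \<gamma> (?s N) $ i)) \<longlonglongrightarrow> \<gamma>' t $ i" for i
  proof (rule tendstoI)
    fix e :: real assume e: "e > 0"
    have "continuous_on {0..1} (\<lambda>s. \<gamma>' s $ i)" using cont by (intro continuous_intros)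
    then obtain \<delta> where \<delta>: "\<delta> > 0" "\<And>s. s \<in> {0..1} \<Longrightarrow> dist s t < \<delta> \<Longrightarrow> dist (\<gamma>' s $ i) (\<gamma>' t $ i) < e"
      using e t unfolding continuous_on_iff by (metis atLeastAtMost_iff less_imp_le)
    obtain N0 where N0: "inverse (real (Suc N0)) < \<delta>" using reals_Archimedean \<delta>(1) by blast
    show "\<forall>\<^sub>F N in sequentially. dist (real N * (\<gamma> (?u N) $ i - \<gamma> (?s N) $ i)) (\<gamma>' t $ i) < e"
      using eventually_ge_at_top[of "Suc N0"]
    proof eventually_elim
      case (elim N)
      then have N: "N \<ge> 1" by simp
      obtain \<xi> where \<xi>: "\<xi> \<in> {?s N..?u N}" "\<gamma> (?u N) $ i - \<gamma> (?s N) $ i = \<gamma>' \<xi> $ i * (?u N - ?s N)"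
        using component_mvt[OF cell_times cell_le_1[OF jN(3)[OF N]]] by blast
      have len: "?u N - ?s N = 1 / real N" by (simp add: diff_divide_distrib[symmetric])
      have "real N * (\<gamma> (?u N) $ i - \<gamma> (?s N) $ i) = \<gamma>' \<xi> $ i" unfolding \<xi>(2) len using N by simp
      moreover have "\<xi> \<in> {0..1}"
      proof -
        have "?s N \<le> \<xi>" "\<xi> \<le> ?u N" using \<xi>(1) by auto
        then have "0 \<le> \<xi>" "\<xi> \<le> 1"
          using cell_times(1)[of "j N" N] cell_le_1[OF jN(3)[OF N]] by linarith+
        then show ?thesis by simp
      qed
      moreover have "dist \<xi> t < \<delta>"
      proof -
        have "\<bar>\<xi> - t\<bar> \<le> ?u N - ?s N" using \<xi>(1) jN(1,2)[OF N] by auto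
        also have "\<dots> = inverse (real N)" unfolding len by (simp add: inverse_eq_divide)
        also have "\<dots> \<le> inverse (real (Suc N0))" using elim by (intro le_imp_inverse_le) auto
        finally show ?thesis using N0 by (simp add: dist_real_def)
      qed
      ultimately show ?case using \<delta>(2) by simp
    qed
  qed
  have small: "(\<lambda>N. \<Sum>i\<in>UNIV. \<gamma> (?u N) $ i - \<gamma> (?s N) $ i) \<longlonglongrightarrow> 0"
  proof -
    have "(\<lambda>N. \<Sum>i\<in>UNIV. inverse (real N) * (real N * (\<gamma> (?u N) $ i - \<gamma> (?s N) $ i))) \<longlonglongrightarrow> (\<Sum>i\<in>UNIV. 0 * \<gamma>' t $ i)"
      by (intro tendsto_sum tendsto_mult D lim_inverse_n)
    moreover have "\<forall>\<^sub>F N in sequentially. (\<Sum>i\<in>UNIV. inverse (real N) * (real N * (\<gamma> (?u N) $ i - \<gamma> (?s N) $ i)))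
        = (\<Sum>i\<in>UNIV. \<gamma> (?u N) $ i - \<gamma> (?s N) $ i)"
      using eventually_gt_at_top[of 0] by eventually_elim (simp add: mult.assoc[symmetric])
    ultimately show ?thesis using Lim_transform_eventually by fastforce
  qed
  \<comment> \<open>The upper bound holds because \<open>\<gamma> t\<close> lies in the cell, the
    lower one by semicontinuity, since the cell shrinks to \<open>\<gamma> t\<close>.\<close>
  have I: "(\<lambda>N. Inf (f ` ?B N)) \<longlonglongrightarrow> f (\<gamma> t)"
  proof (rule tendstoI)
    fix e :: real assume e: "e > 0"
    then have "e / 2 > 0" by simp
    from f_lsc[OF this, of "\<gamma> t"]
    obtain \<rho> where \<rho>: "\<rho> > 0" "\<And>y. dist y (\<gamma> t) < \<rho> \<Longrightarrow> f (\<gamma> t) - e / 2 < f y" by blast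
    show "\<forall>\<^sub>F N in sequentially. dist (Inf (f ` ?B N)) (f (\<gamma> t)) < e"
      using order_tendstoD(2)[OF small \<rho>(1)] eventually_ge_at_top[of 1]
    proof eventually_elim
      case (elim N)
      have t: "\<gamma> t \<in> ?B N" using cell_mem_cbox[OF jN(3) jN(1,2)] elim by blast
      have "f (\<gamma> t) - e / 2 \<le> f y" if y: "y \<in> ?B N" for y
      proof -
        have "dist y (\<gamma> t) \<le> (\<Sum>i\<in>UNIV. \<bar>(y - \<gamma> t) $ i\<bar>)" unfolding dist_norm by (rule norm_le_l1_cart)
        also have "\<dots> \<le> (\<Sum>i\<in>UNIV. \<gamma> (?u N) $ i - \<gamma> (?s N) $ i)"
        proof (intro sum_mono)
          fix i
          have "\<gamma> (?s N) $ i \<le> y $ i" "y $ i \<le> \<gamma> (?u N) $ i" "\<gamma> (?s N) $ i \<le> \<gamma> t $ i" "\<gamma> t $ i \<le> \<gamma> (?u N) $ i"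
            using y t by (auto simp: mem_box_cart)
          then show "\<bar>(y - \<gamma> t) $ i\<bar> \<le> \<gamma> (?u N) $ i - \<gamma> (?s N) $ i" by simp
        qed
        also have "\<dots> < \<rho>" using elim by simp
        finally show ?thesis using \<rho>(2)[of y] by simp
      qed
      then have "f (\<gamma> t) - e / 2 \<le> Inf (f ` ?B N)" using t by (intro cInf_greatest) auto
      moreover have "Inf (f ` ?B N) \<le> f (\<gamma> t)" using t by (intro cInf_lower f_bdd_below) auto
      ultimately show ?case using e by (simp add: dist_real_def)
    qed
  qed
  \<comment> \<open>The limits may be 0, where continuity of \<open>powr\<close> asks for bases that
    are eventually nonnegative.\<close>
  have ev0: "\<forall>\<^sub>F N in sequentially. 0 \<le> Inf (f ` ?B N)"
    using eventually_ge_at_top[of 1] by eventually_elim (use cell_inf(1) jN in auto)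
  have ev1: "\<forall>\<^sub>F N in sequentially. 0 \<le> (\<Prod>i\<in>UNIV. real N * (\<gamma> (?u N) $ i - \<gamma> (?s N) $ i))"
    using eventually_ge_at_top[of 1]
  proof eventually_elim
    case (elim N)
    show ?case using cell_times[of "j N" N] cell_le_1[OF jN(3)[OF elim]]
      by (intro prod_nonneg) (auto intro!: mult_nonneg_nonneg component_mono)
  qed
  have "(\<lambda>N. Inf (f ` ?B N) powr (1 / real CARD('d)) * (\<Prod>i\<in>UNIV. real N * (\<gamma> (?u N) $ i - \<gamma> (?s N) $ i)) powr (1 / real CARD('d)))
     \<longlonglongrightarrow> f (\<gamma> t) powr (1 / real CARD('d)) * (\<Prod>i\<in>UNIV. \<gamma>' t $ i) powr (1 / real CARD('d))"
    by (intro tendsto_mult tendsto_powr' I tendsto_prod D tendsto_const disjI2 conjI ev0 ev1) auto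
  moreover have "\<forall>\<^sub>F N in sequentially. Inf (f ` ?B N) powr (1 / real CARD('d)) * (\<Prod>i\<in>UNIV. real N * (\<gamma> (?u N) $ i - \<gamma> (?s N) $ i)) powr (1 / real CARD('d))
      = real N * curve_cell f \<gamma> N (j N)"
    using eventually_ge_at_top[of 1]
  proof eventually_elim
    case (elim N)
    let ?v = "box_vol (\<gamma> (?s N)) (\<gamma> (?u N))"
    have v: "?v \<ge> 0" using cell_vol_nonneg[OF jN(3)[OF elim]] .
    have "(\<Prod>i\<in>UNIV. real N * (\<gamma> (?u N) $ i - \<gamma> (?s N) $ i)) = real N ^ CARD('d) * ?v"
      by (simp add: prod.distrib box_vol_def)
    moreover have "(real N ^ CARD('d)) powr (1 / real CARD('d)) = real N"
      using elim powr_realpow[of "real N" "CARD('d)"] by (simp add: powr_powr flip: powr_realpow)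
    ultimately have "(\<Prod>i\<in>UNIV. real N * (\<gamma> (?u N) $ i - \<gamma> (?s N) $ i)) powr (1 / real CARD('d)) = real N * ?v powr (1 / real CARD('d))"
      using v by (simp add: powr_mult)
    then show ?case
      unfolding curve_cell_def using v cell_inf(1)[OF jN(3)[OF elim]] by (simp add: powr_mult)
  qed
  ultimately show ?thesis by (rule Lim_transform_eventually)
qed

text \<open>Puts the lower sums into the form in which Fatou's lemma applies: integrals of step
  functions.\<close>

lemma cell_sum_integral:
  assumes N: "N \<ge> 1"
  shows "(\<integral>\<^sup>+ t. indicator {0..<1} t * ennreal (real N * curve_cell f \<gamma> N (nat \<lfloor>t * real N\<rfloor>)) \<partial>lborel)
     = ennreal (\<Sum>j<N. curve_cell f \<gamma> N j)"
proof -
  let ?w = "curve_cell f \<gamma> N"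
  let ?I = "\<lambda>j. {real j / real N..<(real j + 1) / real N}"
  have "indicator {0..<1} t * ennreal (real N * ?w (nat \<lfloor>t * real N\<rfloor>))
      = (\<Sum>j<N. ennreal (real N * ?w j) * indicator (?I j) t)" for t
  proof -
    have mem: "t \<in> ?I j \<longleftrightarrow> 0 \<le> t \<and> j = nat \<lfloor>t * real N\<rfloor>" for j
    proof -
      have "t \<in> ?I j \<longleftrightarrow> real j \<le> t * real N \<and> t * real N < real j + 1"
        using N by (auto simp: divide_le_eq less_divide_eq)
      also have "\<dots> \<longleftrightarrow> \<lfloor>t * real N\<rfloor> = int j" by (simp add: floor_eq_iff)
      also have "\<dots> \<longleftrightarrow> 0 \<le> t \<and> j = nat \<lfloor>t * real N\<rfloor>"
        using N by (auto simp: zero_le_mult_iff) (metis le_floor_iff of_int_0 of_nat_0_le_iff zero_le_mult_iff of_nat_0_less_iff less_eq_Suc_le One_nat_def not_le)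
      finally show ?thesis .
    qed
    have ind: "indicator (?I j) t = (of_bool (0 \<le> t \<and> j = nat \<lfloor>t * real N\<rfloor>) :: ennreal)" for j
      by (simp only: indicator_def mem)
    have lt: "nat \<lfloor>t * real N\<rfloor> < N \<longleftrightarrow> t < 1" if "0 \<le> t"
    proof -
      have "nat \<lfloor>t * real N\<rfloor> < N \<longleftrightarrow> \<lfloor>t * real N\<rfloor> < int N" using that by (simp add: nat_less_iff)
      also have "\<dots> \<longleftrightarrow> t * real N < real N" by (simp add: floor_less_iff)
      also have "\<dots> \<longleftrightarrow> t < 1" using N by simp
      finally show ?thesis .
    qed
    have "(\<Sum>j<N. ennreal (real N * ?w j) * indicator (?I j) t)
       = (\<Sum>j<N. if j = nat \<lfloor>t * real N\<rfloor> then (if 0 \<le> t then ennreal (real N * ?w j) else 0) else 0)"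
      by (intro sum.cong refl) (simp only: ind, auto)
    also have "\<dots> = indicator {0..<1} t * ennreal (real N * ?w (nat \<lfloor>t * real N\<rfloor>))"
      using lt by (simp add: sum.delta indicator_def)
    finally show ?thesis by simp
  qed
  then have "(\<integral>\<^sup>+ t. indicator {0..<1} t * ennreal (real N * ?w (nat \<lfloor>t * real N\<rfloor>)) \<partial>lborel)
     = (\<integral>\<^sup>+ t. (\<Sum>j<N. ennreal (real N * ?w j) * indicator (?I j) t) \<partial>lborel)" by simp
  also have "\<dots> = (\<Sum>j<N. ennreal (real N * ?w j) * emeasure lborel (?I j))"
    by (subst nn_integral_sum) (auto simp: nn_integral_cmult_indicator)
  also have "\<dots> = (\<Sum>j<N. ennreal (?w j))"
  proof (intro sum.cong refl)
    fix j
    have "emeasure lborel (?I j) = ennreal (1 / real N)"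
      using cell_times(2)[of j N] by (simp add: diff_divide_distrib[symmetric])
    then show "ennreal (real N * ?w j) * emeasure lborel (?I j) = ennreal (?w j)"
      using N curve_cell_nonneg[of N j] by (simp add: ennreal_mult'[symmetric])
  qed
  also have "\<dots> = ennreal (\<Sum>j<N. ?w j)" using curve_cell_nonneg by (intro sum_ennreal) auto
  finally show ?thesis .
qed

lemma curve_value_le_liminf:
  "ennreal (curve_value f \<gamma>) \<le> liminf (\<lambda>N. ennreal (\<Sum>j<N. curve_cell f \<gamma> N j))"
proof -
  define g where "g t = f (\<gamma> t) powr (1 / real CARD('d)) *
      (\<Prod>i\<in>UNIV. vector_derivative \<gamma> (at t within {0..1}) $ i) powr (1 / real CARD('d))" for t
  define s where "s N t = indicator {0..<1} t * ennreal (real N * curve_cell f \<gamma> N (nat \<lfloor>t * real N\<rfloor>))" for N t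
  have J: "curve_value f \<gamma> = integral {0..1} g" unfolding curve_value_def g_def[abs_def] by (rule refl)
  show ?thesis
  proof (cases "g integrable_on {0..1}")
    \<comment> \<open>The \<open>integral\<close> of a nonintegrable function is 0 by default, and
      the bound is trivial.\<close>
    case False
    then show ?thesis by (simp add: J not_integrable_integral)
  next
    case True
    have "ennreal (curve_value f \<gamma>) = (\<integral>\<^sup>+ t. ennreal (indicator {0..1} t * g t) \<partial>lborel)"
      unfolding J using True
      by (subst nn_integral_has_integral_lebesgue[OF _ integrable_integral[OF True]]) (auto simp: g_def)
    also have "\<dots> \<le> (\<integral>\<^sup>+ t. liminf (\<lambda>N. s N t) \<partial>lborel)"
    proof (rule nn_integral_mono_AE)
      \<comment> \<open>The step functions vanish at the right end point.\<close>
      have "AE t in lborel. t \<noteq> (1::real)" by (rule AE_lborel_singleton)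
      then show "AE t in lborel. ennreal (indicator {0..1} t * g t) \<le> liminf (\<lambda>N. s N t)"
      proof eventually_elim
        case (elim t)
        show ?case
        proof (cases "0 \<le> t \<and> t < 1")
          case True
          have "vector_derivative \<gamma> (at t within {0..1}) = \<gamma>' t"
            using True by (intro vector_derivative_within_closed_interval deriv) auto
          then have "(\<lambda>N. real N * curve_cell f \<gamma> N (nat \<lfloor>t * real N\<rfloor>)) \<longlonglongrightarrow> g t"
            unfolding g_def using cell_limit[of t] True by simp
          then have "(\<lambda>N. s N t) \<longlonglongrightarrow> ennreal (g t)"
            unfolding s_def using True by (simp add: tendsto_ennrealI)
          then have "liminf (\<lambda>N. s N t) = ennreal (g t)" by (intro lim_imp_Liminf) auto
          then show ?thesis using True by simp
        next
          case False
          then have "t \<notin> {0..1}" using elim by auto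
          then show ?thesis by simp
        qed
      qed
    qed
    also have "\<dots> \<le> liminf (\<lambda>N. \<integral>\<^sup>+ t. s N t \<partial>lborel)"
      by (rule nn_integral_liminf) (auto simp: s_def[abs_def])
    also have "\<dots> = liminf (\<lambda>N. ennreal (\<Sum>j<N. curve_cell f \<gamma> N j))"
    proof (rule Liminf_eq)
      show "\<forall>\<^sub>F N in sequentially. (\<integral>\<^sup>+ t. s N t \<partial>lborel) = ennreal (\<Sum>j<N. curve_cell f \<gamma> N j)"
        using eventually_ge_at_top[of 1] by eventually_elim (simp add: s_def cell_sum_integral)
    qed
    finally show ?thesis .
  qed
qed

text \<open>Makes \<open>U_fun\<close> the supremum of a bounded set. A cell contributes only if its
  infimum is positive, and then the coordinates of both corners are bounded by \<open>R\<close>. The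
  \<open>d\<close>-th root of its volume is at most the sum of its sides, and these sums
  telescope.\<close>

lemma curve_value_le:
  assumes C: "\<And>x. f x \<le> C" "0 \<le> R" and R: "\<And>x i. f x > 0 \<Longrightarrow> \<bar>x $ i\<bar> \<le> R"
  shows "curve_value f \<gamma> \<le> C powr (1 / real CARD('d)) * (real CARD('d) * (2 * R))"
proof -
  let ?K = "C powr (1 / real CARD('d)) * (real CARD('d) * (2 * R))"
  \<comment> \<open>The curve may run outside the support of \<open>f\<close>; clamping keeps the
    telescoping sum below \<open>2 * R\<close> in each coordinate and leaves the contributing cells
    unchanged.\<close>
  define cl where "cl y = max (- R) (min R y)" for y
  have C0: "C \<ge> 0" using C(1) f_nonneg order_trans by blast
  have K0: "?K \<ge> 0" using C(2) by simp
  have "(\<Sum>j<N. curve_cell f \<gamma> N j) \<le> ?K" for N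
  proof -
    let ?h = "\<lambda>i j. cl (\<gamma> (real j / real N) $ i)"
    have cell: "curve_cell f \<gamma> N j \<le> C powr (1 / real CARD('d)) * (\<Sum>i\<in>UNIV. ?h i (Suc j) - ?h i j)" if j: "j < N" for j
    proof -
      let ?a = "\<gamma> (real j / real N)" and ?b = "\<gamma> ((real j + 1) / real N)"
      let ?m = "Inf (f ` cbox ?a ?b)"
      have ab: "?a $ i \<le> ?b $ i" for i
        using cell_times[of j N] cell_le_1[OF j] by (intro component_mono) auto
      have hmono: "0 \<le> ?h i (Suc j) - ?h i j" for i using ab[of i] by (simp add: cl_def add.commute)
      have m0: "0 \<le> ?m" by (rule cell_inf(1)[OF j])
      show ?thesis
      proof (cases "?m = 0")
        case True
        then show ?thesis using hmono by (simp add: curve_cell_def sum_nonneg)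
      next
        case False
        have mem: "?a \<in> cbox ?a ?b" "?b \<in> cbox ?a ?b" using ab by (auto simp: mem_box_cart)
        have "0 < f ?a" "0 < f ?b"
          using cell_inf(2)[OF j mem(1)] cell_inf(2)[OF j mem(2)] m0 False by linarith+
        then have bd: "\<bar>?a $ i\<bar> \<le> R" "\<bar>?b $ i\<bar> \<le> R" for i using R by auto
        have "?h i (Suc j) - ?h i j = ?b $ i - ?a $ i" for i
          using bd[of i] by (auto simp: cl_def add.commute abs_le_iff max_def min_def)
        then have sum: "(\<Sum>i\<in>UNIV. ?h i (Suc j) - ?h i j) = (\<Sum>i\<in>UNIV. ?b $ i - ?a $ i)" by simp
        let ?S = "\<Sum>i\<in>UNIV. ?b $ i - ?a $ i"
        have S0: "?S \<ge> 0" using ab by (intro sum_nonneg) auto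
        have "box_vol ?a ?b \<le> (\<Prod>i\<in>(UNIV :: 'd set). ?S)"
          unfolding box_vol_def using ab by (intro prod_mono conjI member_le_sum) auto
        then have "box_vol ?a ?b powr (1 / real CARD('d)) \<le> (?S ^ CARD('d)) powr (1 / real CARD('d))"
          using cell_vol_nonneg[OF j] by (intro powr_mono2) auto
        also have "\<dots> = ?S"
        proof (cases "?S = 0")
          case False
          then have "?S > 0" using S0 by linarith
          then show ?thesis using powr_realpow[of ?S "CARD('d)"] by (simp add: powr_powr flip: powr_realpow)
        qed simp
        finally have "box_vol ?a ?b powr (1 / real CARD('d)) \<le> ?S" .
        moreover have "?m \<le> C" using cell_inf(2)[OF j mem(1)] C(1)[of ?a] by linarith
        then have "?m powr (1 / real CARD('d)) \<le> C powr (1 / real CARD('d))" using m0 by (intro powr_mono2) auto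
        ultimately have "?m powr (1 / real CARD('d)) * box_vol ?a ?b powr (1 / real CARD('d)) \<le> C powr (1 / real CARD('d)) * ?S"
          by (intro mult_mono) auto
        then show ?thesis unfolding curve_cell_def sum using m0 cell_vol_nonneg[OF j] by (simp add: powr_mult)
      qed
    qed
    have "(\<Sum>j<N. curve_cell f \<gamma> N j) \<le> (\<Sum>j<N. C powr (1 / real CARD('d)) * (\<Sum>i\<in>UNIV. ?h i (Suc j) - ?h i j))"
      by (intro sum_mono cell) auto
    also have "\<dots> = C powr (1 / real CARD('d)) * (\<Sum>i\<in>UNIV. \<Sum>j<N. ?h i (Suc j) - ?h i j)"
      by (subst sum.swap) (simp add: sum_distrib_left)
    also have "\<dots> = C powr (1 / real CARD('d)) * (\<Sum>i\<in>UNIV. ?h i N - ?h i 0)"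
      by (subst sum_lessThan_telescope) simp
    also have "\<dots> \<le> C powr (1 / real CARD('d)) * (\<Sum>i\<in>(UNIV :: 'd set). 2 * R)"
      using C(2) by (intro mult_left_mono sum_mono) (auto simp: cl_def)
    finally show ?thesis by simp
  qed
  then have "liminf (\<lambda>N. ennreal (\<Sum>j<N. curve_cell f \<gamma> N j)) \<le> liminf (\<lambda>N. ennreal ?K)"
    by (intro Liminf_mono always_eventually allI ennreal_leI)
  also have "\<dots> = ennreal ?K" by (simp add: Liminf_const)
  finally have "ennreal (curve_value f \<gamma>) \<le> ennreal ?K" using curve_value_le_liminf by (rule order_trans[rotated])
  then show ?thesis using K0 by simp
qed

end

lemma curve_chain_lower:
  fixes X :: "nat \<Rightarrow> 'a \<Rightarrow> real^'d" and f :: "real^'d \<Rightarrow> real"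
  assumes M: "prob_space M" and ind: "prob_space.indep_vars M (\<lambda>_. borel) X UNIV"
    and law: "\<And>i. distr M borel (X i) = density lborel (\<lambda>x. ennreal (f x))"
    and f: "f \<in> borel_measurable borel" "(\<integral>\<^sup>+ x. ennreal (f x) \<partial>lborel) = 1"
    and curve: "monotone_curve f \<gamma> \<gamma>'" and z: "\<And>t. t \<in> {0..1} \<Longrightarrow> vle (\<gamma> t) z"
    and x: "x < chain_const TYPE('d) * curve_value f \<gamma>"
  shows "AE \<omega> in M. \<forall>\<^sub>F n in sequentially. x * real n powr (1 / real CARD('d)) \<le> real (u_n X n z \<omega>)"
proof -
  interpret monotone_curve f \<gamma> \<gamma>' by fact
  let ?c = "chain_const TYPE('d)" and ?S = "\<lambda>N. \<Sum>j<N. curve_cell f \<gamma> N j"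
  have c: "?c > 0" by (rule chain_const_growth(1))
  have "\<exists>N\<ge>1. x < ?c * ?S N"
  \<comment> \<open>\<open>ennreal\<close> sends negative numbers to 0, so they are treated
    apart.\<close>
  proof (cases "x < 0")
    case True
    have "0 \<le> ?c * ?S 1" using c curve_cell_nonneg by (intro mult_nonneg_nonneg sum_nonneg) auto
    then show ?thesis using True by (intro exI[of _ 1]) auto
  next
    case False
    then have "0 \<le> x / ?c" "x / ?c < curve_value f \<gamma>" using x c by (auto simp: divide_less_eq mult.commute)
    then have "ennreal (x / ?c) < ennreal (curve_value f \<gamma>)" by (simp add: ennreal_less_iff)
    also note curve_value_le_liminf
    finally have "\<forall>\<^sub>F N in sequentially. ennreal (x / ?c) < ennreal (?S N)" by (rule less_LiminfD)
    then have "\<forall>\<^sub>F N in sequentially. 1 \<le> N \<and> ennreal (x / ?c) < ennreal (?S N)"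
      using eventually_ge_at_top by (rule eventually_conj[rotated])
    then obtain N where N: "1 \<le> N" "ennreal (x / ?c) < ennreal (?S N)"
      using eventually_happens'[OF sequentially_bot] by blast
    then have "x / ?c < ?S N" using \<open>0 \<le> x / ?c\<close> by (simp add: ennreal_less_iff)
    then show ?thesis using N(1) c by (auto simp: divide_less_eq mult.commute)
  qed
  then obtain N where N: "1 \<le> N" "x < ?c * ?S N" by blast
  let ?B = "\<lambda>j. box (\<gamma> (real j / real N)) (\<gamma> ((real j + 1) / real N))"
  \<comment> \<open>The slack is shared equally: each \<open>y j\<close> is strictly below the rate
    of its cell, and their sum is still \<open>x\<close>.\<close>
  define \<eta> where "\<eta> = (?c * ?S N - x) / real N"
  have \<eta>: "\<eta> > 0" using N by (simp add: \<eta>_def)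
  define y where "y j = ?c * curve_cell f \<gamma> N j - \<eta>" for j
  have ysum: "(\<Sum>j<N. y j) = x"
    using N(1) by (simp add: y_def sum_subtractf sum_distrib_left[symmetric] \<eta>_def)
  have "AE \<omega> in M. \<forall>\<^sub>F n in sequentially. y j * real n powr (1 / real CARD('d))
      \<le> real (longest_chain ((\<lambda>i. X i \<omega>) ` {..<n} \<inter> ?B j))" if j: "j < N" for j
  proof (rule box_chain_lower[OF M ind law f(1) f_nonneg f(2)])
    show "\<gamma> (real j / real N) $ i \<le> \<gamma> ((real j + 1) / real N) $ i" for i
      by (rule component_mono[OF cell_times cell_le_1[OF j]])
    show "y j < ?c * (Inf (f ` cbox (\<gamma> (real j / real N)) (\<gamma> ((real j + 1) / real N))) *
       box_vol (\<gamma> (real j / real N)) (\<gamma> ((real j + 1) / real N))) powr (1 / real CARD('d))"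
      using \<eta> by (simp add: y_def curve_cell_def)
    show "0 \<le> Inf (f ` cbox (\<gamma> (real j / real N)) (\<gamma> ((real j + 1) / real N)))" by (rule cell_inf(1)[OF j])
    show "Inf (f ` cbox (\<gamma> (real j / real N)) (\<gamma> ((real j + 1) / real N))) \<le> f p" if "p \<in> ?B j" for p
      using that box_subset_cbox by (intro cell_inf(2)[OF j]) blast
  qed
  then have "AE \<omega> in M. \<forall>j\<in>{..<N}. \<forall>\<^sub>F n in sequentially. y j * real n powr (1 / real CARD('d))
      \<le> real (longest_chain ((\<lambda>i. X i \<omega>) ` {..<n} \<inter> ?B j))"
    by (intro eventually_ball_finite) auto
  then show ?thesis
  proof eventually_elim
    case (elim \<omega>)
    from elim have "\<forall>\<^sub>F n in sequentially. \<forall>j\<in>{..<N}. y j * real n powr (1 / real CARD('d))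
      \<le> real (longest_chain ((\<lambda>i. X i \<omega>) ` {..<n} \<inter> ?B j))"
      by (intro eventually_ball_finite) auto
    then show ?case
    proof eventually_elim
      case (elim n)
      let ?P = "(\<lambda>i. X i \<omega>) ` {..<n}"
      have "x * real n powr (1 / real CARD('d)) = (\<Sum>j<N. y j * real n powr (1 / real CARD('d)))"
        by (simp add: ysum[symmetric] sum_distrib_right)
      also have "\<dots> \<le> (\<Sum>j<N. real (longest_chain (?P \<inter> ?B j)))"
        using elim by (intro sum_mono) auto
      also have "\<dots> = real (\<Sum>j<N. longest_chain (?P \<inter> ?B j))" by simp
      also have "\<dots> \<le> real (longest_chain (?P \<inter> (\<Union>j<N. ?B j)))"
      proof (intro of_nat_mono longest_chain_stack_sum)
        fix i j p q assume ij: "i < j" "j < N" "p \<in> ?B i" "q \<in> ?B j"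
        have "(real i + 1) / real N \<le> real j / real N" using ij by (intro divide_right_mono) auto
        then have "\<gamma> ((real i + 1) / real N) $ l \<le> \<gamma> (real j / real N) $ l" for l
          using ij cell_le_1[of j N] cell_times[of j N] by (intro component_mono) (auto simp: divide_le_eq)
        moreover have "p $ l < \<gamma> ((real i + 1) / real N) $ l" "\<gamma> (real j / real N) $ l < q $ l" for l
          using ij by (auto simp: mem_box_cart)
        ultimately have "p $ l < q $ l" for l by (meson le_less_trans less_trans)
        then show "vle p q \<and> p \<noteq> q" by (metis less_imp_le less_irrefl vle_def)
      qed simp
      also have "\<dots> \<le> real (longest_chain {X i \<omega> | i. i < n \<and> vle (X i \<omega>) z})"
      proof (intro of_nat_mono longest_chain_mono subsetI)
        show "finite {X i \<omega> | i. i < n \<and> vle (X i \<omega>) z}" by simp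
        fix p assume p: "p \<in> ?P \<inter> (\<Union>j<N. ?B j)"
        then obtain i j where ij: "p = X i \<omega>" "i < n" "j < N" "p \<in> ?B j" by auto
        have "vle (\<gamma> ((real j + 1) / real N)) z"
          using cell_le_1[OF ij(3)] by (intro z) auto
        then have "vle p z" using ij(4) unfolding vle_def mem_box_cart by (meson less_imp_le order_trans)
        then show "p \<in> {X i \<omega> | i. i < n \<and> vle (X i \<omega>) z}" using ij by auto
      qed
      finally show ?case by (simp add: u_n_def)
    qed
  qed
qed

section \<open>From single curves to the supremum\<close>

theorem theorem3p6:
  fixes \<Omega> :: "(real^'d) set" and f :: "real^'d \<Rightarrow> real" and m :: "real \<Rightarrow> real"
    and M :: "'a measure" and X :: "nat \<Rightarrow> 'a \<Rightarrow> real^'d" and z :: "real^'d"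
  assumes d2: "CARD('d) \<ge> 2"
    and \<Omega>_pos: "\<Omega> \<subseteq> {x. \<forall>i. 0 < x $ i}"
    and \<Omega>_open: "open \<Omega>" and \<Omega>_bdd: "bounded \<Omega>" and \<Omega>_lip: "lipschitz_boundary \<Omega>"
    and f_meas: "f \<in> borel_measurable lborel"
    and f_nonneg: "\<And>x. 0 \<le> f x"
    and f_prob: "(\<integral>\<^sup>+ x. ennreal (f x) \<partial>lborel) = 1"
    and m_cont: "continuous_on {0..} m" and m_mono: "mono_on {0..} m"
    and m_nonneg: "\<And>t. 0 \<le> t \<Longrightarrow> 0 \<le> m t" and m0: "m 0 = 0"
    and f_modulus: "\<And>x y. x \<in> \<Omega> \<Longrightarrow> y \<in> \<Omega> \<Longrightarrow> \<bar>f x - f y\<bar> \<le> m (dist x y)"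
    and f_out: "\<And>x. x \<notin> \<Omega> \<Longrightarrow> f x = 0"
    and M_prob: "prob_space M"
    and X_indep: "prob_space.indep_vars M (\<lambda>_. borel) X UNIV"
    and X_distr: "\<And>i. distributed M lborel (X i) (\<lambda>x. ennreal (f x))"
  shows "AE \<omega> in M. liminf (\<lambda>n. ereal (real n powr (- 1 / real CARD('d)) * real (u_n X n z \<omega>)))
                      \<ge> ereal (chain_const TYPE('d) * U_fun f z)"
proof -
  let ?d = "real CARD('d)" and ?c = "chain_const TYPE('d)"
  have f_borel: "f \<in> borel_measurable borel" using f_meas by simp
  have law: "distr M borel (X i) = density lborel (\<lambda>x. ennreal (f x))" for i
    by (rule distr_of_distributed[OF X_distr])
  \<comment> \<open>Inside the open set the modulus gives continuity; outside,
    \<open>f p = 0\<close> is the minimum of \<open>f\<close>.\<close>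
  have lsc: "\<exists>\<rho>>0. \<forall>y. dist y p < \<rho> \<longrightarrow> f p - e < f y" if e: "e > 0" for p e
  proof (cases "p \<in> \<Omega>")
    case True
    obtain r where r: "r > 0" "ball p r \<subseteq> \<Omega>" using \<Omega>_open True open_contains_ball by blast
    obtain \<delta> where \<delta>: "\<delta> > 0" "\<And>s. s \<in> {0..} \<Longrightarrow> dist s 0 < \<delta> \<Longrightarrow> dist (m s) (m 0) < e"
      using m_cont e unfolding continuous_on_iff by (metis atLeast_iff order_refl)
    have "f p - e < f y" if y: "dist y p < min r \<delta>" for y
    proof -
      have "y \<in> \<Omega>" using r y by (auto simp: dist_commute)
      then have "\<bar>f p - f y\<bar> \<le> m (dist p y)" using f_modulus True by blast
      also have "\<dots> < e" using \<delta>(2)[of "dist p y"] y m0 by (auto simp: dist_commute)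
      finally show ?thesis by linarith
    qed
    then show ?thesis using r(1) \<delta>(1) by (intro exI[of _ "min r \<delta>"]) auto
  next
    case False
    have "f p - e < f y" for y using f_out[OF False] f_nonneg[of y] e by linarith
    then show ?thesis by (intro exI[of _ 1]) auto
  qed
  obtain R where R: "R > 0" "\<And>x. x \<in> \<Omega> \<Longrightarrow> norm x \<le> R" using \<Omega>_bdd bounded_pos by blast
  \<comment> \<open>The modulus bounds the oscillation of \<open>f\<close> on a bounded set by its
    value at the diameter, here estimated by \<open>2 * R\<close>.\<close>
  obtain C where C: "\<And>x. f x \<le> C"
  proof (cases "\<Omega> = {}")
    case True
    then show ?thesis using that[of 0] f_out by simp
  next
    case False
    then obtain x0 where x0: "x0 \<in> \<Omega>" by blast
    have "f x \<le> f x0 + m (2 * R)" for x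
    proof (cases "x \<in> \<Omega>")
      case True
      have "dist x x0 \<le> 2 * R" using R(2)[OF True] R(2)[OF x0] norm_triangle_ineq4[of x x0] by (simp add: dist_norm)
      then have "m (dist x x0) \<le> m (2 * R)" using R(1) by (intro mono_onD[OF m_mono]) auto
      then show ?thesis using f_modulus[OF True x0] by linarith
    next
      case False
      then show ?thesis using f_out f_nonneg[of x0] m_nonneg[of "2 * R"] R(1) by simp
    qed
    then show ?thesis by (rule that)
  qed
  let ?A = "{\<gamma>. admissible \<gamma> \<and> (\<forall>t\<in>{0..1}. vle (\<gamma> t) z)}"
  have curve: "\<exists>\<gamma>'. monotone_curve f \<gamma> \<gamma>'" if "\<gamma> \<in> ?A" for \<gamma>
    using that f_nonneg lsc unfolding admissible_def monotone_curve_def by blast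
  let ?K = "C powr (1 / ?d) * (?d * (2 * R))"
  have "curve_value f \<gamma> \<le> ?K" if \<gamma>: "\<gamma> \<in> ?A" for \<gamma>
  proof -
    obtain \<gamma>' where "monotone_curve f \<gamma> \<gamma>'" using curve[OF \<gamma>] by blast
    then show ?thesis
    proof (rule monotone_curve.curve_value_le[OF _ C])
      show "\<bar>x $ i\<bar> \<le> R" if "f x > 0" for x i
        using R(2)[of x] f_out[of x] that component_le_norm_cart[of x i] by fastforce
    qed (use R in auto)
  qed
  then have bdd: "bdd_above (curve_value f ` ?A)" by (intro bdd_aboveI2)
  \<comment> \<open>The diagonal segment ending at \<open>z\<close> shows that the supremum is over
    a nonempty set.\<close>
  have "(\<lambda>t. z + (t - 1) *\<^sub>R 1) \<in> ?A"
  proof -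
    have "admissible (\<lambda>t. z + (t - 1) *\<^sub>R (1 :: real^'d))"
      unfolding admissible_def
      by (intro exI[of _ "\<lambda>_. 1"] conjI ballI) (auto intro!: derivative_eq_intros continuous_intros simp: vec_eq_iff)
    then show ?thesis by (auto simp: vle_def)
  qed
  then have ne: "?A \<noteq> {}" by blast
  \<comment> \<open>Countably many rates strictly below the claimed one: each is reached by some
    curve, and the exceptional null sets can be united.\<close>
  define x where "x k = ?c * (U_fun f z - inverse (real (Suc k)))" for k
  have "AE \<omega> in M. \<forall>\<^sub>F n in sequentially. x k * real n powr (1 / ?d) \<le> real (u_n X n z \<omega>)" for k
  proof -
    have "U_fun f z - inverse (real (Suc k)) < (SUP \<gamma>\<in>?A. curve_value f \<gamma>)" by (simp add: U_fun_def)
    then obtain \<gamma> where \<gamma>: "\<gamma> \<in> ?A" "U_fun f z - inverse (real (Suc k)) < curve_value f \<gamma>"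
      using less_cSUP_iff[OF ne bdd] by blast
    obtain \<gamma>' where "monotone_curve f \<gamma> \<gamma>'" using curve[OF \<gamma>(1)] by blast
    moreover have "x k < ?c * curve_value f \<gamma>"
      unfolding x_def using \<gamma>(2) chain_const_growth(1)[where 'd = 'd] by (intro mult_strict_left_mono) auto
    ultimately show ?thesis
      using \<gamma>(1) by (intro curve_chain_lower[OF M_prob X_indep law f_borel f_prob]) auto
  qed
  then have "AE \<omega> in M. \<forall>k. \<forall>\<^sub>F n in sequentially. x k * real n powr (1 / ?d) \<le> real (u_n X n z \<omega>)"
    by (simp add: AE_all_countable)
  then show ?thesis
  proof eventually_elim
    case (elim \<omega>)
    let ?l = "liminf (\<lambda>n. ereal (real n powr (- 1 / ?d) * real (u_n X n z \<omega>)))"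
    have xl: "ereal (x k) \<le> ?l" for k
    proof (rule Liminf_bounded)
      show "\<forall>\<^sub>F n in sequentially. ereal (x k) \<le> ereal (real n powr (- 1 / ?d) * real (u_n X n z \<omega>))"
        using elim[rule_format, of k] eventually_gt_at_top[of 0]
      proof eventually_elim
        case (elim n)
        then have "x k \<le> real (u_n X n z \<omega>) / real n powr (1 / ?d)" by (subst pos_le_divide_eq) auto
        then show ?case by (simp add: powr_minus_divide)
      qed
    qed
    have "x \<longlonglongrightarrow> ?c * (U_fun f z - 0)"
      unfolding x_def by (intro tendsto_intros LIMSEQ_inverse_real_of_nat)
    then have "(\<lambda>k. ereal (x k)) \<longlonglongrightarrow> ereal (?c * U_fun f z)" by (simp add: tendsto_ereal)
    then show ?case by (rule LIMSEQ_le_const2) (use xl in auto)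
  qed
qed

end
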